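(* Let $x=t^{-1/3}$. The assignment $\rho_1$ on the generators $\sigma_1,\sigma_2,\alpha_1,\alpha_2$ of $C_3$ given in the context defines a linear representation $\rho_1:C_3\to\mathrm{GL}(V_3)$ which is an extension to $C_3$ of the Lawrence–Krammer representation $\rho$ of $B_3=\langle\sigma_1,\sigma_2\rangle$.
   Context: $F_3$ is the free group on $x_1,x_2,x_3$; $C_3\le\mathrm{Aut}(F_3)$ is the group of conjugating automorphisms, i.e. those sending each $x_i$ to $f_i^{-1}x_{\pi(i)}f_i$ with $f_i\in F_3$, $\pi\in S_3$. It is generated by, for $i=1,2$, $\sigma_i: x_i\mapsto x_ix_{i+1}x_i^{-1},\ x_{i+1}\mapsto x_i$, the remaining generator fixed, and $\alpha_i: x_i\mapsto x_{i+1},\ x_{i+1}\mapsto x_i$, the remaining generator fixed. The braid group $B_3$ is the subgroup generated by $\sigma_1,\sigma_2$. Products of automorphisms are read from left to right, and action on modules is a right action ($v^{gh}=(v^g)^h$), so products in $\mathrm{GL}(V_3)$ are also read from left to right. $V_3$ is the free module with basis $v_{12},v_{13},v_{23}$ over $\mathbb{Z}[t^{\pm1/3},q^{\pm1}]$ (Laurent polynomials in $t^{1/3}$ and $q$). The Lawrence–Krammer representation $\rho$ of $B_3$ is $\sigma_1$: $v_{12}\mapsto tq^2v_{12}$, $v_{13}\mapsto tq(q-1)v_{12}+(1-q)v_{13}+qv_{23}$, $v_{23}\mapsto v_{13}$; $\sigma_2$: $v_{12}\mapsto(1-q)v_{12}+qv_{13}+q(q-1)v_{23}$, $v_{13}\mapsto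 v_{12}$, $v_{23}\mapsto tq^2v_{23}$. One sets $\rho_1(\sigma_i)=\rho(\sigma_i)$, and $\rho_1(\alpha_i)$ is given by $\alpha_1$: $v_{12}\mapsto v_{12}$, $v_{13}\mapsto xv_{23}$, $v_{23}\mapsto x^{-1}v_{13}$; $\alpha_2$: $v_{12}\mapsto xv_{13}$, $v_{13}\mapsto x^{-1}v_{12}$, $v_{23}\mapsto v_{23}$. *)

theory Defs
  imports
    "HOL-Combinatorics.Permutations"
    "HOL-Library.Poly_Mapping"
    "HOL-Library.Product_Plus"
    "HOL-Analysis.Cartesian_Space"
    "HOL-Algebra.Bij"
    "HOL-Algebra.Generated_Groups"
begin

section \<open>Free groups\<close>

text \<open>Group words: the letter \<open>(i, True)\<close> stands for the generator \<open>x\<^sub>i\<close>, and \<open>(i, False)\<close>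
  for its inverse. Elements of the free group are the freely reduced words.\<close>

type_synonym 'a gword = "('a \<times> bool) list"

definition inverse_letters :: "'a \<times> bool \<Rightarrow> 'a \<times> bool \<Rightarrow> bool" where
  "inverse_letters a b \<longleftrightarrow> fst a = fst b \<and> snd a \<noteq> snd b"

definition reduced_word :: "'a gword \<Rightarrow> bool" where
  "reduced_word w \<longleftrightarrow> successively (\<lambda>a b. \<not> inverse_letters a b) w"

definition prepend_letter :: "'a \<times> bool \<Rightarrow> 'a gword \<Rightarrow> 'a gword" where
  "prepend_letter a w =
    (case w of [] \<Rightarrow> [a] | b # w' \<Rightarrow> if inverse_letters a b then w' else a # w)"

definition free_group :: "'a set \<Rightarrow> 'a gword monoid" where
  "free_group S =
    \<lparr>carrier = {w. reduced_word w \<and> fst ` set w \<subseteq> S},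
     mult = (\<lambda>u v. foldr prepend_letter u v),
     one = []\<rparr>"

definition gen :: "'a \<Rightarrow> 'a gword" where
  "gen i = [(i, True)]"

text \<open>The homomorphism from the free group on \<open>S\<close> to \<open>G\<close> with \<open>x\<^sub>i \<mapsto> f i\<close>.\<close>

definition free_group_lift ::
    "'a set \<Rightarrow> ('b, 'c) monoid_scheme \<Rightarrow> ('a \<Rightarrow> 'b) \<Rightarrow> 'a gword \<Rightarrow> 'b" where
  "free_group_lift S G f =
    (\<lambda>w\<in>carrier (free_group S).
       foldr (\<lambda>(i, b) u. (if b then f i else inv\<^bsub>G\<^esub> (f i)) \<otimes>\<^bsub>G\<^esub> u) w \<one>\<^bsub>G\<^esub>)"

section \<open>Conjugating automorphisms and the braid group\<close>

definition F3 :: "nat gword monoid" where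
  "F3 = free_group {1, 2, 3}"

text \<open>Products of automorphisms are read from left to right, whereas the product of
  \<^const>\<open>AutoGroup\<close> is composition of functions; hence the opposite group.\<close>

definition opposite_group :: "'a monoid \<Rightarrow> 'a monoid" where
  "opposite_group G = G\<lparr>mult := (\<lambda>a b. b \<otimes>\<^bsub>G\<^esub> a)\<rparr>"

definition conjugating :: "(nat gword \<Rightarrow> nat gword) \<Rightarrow> bool" where
  "conjugating \<phi> \<longleftrightarrow>
    (\<exists>\<pi> f. \<pi> permutes {1, 2, 3} \<and>
      (\<forall>i\<in>{1, 2, 3}. f i \<in> carrier F3 \<and>
         \<phi> (gen i) = inv\<^bsub>F3\<^esub> (f i) \<otimes>\<^bsub>F3\<^esub> gen (\<pi> i) \<otimes>\<^bsub>F3\<^esub> f i))"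

definition C3 :: "(nat gword \<Rightarrow> nat gword) monoid" where
  "C3 = (opposite_group (AutoGroup F3))\<lparr>carrier := {\<phi> \<in> auto F3. conjugating \<phi>}\<rparr>"

definition sigma :: "nat \<Rightarrow> nat gword \<Rightarrow> nat gword" where
  "sigma i = free_group_lift {1, 2, 3} F3
    (\<lambda>j. if j = i then gen i \<otimes>\<^bsub>F3\<^esub> gen (i + 1) \<otimes>\<^bsub>F3\<^esub> inv\<^bsub>F3\<^esub> (gen i)
         else if j = i + 1 then gen i
         else gen j)"

definition alpha :: "nat \<Rightarrow> nat gword \<Rightarrow> nat gword" where
  "alpha i = free_group_lift {1, 2, 3} F3
    (\<lambda>j. if j = i then gen (i + 1) else if j = i + 1 then gen i else gen j)"

definition B3 :: "(nat gword \<Rightarrow> nat gword) monoid" where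
  "B3 = C3\<lparr>carrier := generate C3 {sigma 1, sigma 2}\<rparr>"

section \<open>The module and its general linear group\<close>

text \<open>Laurent polynomials in \<open>t\<^bsup>1/3\<^esup>\<close> and \<open>q\<close> over the integers, as the group ring of \<open>\<int> \<times> \<int>\<close>:
  the exponent pair \<open>(a, b)\<close> stands for \<open>t\<^bsup>a/3\<^esup> q\<^bsup>b\<^esup>\<close>.\<close>

type_synonym laurent = "(int \<times> int) \<Rightarrow>\<^sub>0 int"

definition laurent_monom :: "int \<Rightarrow> int \<Rightarrow> laurent" where
  "laurent_monom a b = Poly_Mapping.single (a, b) 1"

definition t_var :: laurent where "t_var = laurent_monom 3 0"
definition q_var :: laurent where "q_var = laurent_monom 0 1"

text \<open>\<open>x = t\<^bsup>-1/3\<^esup>\<close> and \<open>x\<^bsup>-1\<^esup> = t\<^bsup>1/3\<^esup>\<close>\<close>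

definition x_var :: laurent where "x_var = laurent_monom (- 1) 0"
definition x_inv :: laurent where "x_inv = laurent_monom 1 0"

type_synonym V3 = "laurent ^ 3"

definition v12 :: V3 where "v12 = axis 1 1"
definition v13 :: V3 where "v13 = axis 2 1"
definition v23 :: V3 where "v23 = axis 3 1"

text \<open>The action on modules is a right action, so the product of \<open>g\<close> and \<open>h\<close> applies \<open>g\<close> first.\<close>

definition GL_V3 :: "(V3 \<Rightarrow> V3) monoid" where
  "GL_V3 =
    \<lparr>carrier = {g. module_hom ((*s) :: laurent \<Rightarrow> V3 \<Rightarrow> V3) (*s) g \<and> bij g},
     mult = (\<lambda>g h. h \<circ> g),
     one = id\<rparr>"

text \<open>The linear map with \<open>v\<^sub>1\<^sub>2 \<mapsto> a\<close>, \<open>v\<^sub>1\<^sub>3 \<mapsto> b\<close>, \<open>v\<^sub>2\<^sub>3 \<mapsto> c\<close>.\<close>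

definition linear_ext :: "V3 \<Rightarrow> V3 \<Rightarrow> V3 \<Rightarrow> V3 \<Rightarrow> V3" where
  "linear_ext a b c v = v $ 1 *s a + v $ 2 *s b + v $ 3 *s c"

section \<open>The assignments on generators\<close>

definition LK_sigma1 :: "V3 \<Rightarrow> V3" where
  "LK_sigma1 = linear_ext
     ((t_var * q_var ^ 2) *s v12)
     ((t_var * q_var * (q_var - 1)) *s v12 + (1 - q_var) *s v13 + q_var *s v23)
     v13"

definition LK_sigma2 :: "V3 \<Rightarrow> V3" where
  "LK_sigma2 = linear_ext
     ((1 - q_var) *s v12 + q_var *s v13 + (q_var * (q_var - 1)) *s v23)
     v12
     ((t_var * q_var ^ 2) *s v23)"

definition rho1_alpha1 :: "V3 \<Rightarrow> V3" where
  "rho1_alpha1 = linear_ext v12 (x_var *s v23) (x_inv *s v13)"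

definition rho1_alpha2 :: "V3 \<Rightarrow> V3" where
  "rho1_alpha2 = linear_ext (x_var *s v13) (x_inv *s v12) v23"

definition is_Lawrence_Krammer :: "((nat gword \<Rightarrow> nat gword) \<Rightarrow> V3 \<Rightarrow> V3) \<Rightarrow> bool" where
  "is_Lawrence_Krammer \<rho> \<longleftrightarrow>
     group_hom B3 GL_V3 \<rho> \<and> \<rho> (sigma 1) = LK_sigma1 \<and> \<rho> (sigma 2) = LK_sigma2"

definition is_rho1 :: "((nat gword \<Rightarrow> nat gword) \<Rightarrow> V3 \<Rightarrow> V3) \<Rightarrow> bool" where
  "is_rho1 \<rho>\<^sub>1 \<longleftrightarrow>
     group_hom C3 GL_V3 \<rho>\<^sub>1 \<and>
     \<rho>\<^sub>1 (sigma 1) = LK_sigma1 \<and> \<rho>\<^sub>1 (sigma 2) = LK_sigma2 \<and>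
     \<rho>\<^sub>1 (alpha 1) = rho1_alpha1 \<and> \<rho>\<^sub>1 (alpha 2) = rho1_alpha2"

end

theory Submission
  imports Defs "HOL-Algebra.Elementary_Groups" "HOL-Library.Sublist"
begin

text \<open>
  Write \<open>c(i, j)\<close> for the automorphism \<open>x\<^sub>i \<mapsto> x\<^sub>j x\<^sub>i x\<^sub>j\<^bsup>-1\<^esup>\<close> fixing the other two generators.
  Then \<open>\<sigma>\<^sub>1 = \<alpha>\<^sub>1 c(2, 1)\<close> and \<open>\<sigma>\<^sub>2 = \<alpha>\<^sub>2 c(3, 2)\<close>, so the proposed values of \<open>\<rho>\<^sub>1\<close> determine values on all
  six \<open>c(i, j)\<close>. The product of \<open>c(i, j)\<close> and \<open>c(k, j)\<close>, for \<open>{i, j, k} = {1, 2, 3}\<close>, is conjugation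
  by \<open>x\<^sub>j\<close>, and a computation with three by three matrices shows that it is sent to the scalar
  \<open>(t\<^bsup>1/3\<^esup> q)\<^sup>2\<close>. This is where \<open>x = t\<^bsup>-1/3\<^esup>\<close> is needed.

  Modulo inner automorphisms \<open>c(i, j)\<close> and \<open>c(k, j)\<close> are therefore inverse to each other, so three
  elements, the \<open>twist j\<close>, suffice to generate the pure automorphisms (those sending each \<open>x\<^sub>i\<close> to a
  conjugate of itself) modulo inner ones. The decisive fact is that they generate a free group of
  rank three there: a nonempty reduced word in the twists is never inner
  (\<open>word_auto_not_inner\<close>). Hence the twists can be given arbitrary values, and every relation of
  \<open>C\<^sub>3\<close> follows from the way inner automorphisms are permuted by conjugation, from the relations of
  \<open>S\<^sub>3\<close>, and from the six formulas for \<open>\<alpha>\<^sub>i (twist j) \<alpha>\<^sub>i\<close>; those are verified for the matrices.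

  Formally, the homomorphism is obtained from its graph. In the product of \<open>C\<^sub>3\<close> and \<open>GL(V\<^sub>3)\<close> the
  pairs (generator, value) generate a subgroup contained in the set of all products
  (inner pair)(word in the twist pairs)(permutation pair). If the first component of such a product
  is trivial, then so is its permutation part, hence its word is inner and therefore empty, hence its
  inner part is trivial, since the free group has trivial centre (\<open>all_pairs_kernel\<close>).

  The freeness proof follows the axes of the three images of the generators in the Cayley tree of the
  free group, see \<open>separated\<close>. Uniqueness of \<open>\<rho>\<^sub>1\<close>, as well as its being defined everywhere,
  needs that \<open>C\<^sub>3\<close> is generated by \<open>\<sigma>\<^sub>1, \<sigma>\<^sub>2, \<alpha>\<^sub>1, \<alpha>\<^sub>2\<close> (\<open>C3_generated\<close>). This is a Nielsen
  reduction: as long as a pure automorphism is not the identity, composing it with some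
  \<open>c(i, j)\<^bsup>\<plusminus>1\<^esup>\<close> shortens the image of a generator, because otherwise the images could not generate
  the free group.
\<close>

section \<open>Free groups of reduced words\<close>

definition flip_letter :: "'a \<times> bool \<Rightarrow> 'a \<times> bool" where
  "flip_letter a = (fst a, \<not> snd a)"

definition flip_word :: "'a gword \<Rightarrow> 'a gword" where
  "flip_word w = rev (map flip_letter w)"

lemma inverse_letters_iff: "inverse_letters a b \<longleftrightarrow> b = flip_letter a"
  by (auto simp: inverse_letters_def flip_letter_def prod_eq_iff)

lemma flip_letter_simps [simp]:
  "fst (flip_letter a) = fst a" "snd (flip_letter a) = (\<not> snd a)"
  "flip_letter (flip_letter a) = a" "flip_letter a \<noteq> a" "a \<noteq> flip_letter a"
  by (auto simp: flip_letter_def prod_eq_iff)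

lemma flip_letter_Pair [simp]: "flip_letter (i, b) = (i, \<not> b)"
  by (simp add: flip_letter_def)

lemma reduced_Nil [simp]: "reduced_word []"
  by (simp add: reduced_word_def)

lemma reduced_Cons: "reduced_word (a # w) \<longleftrightarrow> reduced_word w \<and> (w = [] \<or> hd w \<noteq> flip_letter a)"
  by (auto simp: reduced_word_def successively_Cons inverse_letters_iff)

lemma reduced_append:
  "reduced_word (u @ v) \<longleftrightarrow>
     reduced_word u \<and> reduced_word v \<and> (u = [] \<or> v = [] \<or> hd v \<noteq> flip_letter (last u))"
  by (auto simp: reduced_word_def successively_append_iff inverse_letters_iff)

lemma prepend_letter_Cons:
  "prepend_letter a (b # w) = (if b = flip_letter a then w else a # b # w)"
  by (simp add: prepend_letter_def inverse_letters_iff)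

lemma prepend_letter_Nil [simp]: "prepend_letter a [] = [a]"
  by (simp add: prepend_letter_def)

lemma prepend_letter_no_cancel: "w = [] \<or> hd w \<noteq> flip_letter a \<Longrightarrow> prepend_letter a w = a # w"
  by (cases w) (auto simp: prepend_letter_Cons)

lemma reduced_prepend: "reduced_word w \<Longrightarrow> reduced_word (prepend_letter a w)"
  by (cases w) (auto simp: prepend_letter_Cons reduced_Cons)

lemma prepend_flip_cancel:
  assumes "reduced_word w"
  shows "prepend_letter (flip_letter a) (prepend_letter a w) = w"
proof (cases w)
  case (Cons b v)
  then show ?thesis
    using assms by (cases "b = flip_letter a") (simp_all add: prepend_letter_Cons reduced_Cons prepend_letter_no_cancel)
qed (simp add: prepend_letter_Cons)

lemma reduced_foldr_prepend: "reduced_word v \<Longrightarrow> reduced_word (foldr prepend_letter u v)"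
  by (induction u) (auto simp: reduced_prepend)

text \<open>
  Since prepending a letter and then its inverse is the identity on reduced words
  (\<open>prepend_flip_cancel\<close>), the monoid of functions generated by the prepending operations respects
  free cancellation. Associativity rests on this lemma.
\<close>
lemma foldr_prepend_prepend:
  assumes "reduced_word u" "reduced_word v"
  shows "foldr prepend_letter (prepend_letter a u) v = prepend_letter a (foldr prepend_letter u v)"
proof (cases u)
  case (Cons b w)
  then show ?thesis
    using prepend_flip_cancel[OF reduced_foldr_prepend[OF assms(2), of w], of b]
    by (auto simp: prepend_letter_Cons)
qed simp

lemma foldr_prepend_assoc:
  assumes "reduced_word v" "reduced_word w"
  shows "foldr prepend_letter (foldr prepend_letter u v) w
       = foldr prepend_letter u (foldr prepend_letter v w)"
  using assms by (induction u) (auto simp: foldr_prepend_prepend reduced_foldr_prepend)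

lemma foldr_prepend_append: "reduced_word (u @ v) \<Longrightarrow> foldr prepend_letter u v = u @ v"
proof (induction u)
  case (Cons a u)
  then have "foldr prepend_letter u v = u @ v" "u @ v = [] \<or> hd (u @ v) \<noteq> flip_letter a"
    by (auto simp: reduced_Cons)
  then show ?case by (simp add: prepend_letter_no_cancel)
qed simp

lemma foldr_prepend_Nil: "reduced_word u \<Longrightarrow> foldr prepend_letter u [] = u"
  using foldr_prepend_append[of u "[]"] by simp

lemma reduced_flip_word [simp]: "reduced_word (flip_word w) \<longleftrightarrow> reduced_word w"
proof -
  have "(\<lambda>x y. \<not> inverse_letters (flip_letter y) (flip_letter x)) = (\<lambda>x y. \<not> inverse_letters x (y :: 'a \<times> bool))"
    by (auto simp: fun_eq_iff inverse_letters_def)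
  then show ?thesis
    by (simp only: reduced_word_def flip_word_def successively_rev successively_map)
qed

lemma foldr_flip_word: "foldr prepend_letter (flip_word w) w = []"
  by (induction w) (auto simp: flip_word_def prepend_letter_Cons)

lemma set_prepend: "fst ` set (prepend_letter a w) \<subseteq> insert (fst a) (fst ` set w)"
  by (cases w) (auto simp: prepend_letter_Cons)

lemma set_foldr_prepend: "fst ` set (foldr prepend_letter u v) \<subseteq> fst ` set u \<union> fst ` set v"
proof (induction u)
  case (Cons a u)
  then have "insert (fst a) (fst ` set (foldr prepend_letter u v)) \<subseteq> fst ` set (a # u) \<union> fst ` set v"
    by auto
  from order_trans[OF set_prepend this] show ?case by simp
qed simp

lemma carrier_free_group:
  "w \<in> carrier (free_group S) \<longleftrightarrow> reduced_word w \<and> fst ` set w \<subseteq> S"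
  by (simp add: free_group_def)

lemma mult_free_group: "u \<otimes>\<^bsub>free_group S\<^esub> v = foldr prepend_letter u v"
  by (simp add: free_group_def)

lemma one_free_group: "\<one>\<^bsub>free_group S\<^esub> = []"
  by (simp add: free_group_def)

lemma flip_word_in_free_group:
  "w \<in> carrier (free_group S) \<Longrightarrow> flip_word w \<in> carrier (free_group S)"
  by (simp add: carrier_free_group) (simp add: flip_word_def image_image)

lemma group_free_group: "group (free_group S)"
proof (rule groupI)
  fix u v w assume "u \<in> carrier (free_group S)" "v \<in> carrier (free_group S)"
  then show "u \<otimes>\<^bsub>free_group S\<^esub> v \<in> carrier (free_group S)"
    using order_trans[OF set_foldr_prepend[of u v]]
    by (simp add: carrier_free_group mult_free_group reduced_foldr_prepend)
next
  fix u assume "u \<in> carrier (free_group S)"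
  then have "flip_word u \<in> carrier (free_group S)" "flip_word u \<otimes>\<^bsub>free_group S\<^esub> u = \<one>\<^bsub>free_group S\<^esub>"
    by (simp_all add: flip_word_in_free_group mult_free_group one_free_group foldr_flip_word)
  then show "\<exists>v\<in>carrier (free_group S). v \<otimes>\<^bsub>free_group S\<^esub> u = \<one>\<^bsub>free_group S\<^esub>" by blast
qed (auto simp: carrier_free_group mult_free_group one_free_group foldr_prepend_assoc)

lemma inv_free_group:
  assumes "u \<in> carrier (free_group S)"
  shows "inv\<^bsub>free_group S\<^esub> u = flip_word u"
proof (rule group.inv_equality[OF group_free_group])
  show "flip_word u \<in> carrier (free_group S)"
    using assms by (rule flip_word_in_free_group)
qed (use assms in \<open>simp_all add: mult_free_group one_free_group foldr_flip_word\<close>)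

lemma mult_free_group_append:
  "reduced_word (u @ v) \<Longrightarrow> u \<otimes>\<^bsub>free_group S\<^esub> v = u @ v"
  by (simp add: mult_free_group foldr_prepend_append)

lemma gen_in_free_group: "i \<in> S \<Longrightarrow> gen i \<in> carrier (free_group S)"
  by (simp add: gen_def carrier_free_group reduced_Cons)

lemma inv_gen: "i \<in> S \<Longrightarrow> inv\<^bsub>free_group S\<^esub> (gen i) = [(i, False)]"
  by (simp add: inv_free_group gen_in_free_group) (simp add: gen_def flip_word_def)

lemma Cons_eq_mult:
  assumes "a # w \<in> carrier (free_group S)"
  shows "a # w = [a] \<otimes>\<^bsub>free_group S\<^esub> w" "w \<in> carrier (free_group S)"
        "[a] \<in> carrier (free_group S)"
  using assms by (auto simp: carrier_free_group mult_free_group_append reduced_Cons)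

section \<open>Homomorphisms out of a free group\<close>

definition letter_value :: "('b, 'c) monoid_scheme \<Rightarrow> ('a \<Rightarrow> 'b) \<Rightarrow> 'a \<times> bool \<Rightarrow> 'b" where
  "letter_value G f a = (if snd a then f (fst a) else inv\<^bsub>G\<^esub> (f (fst a)))"

lemma free_group_lift_altdef:
  "free_group_lift S G f =
    (\<lambda>w\<in>carrier (free_group S). foldr (\<lambda>a u. letter_value G f a \<otimes>\<^bsub>G\<^esub> u) w \<one>\<^bsub>G\<^esub>)"
  unfolding free_group_lift_def letter_value_def by (simp add: case_prod_unfold)

lemma free_group_lift_hom:
  assumes G: "group G" and f: "\<And>i. i \<in> S \<Longrightarrow> f i \<in> carrier G"
  shows "free_group_lift S G f \<in> hom (free_group S) G"
proof -
  interpret G: group G by fact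
  let ?l = "letter_value G f" and ?v = "\<lambda>w. foldr (\<lambda>a u. letter_value G f a \<otimes>\<^bsub>G\<^esub> u) w \<one>\<^bsub>G\<^esub>"
  have l: "?l a \<in> carrier G" if "fst a \<in> S" for a
    using f that by (auto simp: letter_value_def)
  have l_flip: "?l a \<otimes>\<^bsub>G\<^esub> ?l (flip_letter a) = \<one>\<^bsub>G\<^esub>" if "fst a \<in> S" for a
    using f that by (auto simp: letter_value_def)
  have v: "?v w \<in> carrier G" if "fst ` set w \<subseteq> S" for w
    using that by (induction w) (auto simp: l)
  have prep: "?v (prepend_letter a w) = ?l a \<otimes>\<^bsub>G\<^esub> ?v w" if "fst a \<in> S" "fst ` set w \<subseteq> S" for a w
    using that by (cases w) (auto simp: prepend_letter_Cons G.m_assoc[symmetric] l l_flip v)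
  have "?v (foldr prepend_letter u w) = ?v u \<otimes>\<^bsub>G\<^esub> ?v w"
    if "fst ` set u \<subseteq> S" "fst ` set w \<subseteq> S" for u w
    using that
  proof (induction u)
    case (Cons a u)
    have "fst ` set (foldr prepend_letter u w) \<subseteq> S"
      using order_trans[OF set_foldr_prepend[of u w]] Cons.prems by simp
    with Cons show ?case by (simp add: prep G.m_assoc l v)
  qed (simp add: v)
  moreover have "u \<otimes>\<^bsub>free_group S\<^esub> w \<in> carrier (free_group S)"
    if "u \<in> carrier (free_group S)" "w \<in> carrier (free_group S)" for u w
    using that group.is_monoid[OF group_free_group] by (blast intro: monoid.m_closed)
  ultimately show ?thesis
    unfolding free_group_lift_altdef
    by (intro homI) (simp_all add: v mult_free_group, simp_all add: carrier_free_group v)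
qed

lemma free_group_lift_extensional: "free_group_lift S G f \<in> extensional (carrier (free_group S))"
  by (simp add: free_group_lift_def)

lemma free_group_lift_gen:
  assumes "group G" "i \<in> S" "f i \<in> carrier G"
  shows "free_group_lift S G f (gen i) = f i"
proof -
  interpret G: group G by fact
  show ?thesis
    using assms by (simp add: free_group_lift_altdef gen_in_free_group) (simp add: gen_def letter_value_def)
qed

lemma free_group_lift_Cons:
  assumes "group G" "a # w \<in> carrier (free_group S)"
  shows "free_group_lift S G f (a # w) = letter_value G f a \<otimes>\<^bsub>G\<^esub> free_group_lift S G f w"
  using assms Cons_eq_mult(2)[OF assms(2)] by (simp add: free_group_lift_altdef)

lemma free_group_lift_Nil: "free_group_lift S G f [] = \<one>\<^bsub>G\<^esub>"
  by (simp add: free_group_lift_altdef carrier_free_group)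

text \<open>
  Used below to recognise automorphisms, and homomorphisms to other groups, by their effect on the
  generators.
\<close>
lemma free_group_hom_eqI:
  assumes G: "group G" and hom: "\<phi> \<in> hom (free_group S) G" "\<psi> \<in> hom (free_group S) G"
    and eq: "\<And>i. i \<in> S \<Longrightarrow> \<phi> (gen i) = \<psi> (gen i)"
    and w: "w \<in> carrier (free_group S)"
  shows "\<phi> w = \<psi> w"
proof -
  interpret \<phi>: group_hom "free_group S" G \<phi>
    by (simp add: group_hom_def group_hom_axioms_def G hom group_free_group)
  interpret \<psi>: group_hom "free_group S" G \<psi>
    by (simp add: group_hom_def group_hom_axioms_def G hom group_free_group)
  have letter: "\<phi> [a] = \<psi> [a]" if "fst a \<in> S" for a
  proof (cases "snd a")
    case True
    then have "[a] = gen (fst a)" by (simp add: gen_def prod_eq_iff)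
    then show ?thesis using eq that by simp
  next
    case False
    then have "[a] = inv\<^bsub>free_group S\<^esub> (gen (fst a))" using that by (simp add: inv_gen prod_eq_iff)
    then show ?thesis using eq that by (simp add: gen_in_free_group)
  qed
  show ?thesis
    using w
  proof (induction w)
    case Nil
    then show ?case using \<phi>.hom_one \<psi>.hom_one by (simp add: one_free_group)
  next
    case (Cons a w)
    note C = Cons_eq_mult[OF Cons.prems]
    have "fst a \<in> S" using Cons.prems by (simp add: carrier_free_group)
    then have "\<phi> ([a] \<otimes>\<^bsub>free_group S\<^esub> w) = \<psi> ([a] \<otimes>\<^bsub>free_group S\<^esub> w)"
      using Cons.IH C(2,3) letter by simp
    then show ?case by (simp add: C(1)[symmetric])
  qed
qed

section \<open>Conjugation in the free group\<close>

lemma group_F3: "group F3"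
  by (simp add: F3_def group_free_group)

interpretation F3: group F3
  by (rule group_F3)

lemmas carrier_F3 = carrier_free_group[where S = "{1, 2, 3 :: nat}", folded F3_def]
lemmas mult_F3_append = mult_free_group_append[where S = "{1, 2, 3 :: nat}", folded F3_def]
lemmas inv_F3 = inv_free_group[where S = "{1, 2, 3 :: nat}", folded F3_def]
lemmas one_F3 = one_free_group[where S = "{1, 2, 3 :: nat}", folded F3_def]

definition conj_by :: "nat gword \<Rightarrow> nat gword \<Rightarrow> nat gword" where
  "conj_by h w = h \<otimes>\<^bsub>F3\<^esub> w \<otimes>\<^bsub>F3\<^esub> inv\<^bsub>F3\<^esub> h"

lemma F3_cancel [simp]:
  assumes "c \<in> carrier F3" "y \<in> carrier F3"
  shows "inv\<^bsub>F3\<^esub> c \<otimes>\<^bsub>F3\<^esub> (c \<otimes>\<^bsub>F3\<^esub> y) = y" "c \<otimes>\<^bsub>F3\<^esub> (inv\<^bsub>F3\<^esub> c \<otimes>\<^bsub>F3\<^esub> y) = y"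
  using assms by (simp_all add: F3.m_assoc[symmetric])

lemma conj_by_closed [simp]: "h \<in> carrier F3 \<Longrightarrow> w \<in> carrier F3 \<Longrightarrow> conj_by h w \<in> carrier F3"
  by (simp add: conj_by_def)

lemma conj_by_conj_by:
  "h \<in> carrier F3 \<Longrightarrow> k \<in> carrier F3 \<Longrightarrow> w \<in> carrier F3 \<Longrightarrow> conj_by h (conj_by k w) = conj_by (h \<otimes>\<^bsub>F3\<^esub> k) w"
  by (simp add: conj_by_def F3.inv_mult_group F3.m_assoc)

lemma conj_by_mult:
  "h \<in> carrier F3 \<Longrightarrow> v \<in> carrier F3 \<Longrightarrow> w \<in> carrier F3 \<Longrightarrow> conj_by h (v \<otimes>\<^bsub>F3\<^esub> w) = conj_by h v \<otimes>\<^bsub>F3\<^esub> conj_by h w"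
  by (simp add: conj_by_def F3.m_assoc)

lemma conj_by_inv:
  "h \<in> carrier F3 \<Longrightarrow> w \<in> carrier F3 \<Longrightarrow> conj_by h (inv\<^bsub>F3\<^esub> w) = inv\<^bsub>F3\<^esub> (conj_by h w)"
  by (simp add: conj_by_def F3.inv_mult_group F3.m_assoc)

lemma conj_by_one [simp]: "w \<in> carrier F3 \<Longrightarrow> conj_by \<one>\<^bsub>F3\<^esub> w = w"
  by (simp add: conj_by_def)

lemma conj_by_cancel:
  "h \<in> carrier F3 \<Longrightarrow> w \<in> carrier F3 \<Longrightarrow> conj_by (inv\<^bsub>F3\<^esub> h) (conj_by h w) = w"
  by (simp add: conj_by_conj_by)

lemma conj_by_conjugator:
  assumes "c \<in> carrier F3" "x \<in> carrier F3" "w \<in> carrier F3"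
  shows "conj_by (conj_by c x) (conj_by c w) = conj_by c (conj_by x w)"
proof -
  have "conj_by c x \<otimes>\<^bsub>F3\<^esub> c = c \<otimes>\<^bsub>F3\<^esub> x"
    using assms by (simp add: conj_by_def F3.m_assoc)
  then show ?thesis using assms by (simp add: conj_by_conj_by)
qed

lemma conj_by_move:
  assumes "h \<in> carrier F3" "k \<in> carrier F3" "v \<in> carrier F3" "w \<in> carrier F3" "conj_by h v = conj_by k w"
  shows "v = conj_by (inv\<^bsub>F3\<^esub> h \<otimes>\<^bsub>F3\<^esub> k) w"
  using conj_by_cancel[OF assms(1,3)] assms by (simp add: conj_by_conj_by)

lemma letter_F3 [simp]: "[(i, b)] \<in> carrier F3 \<longleftrightarrow> i \<in> {1, 2, 3}"
  by (simp add: carrier_F3 reduced_Cons)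

lemma gen_F3 [simp]: "gen i \<in> carrier F3 \<longleftrightarrow> i \<in> {1, 2, 3}"
  by (simp add: gen_def)

lemma inv_gen_F3: "i \<in> {1, 2, 3} \<Longrightarrow> inv\<^bsub>F3\<^esub> (gen i) = [(i, False)]"
  using inv_gen[of i "{1, 2, 3}"] by (simp add: F3_def)

lemma inv_letter_F3: "i \<in> {1, 2, 3} \<Longrightarrow> inv\<^bsub>F3\<^esub> [(i, b)] = [(i, \<not> b)]"
  by (subst inv_F3) (simp_all add: flip_word_def)

lemma reduced_replicate: "reduced_word (replicate n (i, b))"
  by (induction n) (auto simp: reduced_Cons)

lemma replicate_F3: "i \<in> {1, 2, 3} \<Longrightarrow> replicate n (i, b) \<in> carrier F3"
  by (auto simp: carrier_F3 reduced_replicate)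

lemma letter_commutes:
  assumes "i \<in> {1, 2, 3}"
  shows "conj_by [(i, b)] (gen i) = gen i"
proof -
  have "[(i, b)] \<otimes>\<^bsub>F3\<^esub> gen i = gen i \<otimes>\<^bsub>F3\<^esub> [(i, b)]"
    using assms F3.r_inv[of "gen i"] F3.l_inv[of "gen i"]
    by (cases b) (auto simp: inv_gen_F3, simp_all add: gen_def)
  with assms show ?thesis by (simp add: conj_by_def F3.m_assoc)
qed

lemma conj_by_replicate: "i \<in> {1, 2, 3} \<Longrightarrow> conj_by (replicate n (i, b)) (gen i) = gen i"
proof (induction n)
  case 0
  then show ?case using conj_by_one[of "gen i"] by (simp add: one_F3)
next
  case (Suc n)
  have "replicate (Suc n) (i, b) = [(i, b)] \<otimes>\<^bsub>F3\<^esub> replicate n (i, b)"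
    using reduced_replicate[of "Suc n" i b] by (subst mult_F3_append) auto
  with Suc show ?case
    by (simp del: replicate.simps add: conj_by_conj_by[symmetric] replicate_F3 letter_commutes)
qed

text \<open>
  The centraliser of \<open>x\<^sub>i\<close> consists of its powers. If a commuting word starts with \<open>x\<^sub>i\<^bsup>\<plusminus>1\<^esup>\<close>, that
  letter can be removed. If it starts with another letter, then \<open>x\<^sub>i w\<close> is reduced as written and
  begins with \<open>x\<^sub>i\<close>, whereas \<open>w x\<^sub>i\<close> begins with the first letter of \<open>w\<close> or is shorter than \<open>w\<close>.
\<close>
lemma commutes_gen_imp_replicate:
  assumes "w \<in> carrier F3" "i \<in> {1, 2, 3}" "conj_by w (gen i) = gen i"
  shows "\<exists>n b. w = replicate n (i, b)"
  using assms(1,3)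
proof (induction w)
  case Nil
  then show ?case by (auto intro: exI[of _ 0])
next
  case (Cons a v)
  note C = Cons_eq_mult[OF Cons.prems(1)[unfolded F3_def], folded F3_def]
  show ?case
  proof (cases "fst a = i")
    case True
    then obtain b where a: "a = (i, b)" by (cases a) auto
    have "conj_by [a] (conj_by v (gen i)) = conj_by [a] (gen i)"
      using Cons.prems(2) C assms(2) by (simp add: conj_by_conj_by letter_commutes a)
    then have "conj_by v (gen i) = gen i"
      using conj_by_cancel[of "[a]"] C assms(2) by (metis conj_by_closed gen_F3)
    then obtain n b' where v: "v = replicate n (i, b')"
      using Cons.IH C(2) by auto
    have "n = 0 \<or> b' = b"
      using Cons.prems(1) by (cases n) (auto simp: v a carrier_F3 reduced_Cons)
    then have "a # v = replicate 1 (i, b) \<or> a # v = replicate (Suc n) (i, b)"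
      by (auto simp: v a)
    then show ?thesis by blast
  next
    case False
    let ?w = "a # v"
    have red: "reduced_word ?w" using Cons.prems(1) by (simp add: carrier_F3)
    have "conj_by ?w (gen i) \<otimes>\<^bsub>F3\<^esub> ?w = ?w \<otimes>\<^bsub>F3\<^esub> gen i"
      using Cons.prems(1) assms(2) by (simp add: conj_by_def F3.m_assoc)
    then have comm: "gen i \<otimes>\<^bsub>F3\<^esub> ?w = ?w \<otimes>\<^bsub>F3\<^esub> gen i"
      using Cons.prems(2) by simp
    have left: "gen i \<otimes>\<^bsub>F3\<^esub> ?w = (i, True) # ?w"
      using red False by (subst mult_F3_append) (auto simp: gen_def reduced_Cons)
    obtain z c where z: "?w = z @ [c]" by (metis append_butlast_last_id list.distinct(1))
    have "?w \<otimes>\<^bsub>F3\<^esub> gen i \<noteq> (i, True) # ?w"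
    proof (cases "c = (i, False)")
      case True
      have "?w \<otimes>\<^bsub>F3\<^esub> gen i = z"
        using red unfolding z F3_def mult_free_group
        by (simp add: gen_def True prepend_letter_Cons reduced_append foldr_prepend_Nil)
      then show ?thesis by (metis z append_Cons append_assoc append_self_conv2 length_append
            length_Cons less_add_Suc1 add_Suc_right less_irrefl list.size(3) not_less_eq less_Suc_eq)
    next
      case False
      have "reduced_word (?w @ gen i)"
        using red False unfolding z by (cases c) (auto simp: gen_def reduced_append reduced_Cons)
      then have "?w \<otimes>\<^bsub>F3\<^esub> gen i = ?w @ gen i" by (rule mult_F3_append)
      then show ?thesis using \<open>fst a \<noteq> i\<close> by auto
    qed
    with comm left show ?thesis by simp
  qed
qed

section \<open>Relative position of three axes\<close>

definition starts_off :: "'a \<Rightarrow> 'a gword \<Rightarrow> bool" where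
  "starts_off i w \<longleftrightarrow> w = [] \<or> fst (hd w) \<noteq> i"

definition ends_off :: "'a \<Rightarrow> 'a gword \<Rightarrow> bool" where
  "ends_off i w \<longleftrightarrow> w = [] \<or> fst (last w) \<noteq> i"

lemma starts_off_flip [simp]: "starts_off i (flip_word w) = ends_off i w"
  by (auto simp: starts_off_def ends_off_def flip_word_def hd_rev last_map)

lemma ends_off_flip [simp]: "ends_off i (flip_word w) = starts_off i w"
  by (auto simp: starts_off_def ends_off_def flip_word_def last_rev hd_map)

lemma starts_off_append: "starts_off i (u @ v) \<longleftrightarrow> (if u = [] then starts_off i v else starts_off i u)"
  by (auto simp: starts_off_def)

lemma ends_off_append: "ends_off i (u @ v) \<longleftrightarrow> (if v = [] then ends_off i u else ends_off i v)"
  by (auto simp: ends_off_def)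

lemma off_replicate:
  "i \<noteq> j \<Longrightarrow> starts_off i (replicate n (j, e))" "i \<noteq> j \<Longrightarrow> ends_off i (replicate n (j, e))"
  by (cases n; simp add: starts_off_def ends_off_def; fail)
     (cases n; simp add: starts_off_def ends_off_def last_replicate del: replicate_Suc)

lemma flip_word_append: "flip_word (u @ v) = flip_word v @ flip_word u"
  by (simp add: flip_word_def)

lemma flip_word_eq_Nil [simp]: "flip_word w = [] \<longleftrightarrow> w = []"
  by (simp add: flip_word_def)

lemma reduced_append_off:
  "reduced_word u \<Longrightarrow> reduced_word v \<Longrightarrow> ends_off i u \<Longrightarrow> v \<noteq> [] \<Longrightarrow> fst (hd v) = i \<Longrightarrow> reduced_word (u @ v)"
  "reduced_word u \<Longrightarrow> reduced_word v \<Longrightarrow> starts_off i v \<Longrightarrow> u \<noteq> [] \<Longrightarrow> fst (last u) = i \<Longrightarrow> reduced_word (u @ v)"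
  by (auto simp: reduced_append starts_off_def ends_off_def)

text \<open>
  The axis of a conjugate \<open>c x\<^sub>j c\<^bsup>-1\<^esup>\<close> in the Cayley tree is the coset of words \<open>c x\<^sub>j\<^sup>n\<close>. Axes of
  conjugates of different generators share at most one vertex, so each of the axes of \<open>Y i\<close> and
  \<open>Y k\<close> has a unique point of the axis of \<open>Y j\<close> that is nearest to it. The definition says that the
  signed distance along the axis of \<open>Y j\<close> between these two points is \<open>p\<close>, with sign \<open>e\<close>, and
  that \<open>p\<close> is positive; the base vertex \<open>c\<close> is the point nearest to the axis of \<open>Y k\<close>. The words \<open>u\<close>
  and \<open>w\<close> describe the paths from the axis of \<open>Y j\<close> to the other two, whence the restrictions on
  their first and last letters.

  Conjugating \<open>Y i\<close> by \<open>Y j\<close> translates one axis along another and increases \<open>p\<close>. If the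
  axis of \<open>Y j\<close> separates the other two in this way, then all paths between those two run through it;
  seen from the axis of \<open>Y i\<close> or \<open>Y k\<close> the two remaining axes then have the same nearest point, and
  a translation along that axis moves these nearest points to distance one. So the property is
  inherited by every reduced sequence of such moves, with the axis of the latest move in the middle.
\<close>
definition separated :: "nat \<Rightarrow> nat \<Rightarrow> nat \<Rightarrow> bool \<Rightarrow> (nat \<Rightarrow> nat gword) \<Rightarrow> bool" where
  "separated j i k e Y \<longleftrightarrow> (\<exists>c p u w.
     c \<in> carrier F3 \<and> u \<in> carrier F3 \<and> w \<in> carrier F3 \<and> 0 < p \<and>
     starts_off j u \<and> ends_off i u \<and> starts_off j w \<and> ends_off k w \<and>
     Y j = conj_by c (gen j) \<and>
     Y i = conj_by c (conj_by (replicate p (j, e) @ u) (gen i)) \<and>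
     Y k = conj_by c (conj_by w (gen k)))"

definition signed :: "bool \<Rightarrow> nat gword \<Rightarrow> nat gword" where
  "signed e y = (if e then y else inv\<^bsub>F3\<^esub> y)"

lemma signed_gen: "j \<in> {1, 2, 3} \<Longrightarrow> signed e (gen j) = [(j, e)]"
  by (simp add: signed_def inv_gen_F3) (simp add: gen_def)

lemma signed_conj_by: "c \<in> carrier F3 \<Longrightarrow> j \<in> {1, 2, 3} \<Longrightarrow> signed e (conj_by c (gen j)) = conj_by c [(j, e)]"
  using signed_gen[of j e] conj_by_inv[of c "gen j"] by (simp add: signed_def split: if_splits)

lemma separatedI:
  assumes "c \<in> carrier F3" "u \<in> carrier F3" "w \<in> carrier F3" "0 < p"
    "starts_off j u" "ends_off i u" "starts_off j w" "ends_off k w"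
    "Y j = conj_by c (gen j)"
    "Y i = conj_by c (conj_by (replicate p (j, e) @ u) (gen i))"
    "Y k = conj_by c (conj_by w (gen k))"
  shows "separated j i k e Y"
  using assms unfolding separated_def by blast

context
  fixes i j k :: nat
  assumes idx: "{i, j, k} = {1, 2, 3}" "i \<noteq> j" "j \<noteq> k" "i \<noteq> k"
begin

lemma idx_mem: "i \<in> {1, 2, 3}" "j \<in> {1, 2, 3}" "k \<in> {1, 2, 3}"
  using idx(1) by blast+

lemma replicate_append_F3:
  assumes "u \<in> carrier F3" "starts_off j u"
  shows "replicate p (j, e) @ u \<in> carrier F3"
        "replicate p (j, e) @ u = replicate p (j, e) \<otimes>\<^bsub>F3\<^esub> u"
proof -
  have "reduced_word (replicate p (j, e) @ u)"
    using assms reduced_append_off(2)[of "replicate p (j, e)" u j]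
    by (cases "p = 0") (simp_all add: carrier_F3 reduced_replicate)
  then show "replicate p (j, e) @ u = replicate p (j, e) \<otimes>\<^bsub>F3\<^esub> u"
    by (simp add: mult_F3_append)
  then show "replicate p (j, e) @ u \<in> carrier F3"
    using assms idx_mem by (simp add: replicate_F3)
qed

text \<open>
  A further translation along the middle axis, in the same direction: \<open>p\<close> becomes \<open>p + 1\<close>.
\<close>
lemma separated_same:
  assumes "separated j i k e Y"
  shows "separated j i k e (Y(i := conj_by (signed e (Y j)) (Y i)))"
proof -
  from assms obtain c p u w where *:
    "c \<in> carrier F3" "u \<in> carrier F3" "w \<in> carrier F3" "0 < p"
    "starts_off j u" "ends_off i u" "starts_off j w" "ends_off k w"
    "Y j = conj_by c (gen j)" "Y i = conj_by c (conj_by (replicate p (j, e) @ u) (gen i))" "Y k = conj_by c (conj_by w (gen k))"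
    unfolding separated_def by blast
  note W = replicate_append_F3[OF *(2,5)]
  have "conj_by (signed e (Y j)) (Y i) = conj_by c (conj_by ([(j, e)] \<otimes>\<^bsub>F3\<^esub> (replicate p (j, e) @ u)) (gen i))"
    using * idx_mem W(1) by (simp add: signed_conj_by conj_by_conjugator del: insert_iff) (simp add: conj_by_conj_by)
  also have "[(j, e)] \<otimes>\<^bsub>F3\<^esub> (replicate p (j, e) @ u) = replicate (Suc p) (j, e) @ u"
    using W(1)[of "Suc p" e] by (subst mult_F3_append) (auto simp: carrier_F3)
  finally show ?thesis
    using * idx by (intro separatedI[of c u w "Suc p"]) auto
qed

text \<open>
  A translation along the axis of \<open>Y i\<close>, which thereby becomes the middle one. The new base vertex is
  the point \<open>c'\<close> of that axis nearest to both other axes; the path from it to the axis of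
  \<open>Y k\<close> passes along the former middle axis, hence the inverse power of \<open>x\<^sub>j\<close> inside \<open>u'\<close>.
\<close>
lemma separated_next:
  assumes "separated j i k e Y"
  shows "separated i k j e' (Y(k := conj_by (signed e' (Y i)) (Y k)))"
proof -
  from assms obtain c p u w where *:
    "c \<in> carrier F3" "u \<in> carrier F3" "w \<in> carrier F3" "0 < p"
    "starts_off j u" "ends_off i u" "starts_off j w" "ends_off k w"
    "Y j = conj_by c (gen j)" "Y i = conj_by c (conj_by (replicate p (j, e) @ u) (gen i))" "Y k = conj_by c (conj_by w (gen k))"
    unfolding separated_def by blast
  define W where "W = replicate p (j, e) @ u"
  have W: "W \<in> carrier F3" "W = replicate p (j, e) \<otimes>\<^bsub>F3\<^esub> u"
    unfolding W_def using replicate_append_F3[OF *(2,5)] by auto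
  define c' where "c' = c \<otimes>\<^bsub>F3\<^esub> W"
  have c': "c' \<in> carrier F3" using * W by (simp add: c'_def)
  \<comment> \<open>There is no cancellation here: the power of \<open>x\<^sub>j\<close> between the two outer words has a positive exponent.\<close>
  define u' where "u' = flip_word W @ w"
  have W_ne: "W \<noteq> []" "fst (hd W) = j" using *(4) by (auto simp: W_def hd_append)
  have "flip_word W \<noteq> []" "fst (last (flip_word W)) = j"
    using W_ne by (simp_all add: flip_word_def last_rev hd_map)
  then have "reduced_word u'"
    unfolding u'_def using W(1) *
    by (intro reduced_append_off(2)[of _ _ j]) (simp_all add: carrier_F3)
  then have "u' = inv\<^bsub>F3\<^esub> W \<otimes>\<^bsub>F3\<^esub> w"
    unfolding u'_def using W(1) by (simp add: inv_F3 mult_F3_append)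
  then have u': "u' = inv\<^bsub>F3\<^esub> W \<otimes>\<^bsub>F3\<^esub> w" "u' \<in> carrier F3"
    using W(1) *(3) by simp_all
  have off_u': "starts_off i u'" "ends_off k u'"
    using *(4,6,8) idx(2-4)
    by (simp_all add: u'_def W_def flip_word_append starts_off_append ends_off_append off_replicate)
  have rep: "replicate p (j, e) = W \<otimes>\<^bsub>F3\<^esub> flip_word u"
    using *(2) idx_mem by (simp add: W(2) F3.m_assoc replicate_F3 inv_F3[symmetric])
  have "flip_word u \<in> carrier F3" using *(2) by (simp add: inv_F3[symmetric])
  then have Yj: "Y j = conj_by c' (conj_by (flip_word u) (gen j))"
    using * W(1) idx_mem rep conj_by_replicate[OF idx_mem(2), of p e]
    by (simp add: c'_def conj_by_conj_by F3.m_assoc) (simp add: conj_by_conj_by[symmetric] replicate_F3)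
  have Yi: "Y i = conj_by c' (gen i)"
    using * W(1) idx_mem by (simp add: c'_def W_def[symmetric] conj_by_conj_by)
  have Yk: "Y k = conj_by c' (conj_by u' (gen k))"
    using * W(1) idx_mem by (simp add: c'_def u'(1) conj_by_conj_by F3.m_assoc)
  have "[(i, e')] @ u' = [(i, e')] \<otimes>\<^bsub>F3\<^esub> u'"
    using u'(2) off_u' by (subst mult_F3_append) (auto simp: carrier_F3 reduced_Cons starts_off_def prod_eq_iff)
  then have "conj_by (signed e' (Y i)) (Y k) = conj_by c' (conj_by (replicate 1 (i, e') @ u') (gen k))"
    using c' u'(2) idx_mem by (simp add: Yi Yk signed_conj_by conj_by_conjugator) (simp add: conj_by_conj_by)
  then show ?thesis
    using c' u'(2) off_u' * idx Yi Yj \<open>flip_word u \<in> carrier F3\<close>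
    by (intro separatedI[of c' u' "flip_word u" 1]) auto
qed

text \<open>
  The same for a translation along the axis of \<open>Y k\<close>.
\<close>
lemma separated_prev:
  assumes "separated j i k e Y"
  shows "separated k j i e' (Y(j := conj_by (signed e' (Y k)) (Y j)))"
proof -
  from assms obtain c p u w where *:
    "c \<in> carrier F3" "u \<in> carrier F3" "w \<in> carrier F3" "0 < p"
    "starts_off j u" "ends_off i u" "starts_off j w" "ends_off k w"
    "Y j = conj_by c (gen j)" "Y i = conj_by c (conj_by (replicate p (j, e) @ u) (gen i))" "Y k = conj_by c (conj_by w (gen k))"
    unfolding separated_def by blast
  define W where "W = replicate p (j, e) @ u"
  have W: "W \<in> carrier F3"
    unfolding W_def using replicate_append_F3[OF *(2,5)] by auto
  define c' where "c' = c \<otimes>\<^bsub>F3\<^esub> w"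
  have c': "c' \<in> carrier F3" using * by (simp add: c'_def)
  have fw: "flip_word w \<in> carrier F3" using * by (simp add: inv_F3[symmetric])
  define w' where "w' = flip_word w @ W"
  have W_ne: "W \<noteq> []" "fst (hd W) = j" using *(4) by (auto simp: W_def hd_append)
  have "reduced_word w'"
    unfolding w'_def using W_ne W * 
    by (intro reduced_append_off(1)[of _ _ j]) (auto simp: carrier_F3)
  then have "w' = inv\<^bsub>F3\<^esub> w \<otimes>\<^bsub>F3\<^esub> W"
    unfolding w'_def using *(3) by (simp add: inv_F3 mult_F3_append)
  then have w': "w' = inv\<^bsub>F3\<^esub> w \<otimes>\<^bsub>F3\<^esub> W" "w' \<in> carrier F3"
    using W *(3) by simp_all
  have off_w': "starts_off k w'" "ends_off i w'"
    using *(4,6,8) idx(2-4)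
    by (simp_all add: w'_def W_def starts_off_append ends_off_append off_replicate)
  have Yk: "Y k = conj_by c' (gen k)"
    using * idx_mem by (simp add: c'_def conj_by_conj_by)
  have Yj: "Y j = conj_by c' (conj_by (flip_word w) (gen j))"
    using * idx_mem by (simp add: c'_def conj_by_conj_by F3.m_assoc inv_F3[symmetric])
  have Yi: "Y i = conj_by c' (conj_by w' (gen i))"
    using * W idx_mem by (simp add: c'_def W_def[symmetric] w'(1) conj_by_conj_by F3.m_assoc)
  have "[(k, e')] @ flip_word w = [(k, e')] \<otimes>\<^bsub>F3\<^esub> flip_word w"
    using fw *(8) by (subst mult_F3_append)
      (auto simp: carrier_F3 reduced_Cons starts_off_flip[symmetric] starts_off_def prod_eq_iff simp del: starts_off_flip)
  then have "conj_by (signed e' (Y k)) (Y j) = conj_by c' (conj_by (replicate 1 (k, e') @ flip_word w) (gen j))"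
    using c' fw idx_mem by (simp add: Yj Yk signed_conj_by conj_by_conjugator) (simp add: conj_by_conj_by)
  then show ?thesis
    using c' fw off_w' w'(2) * idx Yi Yk
    by (intro separatedI[of c' "flip_word w" w' 1]) auto
qed

text \<open>
  If the three elements were \<open>g x\<^sub>l g\<^bsup>-1\<^esup>\<close> for a common \<open>g\<close>, their axes would meet in the vertex \<open>g\<close>,
  leaving no room for a positive distance. In terms of words, \<open>g\<^bsup>-1\<^esup> c\<close> centralises \<open>x\<^sub>j\<close> and so is a
  power of it; comparing first letters in the conditions on \<open>x\<^sub>k\<close> and \<open>x\<^sub>i\<close> forces this power and
  then \<open>p\<close> to vanish.
\<close>
lemma separated_not_inner:
  assumes "separated j i k e Y" "g \<in> carrier F3" "\<And>l. l \<in> {1, 2, 3} \<Longrightarrow> Y l = conj_by g (gen l)"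
  shows False
proof -
  from assms obtain c p u w where *:
    "c \<in> carrier F3" "u \<in> carrier F3" "w \<in> carrier F3" "0 < p"
    "starts_off j u" "ends_off i u" "starts_off j w" "ends_off k w"
    "Y j = conj_by c (gen j)" "Y i = conj_by c (conj_by (replicate p (j, e) @ u) (gen i))" "Y k = conj_by c (conj_by w (gen k))"
    unfolding separated_def by blast
  define b where "b = inv\<^bsub>F3\<^esub> g \<otimes>\<^bsub>F3\<^esub> c"
  have b: "b \<in> carrier F3" using * assms(2) by (simp add: b_def)
  note W = replicate_append_F3[OF *(2,5)]
  have eq: "gen j = conj_by b (gen j)" "gen i = conj_by (b \<otimes>\<^bsub>F3\<^esub> (replicate p (j, e) @ u)) (gen i)"
           "gen k = conj_by (b \<otimes>\<^bsub>F3\<^esub> w) (gen k)"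
    using conj_by_move[OF assms(2), of c "gen j" "gen j"]
          conj_by_move[OF assms(2), of "c \<otimes>\<^bsub>F3\<^esub> (replicate p (j, e) @ u)" "gen i" "gen i"]
          conj_by_move[OF assms(2), of "c \<otimes>\<^bsub>F3\<^esub> w" "gen k" "gen k"]
          assms(2,3) * idx_mem W(1) by (auto simp: b_def conj_by_conj_by F3.m_assoc)
  obtain n d where n: "b = replicate n (j, d)"
    using commutes_gen_imp_replicate[OF b idx_mem(2)] eq(1) by auto
  have no_power: "m = 0" if "replicate m (j, f) @ v = replicate q (l, f')" "l \<noteq> j" for m v q l f f'
    using that by (cases m; cases q) auto
  have "b \<otimes>\<^bsub>F3\<^esub> w = replicate n (j, d) @ w"
    using replicate_append_F3(2)[OF *(3,7)] by (simp only: n)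
  moreover obtain q f where "b \<otimes>\<^bsub>F3\<^esub> w = replicate q (k, f)"
    using commutes_gen_imp_replicate[OF F3.m_closed[OF b *(3)] idx_mem(3) eq(3)[symmetric]] by blast
  ultimately have "n = 0" using idx(3) no_power by metis
  then have "b = \<one>\<^bsub>F3\<^esub>" by (simp add: n one_F3)
  then have "conj_by (replicate p (j, e) @ u) (gen i) = gen i"
    using eq(2) W(1) by simp
  then obtain q f where "replicate p (j, e) @ u = replicate q (i, f)"
    using commutes_gen_imp_replicate[OF W(1) idx_mem(1)] by blast
  then have "p = 0" using idx(2) no_power by metis
  with *(4) show False by simp
qed

end

declare One_nat_def [simp del]

section \<open>The group of conjugating automorphisms\<close>

lemma hom_F3D:
  assumes "\<phi> \<in> hom F3 F3" "u \<in> carrier F3"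
  shows "\<phi> u \<in> carrier F3" "v \<in> carrier F3 \<Longrightarrow> \<phi> (u \<otimes>\<^bsub>F3\<^esub> v) = \<phi> u \<otimes>\<^bsub>F3\<^esub> \<phi> v"
    "\<phi> (inv\<^bsub>F3\<^esub> u) = inv\<^bsub>F3\<^esub> (\<phi> u)" "\<phi> \<one>\<^bsub>F3\<^esub> = \<one>\<^bsub>F3\<^esub>"
proof -
  interpret group_hom F3 F3 \<phi> by (simp add: group_hom_def group_hom_axioms_def group_F3 assms)
  show "\<phi> u \<in> carrier F3" "v \<in> carrier F3 \<Longrightarrow> \<phi> (u \<otimes>\<^bsub>F3\<^esub> v) = \<phi> u \<otimes>\<^bsub>F3\<^esub> \<phi> v"
    "\<phi> (inv\<^bsub>F3\<^esub> u) = inv\<^bsub>F3\<^esub> (\<phi> u)" "\<phi> \<one>\<^bsub>F3\<^esub> = \<one>\<^bsub>F3\<^esub>"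
    using assms by auto
qed

lemma hom_conj_by:
  "\<phi> \<in> hom F3 F3 \<Longrightarrow> h \<in> carrier F3 \<Longrightarrow> w \<in> carrier F3 \<Longrightarrow> \<phi> (conj_by h w) = conj_by (\<phi> h) (\<phi> w)"
  by (simp add: conj_by_def hom_F3D)

lemma hom_signed:
  "\<phi> \<in> hom F3 F3 \<Longrightarrow> w \<in> carrier F3 \<Longrightarrow> \<phi> (signed e w) = signed e (\<phi> w)"
  by (simp add: signed_def hom_F3D)

lemma hom_letter:
  "\<phi> \<in> hom F3 F3 \<Longrightarrow> j \<in> {1, 2, 3} \<Longrightarrow> \<phi> [(j, e)] = signed e (\<phi> (gen j))"
  by (simp add: hom_signed signed_gen[symmetric])

lemma hom_F3_eqI:
  assumes "\<phi> \<in> hom F3 F3" "\<psi> \<in> hom F3 F3" "\<And>i. i \<in> {1, 2, 3} \<Longrightarrow> \<phi> (gen i) = \<psi> (gen i)" "w \<in> carrier F3"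
  shows "\<phi> w = \<psi> w"
  using free_group_hom_eqI[of F3 \<phi> "{1, 2, 3}" \<psi> w] assms group_F3 by (simp add: F3_def)

text \<open>
  Conjugators are moved to the left, because products of the form \<open>h x\<^sub>i h\<^bsup>-1\<^esup>\<close> make \<open>h\<close> a prefix of
  the reduced word as soon as \<open>h\<close> does not end in \<open>x\<^sub>i\<^bsup>\<plusminus>1\<^esup>\<close>.
\<close>
lemma conjugating_iff:
  "conjugating \<phi> \<longleftrightarrow> (\<exists>\<pi> h. \<pi> permutes {1, 2, 3} \<and>
      (\<forall>i\<in>{1, 2, 3}. h i \<in> carrier F3 \<and> \<phi> (gen i) = conj_by (h i) (gen (\<pi> i))))"
proof
  assume "conjugating \<phi>"
  then obtain \<pi> f where *: "\<pi> permutes {1, 2, 3}" "\<forall>i\<in>{1, 2, 3}. f i \<in> carrier F3 \<and>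
         \<phi> (gen i) = inv\<^bsub>F3\<^esub> (f i) \<otimes>\<^bsub>F3\<^esub> gen (\<pi> i) \<otimes>\<^bsub>F3\<^esub> f i"
    unfolding conjugating_def by blast
  then show "\<exists>\<pi> h. \<pi> permutes {1, 2, 3} \<and>
      (\<forall>i\<in>{1, 2, 3}. h i \<in> carrier F3 \<and> \<phi> (gen i) = conj_by (h i) (gen (\<pi> i)))"
    by (intro exI[of _ \<pi>] exI[of _ "\<lambda>i. inv\<^bsub>F3\<^esub> (f i)"]) (simp add: conj_by_def)
next
  assume "\<exists>\<pi> h. \<pi> permutes {1, 2, 3} \<and>
      (\<forall>i\<in>{1, 2, 3}. h i \<in> carrier F3 \<and> \<phi> (gen i) = conj_by (h i) (gen (\<pi> i)))"
  then obtain \<pi> h where *: "\<pi> permutes {1, 2, 3}"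
    "\<forall>i\<in>{1, 2, 3}. h i \<in> carrier F3 \<and> \<phi> (gen i) = conj_by (h i) (gen (\<pi> i))"
    by blast
  then show "conjugating \<phi>"
    unfolding conjugating_def
    by (intro exI[of _ \<pi>] exI[of _ "\<lambda>i. inv\<^bsub>F3\<^esub> (h i)"]) (simp add: conj_by_def)
qed

lemma conjugatingE:
  assumes "conjugating \<phi>"
  obtains \<pi> h where "\<pi> permutes {1, 2, 3}" "\<And>i. i \<in> {1, 2, 3} \<Longrightarrow> h i \<in> carrier F3"
    "\<And>i. i \<in> {1, 2, 3} \<Longrightarrow> \<phi> (gen i) = conj_by (h i) (gen (\<pi> i))"
proof -
  obtain \<pi> h where *: "\<pi> permutes {1, 2, 3}"
    "\<forall>i\<in>{1, 2, 3}. h i \<in> carrier F3 \<and> \<phi> (gen i) = conj_by (h i) (gen (\<pi> i))"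
    using assms conjugating_iff by auto
  show ?thesis by (rule that[of \<pi> h]) (use * in blast)+
qed

lemma conjugatingI:
  assumes "\<pi> permutes {1, 2, 3}"
    "\<And>i. i \<in> {1, 2, 3} \<Longrightarrow> h i \<in> carrier F3" "\<And>i. i \<in> {1, 2, 3} \<Longrightarrow> \<phi> (gen i) = conj_by (h i) (gen (\<pi> i))"
  shows "conjugating \<phi>"
  using assms unfolding conjugating_iff by blast

lemma group_opposite:
  assumes "group G" shows "group (opposite_group G)"
proof -
  interpret G: group G by fact
  show ?thesis
  proof (rule groupI)
    fix a assume "a \<in> carrier (opposite_group G)"
    then show "\<exists>b\<in>carrier (opposite_group G). b \<otimes>\<^bsub>opposite_group G\<^esub> a = \<one>\<^bsub>opposite_group G\<^esub>"
      by (intro bexI[of _ "inv\<^bsub>G\<^esub> a"]) (simp_all add: opposite_group_def)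
  qed (simp_all add: opposite_group_def G.m_assoc)
qed

lemma auto_F3D:
  assumes "\<phi> \<in> auto F3"
  shows "\<phi> \<in> hom F3 F3" "\<phi> \<in> Bij (carrier F3)" "\<phi> \<in> extensional (carrier F3)"
    "bij_betw \<phi> (carrier F3) (carrier F3)"
  using assms by (simp_all add: auto_def Bij_def)

lemma auto_F3I:
  assumes "\<phi> \<in> hom F3 F3" "\<phi> \<in> extensional (carrier F3)" "\<psi> \<in> hom F3 F3"
    "\<And>w. w \<in> carrier F3 \<Longrightarrow> \<psi> (\<phi> w) = w" "\<And>w. w \<in> carrier F3 \<Longrightarrow> \<phi> (\<psi> w) = w"
  shows "\<phi> \<in> auto F3"
proof -
  have "bij_betw \<phi> (carrier F3) (carrier F3)"
    using assms hom_F3D(1) by (intro bij_betwI[of _ _ _ \<psi>]) auto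
  then show ?thesis using assms by (simp add: auto_def Bij_def)
qed

lemma mult_opposite_AutoGroup:
  "a \<in> auto F3 \<Longrightarrow> b \<in> auto F3 \<Longrightarrow> a \<otimes>\<^bsub>opposite_group (AutoGroup F3)\<^esub> b = compose (carrier F3) b a"
  by (simp add: opposite_group_def AutoGroup_def BijGroup_def auto_F3D)

lemma carrier_opposite_AutoGroup: "carrier (opposite_group (AutoGroup F3)) = auto F3"
  by (simp add: opposite_group_def AutoGroup_def)

lemma one_opposite_AutoGroup: "\<one>\<^bsub>opposite_group (AutoGroup F3)\<^esub> = (\<lambda>w\<in>carrier F3. w)"
  by (simp add: opposite_group_def AutoGroup_def BijGroup_def)

lemma group_opposite_AutoGroup: "group (opposite_group (AutoGroup F3))"
  by (rule group_opposite[OF F3.AutoGroup])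

lemma carrier_C3: "carrier C3 = {\<phi> \<in> auto F3. conjugating \<phi>}"
  by (simp add: C3_def)

lemma subgroup_conjugating:
  "subgroup {\<phi> \<in> auto F3. conjugating \<phi>} (opposite_group (AutoGroup F3))" (is "subgroup ?H ?A")
proof -
  interpret A: group ?A by (rule group_opposite_AutoGroup)
  show ?thesis
  proof (rule A.subgroupI)
    show "?H \<subseteq> carrier ?A" by (auto simp: carrier_opposite_AutoGroup)
    have "(\<lambda>w\<in>carrier F3. w) \<in> ?H"
      using F3.id_in_auto by (auto intro!: conjugatingI[of id "\<lambda>_. \<one>\<^bsub>F3\<^esub>"] permutes_id)
    then show "?H \<noteq> {}" by blast
  next
    fix a b assume a: "a \<in> ?H" and b: "b \<in> ?H"
    have "conjugating a" using a by simp
    then obtain \<pi> h where h: "\<pi> permutes {1, 2, 3}" "\<And>i. i \<in> {1, 2, 3} \<Longrightarrow> h i \<in> carrier F3"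
      "\<And>i. i \<in> {1, 2, 3} \<Longrightarrow> a (gen i) = conj_by (h i) (gen (\<pi> i))"
      by (rule conjugatingE) blast
    have "conjugating b" using b by simp
    then obtain \<pi>' h' where h': "\<pi>' permutes {1, 2, 3}" "\<And>i. i \<in> {1, 2, 3} \<Longrightarrow> h' i \<in> carrier F3"
      "\<And>i. i \<in> {1, 2, 3} \<Longrightarrow> b (gen i) = conj_by (h' i) (gen (\<pi>' i))"
      by (rule conjugatingE) blast
    have ab: "a \<in> auto F3" "b \<in> auto F3" using a b by auto
    have mem: "\<pi> i \<in> {1, 2, 3}" "\<pi>' i \<in> {1, 2, 3}" if "i \<in> {1, 2, 3}" for i
      using permutes_in_image[OF h(1)] permutes_in_image[OF h'(1)] that by auto
    have "conjugating (compose (carrier F3) b a)"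
    proof (rule conjugatingI[of "\<pi>' \<circ> \<pi>" "\<lambda>i. b (h i) \<otimes>\<^bsub>F3\<^esub> h' (\<pi> i)"])
      show "\<pi>' \<circ> \<pi> permutes {1, 2, 3}" by (rule permutes_compose[OF h(1) h'(1)])
      fix i :: nat assume i: "i \<in> {1, 2, 3}"
      have b_hom: "b \<in> hom F3 F3" using ab by (simp add: auto_F3D)
      have hC: "h i \<in> carrier F3" "h' (\<pi> i) \<in> carrier F3" "b (h i) \<in> carrier F3"
        "gen (\<pi> i) \<in> carrier F3" "gen (\<pi>' (\<pi> i)) \<in> carrier F3"
        using h(2)[OF i] h'(2)[OF mem(1)[OF i]] hom_F3D(1)[OF b_hom] mem(1)[OF i] mem(2)[OF mem(1)[OF i]]
        by (simp_all only: gen_F3)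
      then show "b (h i) \<otimes>\<^bsub>F3\<^esub> h' (\<pi> i) \<in> carrier F3" by simp
      have "compose (carrier F3) b a (gen i) = b (conj_by (h i) (gen (\<pi> i)))"
        using i h(3)[OF i] by (simp only: compose_eq gen_F3)
      also have "\<dots> = conj_by (b (h i)) (b (gen (\<pi> i)))"
        using hC by (simp only: hom_conj_by[OF b_hom])
      also have "\<dots> = conj_by (b (h i) \<otimes>\<^bsub>F3\<^esub> h' (\<pi> i)) (gen ((\<pi>' \<circ> \<pi>) i))"
        using hC by (simp only: h'(3)[OF mem(1)[OF i]] conj_by_conj_by o_apply)
      finally show "compose (carrier F3) b a (gen i) = conj_by (b (h i) \<otimes>\<^bsub>F3\<^esub> h' (\<pi> i)) (gen ((\<pi>' \<circ> \<pi>) i))" .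
    qed
    moreover have "compose (carrier F3) b a \<in> auto F3"
      using A.m_closed[of a b] ab by (simp add: carrier_opposite_AutoGroup mult_opposite_AutoGroup)
    ultimately show "a \<otimes>\<^bsub>?A\<^esub> b \<in> ?H"
      using ab by (simp add: mult_opposite_AutoGroup)
  next
    fix a assume a: "a \<in> ?H"
    have "conjugating a" using a by simp
    then obtain \<pi> h where h: "\<pi> permutes {1, 2, 3}" "\<And>i. i \<in> {1, 2, 3} \<Longrightarrow> h i \<in> carrier F3"
      "\<And>i. i \<in> {1, 2, 3} \<Longrightarrow> a (gen i) = conj_by (h i) (gen (\<pi> i))"
      by (rule conjugatingE) blast
    define b where "b = inv\<^bsub>?A\<^esub> a"
    have ab: "a \<in> auto F3" "b \<in> auto F3"
      using a A.inv_closed[of a] by (auto simp: b_def carrier_opposite_AutoGroup)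
    have "compose (carrier F3) b a = (\<lambda>w\<in>carrier F3. w)"
      using A.r_inv[of a] ab unfolding b_def
      by (simp add: carrier_opposite_AutoGroup mult_opposite_AutoGroup one_opposite_AutoGroup)
    then have ba: "b (a w) = w" if "w \<in> carrier F3" for w
      using that by (metis compose_eq restrict_apply')
    let ?\<rho> = "inv_into UNIV \<pi>"
    have \<rho>: "?\<rho> permutes {1, 2, 3}" "\<pi> (?\<rho> i) = i" for i
      using permutes_inv[OF h(1)] permutes_inverses[OF h(1)] by auto
    have "conjugating b"
    proof (rule conjugatingI[OF \<rho>(1), of "\<lambda>i. inv\<^bsub>F3\<^esub> (b (h (?\<rho> i)))"])
      fix j :: nat assume j: "j \<in> {1, 2, 3}"
      define i where "i = ?\<rho> j"
      have i: "i \<in> {1, 2, 3}" "\<pi> i = j"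
        using permutes_in_image[OF \<rho>(1)] j \<rho>(2) unfolding i_def by auto
      have bh: "b (h i) \<in> carrier F3" "b (gen j) \<in> carrier F3" 
        using h i(1) j ab hom_F3D(1)[OF auto_F3D(1)] by simp_all
      then show "inv\<^bsub>F3\<^esub> (b (h (?\<rho> j))) \<in> carrier F3" by (simp add: i_def[symmetric])
      have "gen i = b (a (gen i))" using ba i by simp
      also have "\<dots> = conj_by (b (h i)) (b (gen j))"
        using h i j ab hom_conj_by[OF auto_F3D(1)] by simp
      finally show "b (gen j) = conj_by (inv\<^bsub>F3\<^esub> (b (h (?\<rho> j)))) (gen (?\<rho> j))"
        using bh conj_by_cancel[of "b (h i)" "b (gen j)"] by (simp add: i_def[symmetric])
    qed
    then show "inv\<^bsub>?A\<^esub> a \<in> ?H" using ab by (simp add: b_def)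
  qed
qed

lemma group_C3: "group C3"
  unfolding C3_def
  by (rule subgroup.subgroup_is_group[OF subgroup_conjugating group_opposite_AutoGroup])

interpretation C3: group C3
  by (rule group_C3)

lemma C3_auto: "a \<in> carrier C3 \<Longrightarrow> a \<in> auto F3"
  by (simp add: carrier_C3)

lemmas C3_hom = auto_F3D(1)[OF C3_auto]

lemma C3_closed: "a \<in> carrier C3 \<Longrightarrow> w \<in> carrier F3 \<Longrightarrow> a w \<in> carrier F3"
  by (rule hom_F3D(1)[OF C3_hom])

lemma C3_mult_apply:
  "a \<in> carrier C3 \<Longrightarrow> b \<in> carrier C3 \<Longrightarrow> w \<in> carrier F3 \<Longrightarrow> (a \<otimes>\<^bsub>C3\<^esub> b) w = b (a w)"
  using mult_opposite_AutoGroup[of a b] by (simp add: C3_def compose_def)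

lemma C3_one: "\<one>\<^bsub>C3\<^esub> = (\<lambda>w\<in>carrier F3. w)"
  by (simp add: C3_def one_opposite_AutoGroup)

lemma hom_extensional_eqI:
  assumes "a \<in> hom F3 F3" "b \<in> hom F3 F3" "a \<in> extensional (carrier F3)" "b \<in> extensional (carrier F3)"
    "\<And>i. i \<in> {1, 2, 3} \<Longrightarrow> a (gen i) = b (gen i)"
  shows "a = b"
  using hom_F3_eqI[OF assms(1,2,5)] assms(3,4) by (intro extensionalityI) auto

lemma C3_eqI:
  assumes "a \<in> carrier C3" "b \<in> carrier C3" "\<And>i. i \<in> {1, 2, 3} \<Longrightarrow> a (gen i) = b (gen i)"
  shows "a = b"
  using assms by (intro hom_extensional_eqI) (auto intro: C3_hom auto_F3D(3)[OF C3_auto])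

section \<open>Particular conjugating automorphisms\<close>

abbreviation endo :: "(nat \<Rightarrow> nat gword) \<Rightarrow> nat gword \<Rightarrow> nat gword" where
  "endo \<equiv> free_group_lift {1, 2, 3} F3"

lemma endo:
  assumes "\<And>i. i \<in> {1, 2, 3} \<Longrightarrow> f i \<in> carrier F3"
  shows "endo f \<in> hom F3 F3" "endo f \<in> extensional (carrier F3)" "i \<in> {1, 2, 3} \<Longrightarrow> endo f (gen i) = f i"
  using free_group_lift_hom[OF group_F3, of "{1, 2, 3}" f] free_group_lift_gen[OF group_F3, of i "{1, 2, 3}" f]
    free_group_lift_extensional[of "{1, 2, 3}" F3 f] assms
  by (auto simp: F3_def)

text \<open>
  Invertibility has to be checked on the generators only: both composites with \<open>\<psi>\<close> are endomorphisms
  agreeing with the identity there.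
\<close>
lemma endo_in_C3:
  assumes f: "\<And>i. i \<in> {1, 2, 3} \<Longrightarrow> f i = conj_by (h i) (gen (\<pi> i))" "\<And>i. i \<in> {1, 2, 3} \<Longrightarrow> h i \<in> carrier F3"
    and \<pi>: "\<pi> permutes {1, 2, 3}"
    and \<psi>: "\<psi> \<in> hom F3 F3" "\<And>i. i \<in> {1, 2, 3} \<Longrightarrow> \<psi> (f i) = gen i"
      "\<And>i. i \<in> {1, 2, 3} \<Longrightarrow> endo f (\<psi> (gen i)) = gen i"
  shows "endo f \<in> carrier C3"
proof -
  have fC: "f i \<in> carrier F3" if "i \<in> {1, 2, 3}" for i
    using f[OF that] permutes_in_image[OF \<pi>, of i] that by simp
  note E = endo[of f, OF fC]
  have id: "(\<lambda>w. w) \<in> hom F3 F3" by (auto simp: hom_def)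
  have "\<psi> (endo f w) = w" if "w \<in> carrier F3" for w
    using hom_F3_eqI[of "\<lambda>w. \<psi> (endo f w)" "\<lambda>w. w" w] that \<psi> E id
    by (simp add: hom_def Pi_iff)
  moreover have "endo f (\<psi> w) = w" if "w \<in> carrier F3" for w
    using hom_F3_eqI[of "\<lambda>w. endo f (\<psi> w)" "\<lambda>w. w" w] that \<psi> E id
    by (simp add: hom_def Pi_iff)
  ultimately have "endo f \<in> auto F3"
    using E \<psi> by (intro auto_F3I[of _ \<psi>]) auto
  moreover have "conjugating (endo f)"
    using f \<pi> E(3) by (intro conjugatingI[of \<pi> h]) auto
  ultimately show ?thesis by (simp add: carrier_C3)
qed

definition conj_auto :: "nat \<Rightarrow> nat \<Rightarrow> bool \<Rightarrow> nat gword \<Rightarrow> nat gword" where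
  "conj_auto i j e = endo (\<lambda>l. if l = i then conj_by [(j, e)] (gen i) else gen l)"

lemma conj_auto_gen:
  assumes "i \<in> {1, 2, 3}" "j \<in> {1, 2, 3}" "l \<in> {1, 2, 3}"
  shows "conj_auto i j e (gen l) = (if l = i then conj_by [(j, e)] (gen i) else gen l)"
  unfolding conj_auto_def using assms by (subst endo(3)) auto

lemma conj_auto_hom: "i \<in> {1, 2, 3} \<Longrightarrow> j \<in> {1, 2, 3} \<Longrightarrow> conj_auto i j e \<in> hom F3 F3"
  unfolding conj_auto_def by (rule endo(1)) auto

lemma conj_auto_letter:
  assumes "i \<in> {1, 2, 3}" "j \<in> {1, 2, 3}" "l \<in> {1, 2, 3}" "l \<noteq> i"
  shows "conj_auto i j e [(l, d)] = [(l, d)]"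
  using assms by (simp only: hom_letter[OF conj_auto_hom] conj_auto_gen if_False signed_gen)

lemma conj_auto_flip:
  assumes "i \<in> {1, 2, 3}" "j \<in> {1, 2, 3}" "i \<noteq> j" "l \<in> {1, 2, 3}"
  shows "conj_auto i j (\<not> e) (conj_auto i j e (gen l)) = gen l"
proof (cases "l = i")
  case True
  have "conj_auto i j (\<not> e) (conj_by [(j, e)] (gen i)) = conj_by [(j, e)] (conj_by [(j, \<not> e)] (gen i))"
    using assms conj_auto_hom[of i j "\<not> e"] by (simp only: hom_conj_by letter_F3 gen_F3 conj_auto_letter conj_auto_gen if_True refl not_sym)
  also have "\<dots> = gen i"
    using assms conj_by_cancel[of "[(j, \<not> e)]" "gen i"] by (simp only: inv_letter_F3 letter_F3 gen_F3 not_not)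
  finally show ?thesis using True assms by (simp only: conj_auto_gen if_True refl)
qed (use assms in \<open>simp only: conj_auto_gen if_False\<close>)

lemma conj_auto_C3:
  assumes "i \<in> {1, 2, 3}" "j \<in> {1, 2, 3}" "i \<noteq> j"
  shows "conj_auto i j e \<in> carrier C3"
  unfolding conj_auto_def
proof (rule endo_in_C3[where \<pi> = id and h = "\<lambda>l. if l = i then [(j, e)] else \<one>\<^bsub>F3\<^esub>" and \<psi> = "conj_auto i j (\<not> e)"])
  fix l :: nat assume l: "l \<in> {1, 2, 3}"
  show "conj_auto i j (\<not> e) (if l = i then conj_by [(j, e)] (gen i) else gen l) = gen l"
    using conj_auto_flip[OF assms l, of e] assms l by (simp only: conj_auto_gen)
  show "endo (\<lambda>l. if l = i then conj_by [(j, e)] (gen i) else gen l) (conj_auto i j (\<not> e) (gen l)) = gen l"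
    using conj_auto_flip[OF assms l, of "\<not> e"] by (simp add: conj_auto_def)
qed (use assms conj_auto_hom permutes_id in \<open>simp_all split: if_splits\<close>)

lemma conj_auto_inverse:
  assumes "i \<in> {1, 2, 3}" "j \<in> {1, 2, 3}" "i \<noteq> j"
  shows "inv\<^bsub>C3\<^esub> (conj_auto i j e) = conj_auto i j (\<not> e)"
proof (rule C3.inv_equality)
  show "conj_auto i j (\<not> e) \<otimes>\<^bsub>C3\<^esub> conj_auto i j e = \<one>\<^bsub>C3\<^esub>"
  proof (rule C3_eqI)
    fix l :: nat assume l: "l \<in> {1, 2, 3}"
    then have "gen l \<in> carrier F3" by (simp only: gen_F3)
    then show "(conj_auto i j (\<not> e) \<otimes>\<^bsub>C3\<^esub> conj_auto i j e) (gen l) = \<one>\<^bsub>C3\<^esub> (gen l)"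
      using conj_auto_flip[OF assms l, of "\<not> e"] conj_auto_C3[OF assms, of e] conj_auto_C3[OF assms, of "\<not> e"]
      by (simp only: C3_mult_apply C3_one restrict_apply' not_not)
  qed (simp_all add: conj_auto_C3[OF assms])
qed (simp_all add: conj_auto_C3[OF assms])

lemma alpha_gen:
  "alpha 1 (gen 1) = gen 2" "alpha 1 (gen 2) = gen 1" "alpha 1 (gen 3) = gen 3"
  "alpha 2 (gen 1) = gen 1" "alpha 2 (gen 2) = gen 3" "alpha 2 (gen 3) = gen 2"
  unfolding alpha_def by (subst endo(3); auto)+

lemma alpha_C3: "i \<in> {1, 2} \<Longrightarrow> alpha i \<in> carrier C3"
proof -
  assume i: "i \<in> {1, 2}"
  have inv: "alpha i (alpha i (gen l)) = gen l" if "l \<in> {1, 2, 3}" for l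
  proof -
    have "i = 1 \<or> i = 2" "l = 1 \<or> l = 2 \<or> l = 3" using i that by simp_all
    then show ?thesis by (elim disjE) (simp_all only: alpha_gen)
  qed
  let ?f = "\<lambda>l. if l = i then gen (i + 1) else if l = i + 1 then gen i else gen l"
  have hom: "alpha i \<in> hom F3 F3" and gen: "l \<in> {1, 2, 3} \<Longrightarrow> alpha i (gen l) = ?f l" for l
    unfolding alpha_def using i by (intro endo(1,3); auto)+
  show ?thesis
    unfolding alpha_def
  proof (rule endo_in_C3[where \<pi> = "Transposition.transpose i (i + 1)" and h = "\<lambda>_. \<one>\<^bsub>F3\<^esub>" and \<psi> = "alpha i"])
    show "Transposition.transpose i (i + 1) permutes {1, 2, 3}"
      using i by (intro permutes_swap_id) auto
    fix l :: nat assume l: "l \<in> {1, 2, 3}"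
    show "?f l = conj_by \<one>\<^bsub>F3\<^esub> (gen (Transposition.transpose i (i + 1) l))"
    proof -
      have "i = 1 \<or> i = 2" "l = 1 \<or> l = 2 \<or> l = 3" using i l by simp_all
      then show ?thesis by (elim disjE) (simp_all add: Transposition.transpose_def)
    qed
    show "alpha i (?f l) = gen l"
      using inv[OF l] by (simp only: gen[OF l])
    show "endo ?f (alpha i (gen l)) = gen l"
      using inv[OF l] by (simp only: alpha_def)
  qed (simp_all add: hom)
qed

lemma sigma_gen:
  "sigma 1 (gen 1) = conj_by (gen 1) (gen 2)" "sigma 1 (gen 2) = gen 1" "sigma 1 (gen 3) = gen 3"
  "sigma 2 (gen 1) = gen 1" "sigma 2 (gen 2) = conj_by (gen 2) (gen 3)" "sigma 2 (gen 3) = gen 2"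
  unfolding sigma_def by (subst endo(3); auto simp: conj_by_def)+

text \<open>
  This reduces the braid generators to permutations and the automorphisms \<open>c(i, j)\<close>.
\<close>
lemma sigma_eq:
  "sigma 1 = alpha 1 \<otimes>\<^bsub>C3\<^esub> conj_auto 2 1 True"
  "sigma 2 = alpha 2 \<otimes>\<^bsub>C3\<^esub> conj_auto 3 2 True"
proof -
  have *: "sigma i \<in> hom F3 F3" "sigma i \<in> extensional (carrier F3)" if "i \<in> {1, 2}" for i
    unfolding sigma_def using that by (intro endo; auto)+
  have **: "sigma i = a" if "a \<in> carrier C3" "i \<in> {1, 2}"
     "\<And>l. l \<in> {1, 2, 3} \<Longrightarrow> sigma i (gen l) = a (gen l)" for i a
    using that * C3_hom auto_F3D(3)[OF C3_auto] by (intro hom_extensional_eqI) auto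
  show "sigma 1 = alpha 1 \<otimes>\<^bsub>C3\<^esub> conj_auto 2 1 True" "sigma 2 = alpha 2 \<otimes>\<^bsub>C3\<^esub> conj_auto 3 2 True"
    by (intro **; auto simp: conj_auto_C3 alpha_C3 C3_mult_apply alpha_gen[simplified] sigma_gen[simplified] conj_auto_gen[simplified]; simp add: gen_def)+
qed

lemma sigma_C3: "i \<in> {1, 2} \<Longrightarrow> sigma i \<in> carrier C3"
  using sigma_eq alpha_C3[of 1] alpha_C3[of 2] conj_auto_C3[of 2 1 True] conj_auto_C3[of 3 2 True] by auto

text \<open>
  Conjugation from the right, so that \<open>inner_auto\<close> is multiplicative for the left-to-right product of
  automorphisms.
\<close>
definition inner_auto :: "nat gword \<Rightarrow> nat gword \<Rightarrow> nat gword" where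
  "inner_auto h = (\<lambda>w\<in>carrier F3. conj_by (inv\<^bsub>F3\<^esub> h) w)"

lemma inner_auto_apply: "w \<in> carrier F3 \<Longrightarrow> inner_auto h w = conj_by (inv\<^bsub>F3\<^esub> h) w"
  by (simp add: inner_auto_def)

lemma inner_auto_C3: "h \<in> carrier F3 \<Longrightarrow> inner_auto h \<in> carrier C3"
proof -
  assume h: "h \<in> carrier F3"
  have hom: "inner_auto k \<in> hom F3 F3" if "k \<in> carrier F3" for k
    using that by (auto simp: hom_def inner_auto_apply conj_by_mult)
  have "inner_auto h \<in> auto F3"
    using h hom conj_by_cancel[of h] conj_by_cancel[of "inv\<^bsub>F3\<^esub> h"]
    by (intro auto_F3I[of _ "inner_auto (inv\<^bsub>F3\<^esub> h)"]) (simp_all add: inner_auto_apply, simp add: inner_auto_def)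
  moreover have "conjugating (inner_auto h)"
    using h by (intro conjugatingI[of id "\<lambda>_. inv\<^bsub>F3\<^esub> h"] permutes_id) (simp_all add: inner_auto_apply)
  ultimately show ?thesis by (simp add: carrier_C3)
qed

section \<open>Freeness modulo inner automorphisms\<close>

definition nxt :: "nat \<Rightarrow> nat" where
  "nxt j = (if j = 1 then 2 else if j = 2 then 3 else 1)"

lemma nxt_simps [simp]: "nxt 1 = 2" "nxt 2 = 3" "nxt 3 = 1"
  by (simp_all add: nxt_def)

lemma nxt_cases:
  assumes "j \<in> {1, 2, 3}"
  shows "{nxt j, j, nxt (nxt j)} = {1, 2, 3}" "nxt j \<noteq> j" "j \<noteq> nxt (nxt j)" "nxt j \<noteq> nxt (nxt j)"
    "nxt j \<in> {1, 2, 3}" "nxt (nxt j) \<in> {1, 2, 3}" "nxt (nxt (nxt j)) = j"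
proof -
  have "j = 1 \<or> j = 2 \<or> j = 3" using assms by simp
  then show "{nxt j, j, nxt (nxt j)} = {1, 2, 3}" "nxt j \<noteq> j" "j \<noteq> nxt (nxt j)" "nxt j \<noteq> nxt (nxt j)"
    "nxt j \<in> {1, 2, 3}" "nxt (nxt j) \<in> {1, 2, 3}" "nxt (nxt (nxt j)) = j"
    by (elim disjE; simp; blast)+
qed

text \<open>
  One representative of each pair \<open>c(i, j)\<close>, \<open>c(k, j)\<close> of automorphisms that are inverse to each other
  modulo inner ones. Taking \<open>i = nxt j\<close> gives \<open>c(2, 1)\<close>, \<open>c(3, 2)\<close>, \<open>c(1, 3)\<close>.
\<close>
definition twist :: "nat \<Rightarrow> nat gword \<Rightarrow> nat gword" where
  "twist j = conj_auto (nxt j) j True"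

text \<open>
  Words in the three twists are indexed by the free group itself: the letter \<open>j\<close> stands for \<open>twist j\<close>.
\<close>
definition word_auto :: "nat gword \<Rightarrow> nat gword \<Rightarrow> nat gword" where
  "word_auto = free_group_lift {1, 2, 3} C3 twist"

lemma twist_C3: "j \<in> {1, 2, 3} \<Longrightarrow> twist j \<in> carrier C3"
  unfolding twist_def using nxt_cases by (intro conj_auto_C3)

lemma letter_value_twist:
  "j \<in> {1, 2, 3} \<Longrightarrow> letter_value C3 twist (j, e) = conj_auto (nxt j) j e"
  using conj_auto_inverse[of "nxt j" j True] nxt_cases(2,5)[of j]
  by (cases e) (simp_all only: letter_value_def twist_def fst_conv snd_conv if_True if_False simp_thms)

lemma word_auto_hom: "word_auto \<in> hom F3 C3"
  unfolding word_auto_def F3_def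
  using twist_C3 by (intro free_group_lift_hom[OF group_C3])

lemma word_auto_C3: "v \<in> carrier F3 \<Longrightarrow> word_auto v \<in> carrier C3"
  using word_auto_hom by (auto simp: hom_def)

lemma word_auto_Nil: "word_auto [] = \<one>\<^bsub>C3\<^esub>"
  unfolding word_auto_def by (rule free_group_lift_Nil)

lemma Cons_F3:
  assumes "a # v \<in> carrier F3"
  shows "fst a \<in> {1, 2, 3}" "v \<in> carrier F3"
  using assms by (auto simp: carrier_F3 reduced_Cons)

text \<open>
  Since products are read from left to right, a new first letter acts on the generators before
  the rest of the word does. Seen through that rest, it conjugates one of the three image
  elements by another: a move of the kind for which \<open>separated\<close> was designed.
\<close>
lemma word_auto_Cons:
  assumes "(j, e) # v \<in> carrier F3" "l \<in> {1, 2, 3}"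
  shows "word_auto ((j, e) # v) (gen l) =
    (if l = nxt j then conj_by (signed e (word_auto v (gen j))) (word_auto v (gen l)) else word_auto v (gen l))"
proof -
  have j: "j \<in> {1, 2, 3}" and v: "v \<in> carrier F3" using Cons_F3[OF assms(1)] by simp_all
  have "word_auto ((j, e) # v) = conj_auto (nxt j) j e \<otimes>\<^bsub>C3\<^esub> word_auto v"
    using free_group_lift_Cons[OF group_C3 assms(1)[unfolded F3_def], of twist] letter_value_twist[OF j]
    by (simp add: word_auto_def)
  then have "word_auto ((j, e) # v) (gen l) = word_auto v (conj_auto (nxt j) j e (gen l))"
    using conj_auto_C3[OF nxt_cases(5)[OF j] j nxt_cases(2)[OF j], of e] word_auto_C3[OF v] assms(2)
    by (simp only: C3_mult_apply gen_F3)
  also have "\<dots> = (if l = nxt j then conj_by (signed e (word_auto v (gen j))) (word_auto v (gen l)) else word_auto v (gen l))"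
    using hom_conj_by[OF C3_hom[OF word_auto_C3[OF v]], of "[(j, e)]" "gen l"]
      hom_letter[OF C3_hom[OF word_auto_C3[OF v]] j] assms(2) j
    by (cases "l = nxt j") (simp_all only: conj_auto_gen[OF nxt_cases(5)[OF j] j] letter_F3 gen_F3 simp_thms if_True if_False)
  finally show ?thesis .
qed

lemma separated_cong:
  assumes "separated j i k e Y" "Y j = Z j" "Y i = Z i" "Y k = Z k"
  shows "separated j i k e Z"
  using assms unfolding separated_def by simp

text \<open>
  In a reduced word the letter preceding \<open>(j', e')\<close> either equals it, or has a different
  index, which is then one of the two outer positions of the triple. The three cases are the three
  preservation lemmas for \<open>separated\<close>; cancellation is the excluded fourth case.
\<close>
lemma separated_word_auto:
  assumes "(j, e) # v \<in> carrier F3"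
  shows "separated j (nxt j) (nxt (nxt j)) e (\<lambda>l. word_auto ((j, e) # v) (gen l))"
  using assms
proof (induction v arbitrary: j e)
  case Nil
  have j: "j \<in> {1, 2, 3}" using Cons_F3[OF Nil] by simp
  note n = nxt_cases[OF j]
  have one: "word_auto [] (gen l) = gen l" if "l \<in> {1, 2, 3}" for l
    using that by (simp only: word_auto_Nil C3_one restrict_apply' gen_F3)
  have nil: "[] \<in> carrier F3" by (simp add: carrier_F3)
  have cj_nil: "conj_by [] w = w" if "w \<in> carrier F3" for w using conj_by_one[OF that] by (simp add: one_F3)
  have "word_auto [(j, e)] (gen j) = gen j" "word_auto [(j, e)] (gen (nxt (nxt j))) = gen (nxt (nxt j))"
    "word_auto [(j, e)] (gen (nxt j)) = conj_by [(j, e)] (gen (nxt j))"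
    using n(2-4) not_sym[OF n(2)] not_sym[OF n(4)]
    by (simp_all only: word_auto_Cons[OF Nil] one j n(5,6) signed_gen refl if_True if_False)
  then show ?case
    using j n(5,6) nil
    by (intro separatedI[of "[]" "[]" "[]" "Suc 0"]) (simp_all add: starts_off_def ends_off_def cj_nil)
next
  case (Cons b v)
  obtain j' e' where b: "b = (j', e')" by (cases b)
  have w: "(j', e') # v \<in> carrier F3" using Cons_F3(2)[OF Cons.prems] by (simp add: b)
  have j: "j \<in> {1, 2, 3}" "j' \<in> {1, 2, 3}" using Cons_F3(1)[OF Cons.prems] Cons_F3(1)[OF w] by simp_all
  note n = nxt_cases[OF j(1)] and n' = nxt_cases[OF j(2)]
  define Y where "Y = (\<lambda>l. word_auto (b # v) (gen l))"
  have sep: "separated j' (nxt j') (nxt (nxt j')) e' Y"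
    using Cons.IH[OF w] by (simp add: Y_def b)
  have eq: "word_auto ((j, e) # b # v) (gen l) = (Y(nxt j := conj_by (signed e (Y j)) (Y (nxt j)))) l" if "l \<in> {1, 2, 3}" for l
    using word_auto_Cons[OF Cons.prems that] by (simp add: Y_def)
  have "separated j (nxt j) (nxt (nxt j)) e (Y(nxt j := conj_by (signed e (Y j)) (Y (nxt j))))"
  proof -
    have "j = j' \<or> j = nxt j' \<or> j = nxt (nxt j')" using j n'(1) by blast
    then consider "j = j'" "e = e'" | "j = nxt j'" | "j = nxt (nxt j')"
      using Cons.prems by (auto simp: carrier_F3 reduced_Cons b)
    then show ?thesis
    proof cases
      case 1
      show ?thesis using separated_same[OF n'(1-4) sep] by (simp only: 1)
    next
      case 2
      show ?thesis using separated_next[OF n'(1-4) sep, of e] by (simp only: 2 n'(7))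
    next
      case 3
      show ?thesis using separated_prev[OF n'(1-4) sep, of e] by (simp only: 3 n'(7))
    qed
  qed
  then show ?case
    by (rule separated_cong) (simp_all only: eq j n(5,6))
qed

lemma word_auto_not_inner:
  assumes "v \<in> carrier F3" "v \<noteq> []" "h \<in> carrier F3"
  shows "word_auto v \<noteq> inner_auto h"
proof
  assume inn: "word_auto v = inner_auto h"
  obtain j e u where v: "v = (j, e) # u" using assms(2) by (cases v) auto
  have j: "j \<in> {1, 2, 3}" using Cons_F3(1) assms(1) v by fastforce
  show False
  proof (rule separated_not_inner[OF nxt_cases(1-4)[OF j] separated_word_auto[of j e u]])
    show "(j, e) # u \<in> carrier F3" using assms v by simp
    fix l :: nat assume l: "l \<in> {1, 2, 3}"
    then show "word_auto ((j, e) # u) (gen l) = conj_by (inv\<^bsub>F3\<^esub> h) (gen l)"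
      unfolding v[symmetric] inn by (simp only: inner_auto_apply gen_F3)
  qed (use assms(3) in simp)
qed

text \<open>
  The free group has trivial centre: a central element is both a power of \<open>x\<^sub>1\<close> and a power of \<open>x\<^sub>2\<close>.
\<close>
lemma inner_auto_eq_one:
  assumes h: "h \<in> carrier F3" and one: "inner_auto h = \<one>\<^bsub>C3\<^esub>"
  shows "h = []"
proof -
  have "conj_by (inv\<^bsub>F3\<^esub> h) (gen i) = gen i" if "i \<in> {1, 2, 3}" for i
    using that fun_cong[OF one, of "gen i"] by (simp only: C3_one inner_auto_apply gen_F3 restrict_apply')
  then obtain m n b c where "inv\<^bsub>F3\<^esub> h = replicate m (1, b)" "inv\<^bsub>F3\<^esub> h = replicate n (2, c)"
    using commutes_gen_imp_replicate[of "inv\<^bsub>F3\<^esub> h" 1] commutes_gen_imp_replicate[of "inv\<^bsub>F3\<^esub> h" 2] h by auto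
  then have "inv\<^bsub>F3\<^esub> h = \<one>\<^bsub>F3\<^esub>"
    by (cases m; cases n) (auto simp: one_F3)
  then show ?thesis using h by (metis F3.inv_inv F3.inv_one one_F3)
qed

section \<open>Exponent sums and pure automorphisms\<close>

text \<open>
  Weighted exponent sums serve two purposes. With weight one on a single generator they show
  that distinct generators are not conjugate, and with weight one everywhere they give the exponent
  of the scalar by which an inner automorphism acts.
\<close>
definition weight :: "(nat \<Rightarrow> int) \<Rightarrow> nat gword \<Rightarrow> int" where
  "weight f = free_group_lift {1, 2, 3} integer_group f"

lemma weight_hom: "weight f \<in> hom F3 integer_group"
  unfolding weight_def F3_def by (intro free_group_lift_hom) simp_all

lemma weight_mult: "u \<in> carrier F3 \<Longrightarrow> v \<in> carrier F3 \<Longrightarrow> weight f (u \<otimes>\<^bsub>F3\<^esub> v) = weight f u + weight f v"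
  using hom_mult[OF weight_hom[of f]] by simp

lemma weight_gen: "i \<in> {1, 2, 3} \<Longrightarrow> weight f (gen i) = f i"
  unfolding weight_def by (rule free_group_lift_gen) simp_all

lemma weight_one: "weight f [] = 0"
  unfolding weight_def by (simp add: free_group_lift_Nil)

lemma weight_inv: "u \<in> carrier F3 \<Longrightarrow> weight f (inv\<^bsub>F3\<^esub> u) = - weight f u"
  using weight_mult[of u "inv\<^bsub>F3\<^esub> u" f] by (simp add: one_F3 weight_one)

lemma weight_conj_by: "h \<in> carrier F3 \<Longrightarrow> w \<in> carrier F3 \<Longrightarrow> weight f (conj_by h w) = weight f w"
  by (simp add: conj_by_def weight_mult weight_inv)

lemma gen_conj_gen:
  assumes "h \<in> carrier F3" "i \<in> {1, 2, 3}" "j \<in> {1, 2, 3}" "conj_by h (gen i) = gen j"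
  shows "i = j"
  using weight_conj_by[OF assms(1), of "gen i" "\<lambda>l. if l = i then 1 else 0"] assms(2-4)
  by (simp add: weight_gen del: insert_iff split: if_splits)

definition pure_C3 :: "(nat gword \<Rightarrow> nat gword) set" where
  "pure_C3 = {a \<in> carrier C3. \<forall>i\<in>{1, 2, 3}. \<exists>h\<in>carrier F3. a (gen i) = conj_by h (gen i)}"

lemma pure_C3_mult:
  assumes "a \<in> pure_C3" "b \<in> pure_C3" shows "a \<otimes>\<^bsub>C3\<^esub> b \<in> pure_C3"
proof -
  have ab: "a \<in> carrier C3" "b \<in> carrier C3" using assms by (auto simp: pure_C3_def)
  have "\<exists>h\<in>carrier F3. (a \<otimes>\<^bsub>C3\<^esub> b) (gen i) = conj_by h (gen i)" if i: "i \<in> {1, 2, 3}" for i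
  proof -
    obtain h k where h: "h \<in> carrier F3" "a (gen i) = conj_by h (gen i)"
      and k: "k \<in> carrier F3" "b (gen i) = conj_by k (gen i)"
      using assms i unfolding pure_C3_def by blast
    have "(a \<otimes>\<^bsub>C3\<^esub> b) (gen i) = conj_by (b h \<otimes>\<^bsub>F3\<^esub> k) (gen i)"
      using ab h k i C3_closed[OF ab(2)] hom_conj_by[OF C3_hom[OF ab(2)], of h "gen i"]
      by (simp only: C3_mult_apply gen_F3 conj_by_conj_by)
    then show ?thesis using h(1) k(1) C3_closed[OF ab(2)] by blast
  qed
  with ab show ?thesis unfolding pure_C3_def by blast
qed

lemma pure_C3_conj_auto:
  assumes "i \<in> {1, 2, 3}" "j \<in> {1, 2, 3}" "i \<noteq> j"
  shows "conj_auto i j e \<in> pure_C3"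
proof -
  have "\<exists>h\<in>carrier F3. conj_auto i j e (gen l) = conj_by h (gen l)" if l: "l \<in> {1, 2, 3}" for l
  proof (cases "l = i")
    case True
    then show ?thesis using assms by (intro bexI[of _ "[(j, e)]"]) (simp_all only: conj_auto_gen letter_F3 if_True refl)
  next
    case False
    then show ?thesis using assms l 
      by (intro bexI[of _ "\<one>\<^bsub>F3\<^esub>"]) (simp_all only: conj_auto_gen conj_by_one gen_F3 if_False F3.one_closed)
  qed
  then show ?thesis using conj_auto_C3[OF assms] unfolding pure_C3_def by blast
qed

lemma pure_C3_inner_auto: "h \<in> carrier F3 \<Longrightarrow> inner_auto h \<in> pure_C3"
  using inner_auto_C3[of h] by (auto simp: pure_C3_def inner_auto_apply intro!: bexI[of _ "inv\<^bsub>F3\<^esub> h"])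

lemma pure_C3_one: "\<one>\<^bsub>C3\<^esub> \<in> pure_C3"
proof -
  have "\<one>\<^bsub>C3\<^esub> (gen i) = conj_by \<one>\<^bsub>F3\<^esub> (gen i)" if "i \<in> {1, 2, 3}" for i
    using that by (simp only: C3_one restrict_apply' gen_F3 conj_by_one)
  then show ?thesis unfolding pure_C3_def using C3.one_closed F3.one_closed by blast
qed

lemma pure_C3_word_auto: "v \<in> carrier F3 \<Longrightarrow> word_auto v \<in> pure_C3"
proof (induction v)
  case (Cons a v)
  obtain j e where a: "a = (j, e)" by (cases a)
  have j: "j \<in> {1, 2, 3}" and v: "v \<in> carrier F3" using Cons_F3[OF Cons.prems] by (simp_all add: a)
  have "word_auto (a # v) = conj_auto (nxt j) j e \<otimes>\<^bsub>C3\<^esub> word_auto v"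
    using free_group_lift_Cons[OF group_C3 Cons.prems[unfolded F3_def], of twist] letter_value_twist[OF j]
    by (simp add: word_auto_def a)
  then show ?case
    using Cons.IH[OF v] pure_C3_mult pure_C3_conj_auto[OF nxt_cases(5)[OF j] j nxt_cases(2)[OF j]] by simp
qed (simp add: word_auto_Nil pure_C3_one)

section \<open>Generation of the group of conjugating automorphisms\<close>

text \<open>
  Final letters \<open>x\<^sub>i\<^bsup>\<plusminus>1\<^esup>\<close> of a conjugator do not affect the conjugate of \<open>x\<^sub>i\<close>.
\<close>
lemma strip_conjugator:
  assumes "h \<in> carrier F3" "i \<in> {1, 2, 3}"
  shows "\<exists>k\<in>carrier F3. length k \<le> length h \<and> ends_off i k \<and> conj_by h (gen i) = conj_by k (gen i)"
  using assms(1)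
proof (induction h rule: rev_induct)
  case Nil
  then show ?case by (auto simp: ends_off_def)
next
  case (snoc a z)
  show ?case
  proof (cases "fst a = i")
    case True
    then obtain e where a: "a = (i, e)" by (cases a) auto
    have z: "z \<in> carrier F3" and "z @ [a] = z \<otimes>\<^bsub>F3\<^esub> [a]"
      using snoc.prems mult_F3_append[of z "[a]"] by (auto simp: carrier_F3 reduced_append)
    then have "conj_by (z @ [a]) (gen i) = conj_by z (conj_by [a] (gen i))"
      using assms(2) by (simp only: a conj_by_conj_by letter_F3 gen_F3)
    also have "\<dots> = conj_by z (gen i)" using assms(2) by (simp only: a letter_commutes)
    finally have eq: "conj_by (z @ [a]) (gen i) = conj_by z (gen i)" .
    obtain k where "k \<in> carrier F3" "length k \<le> length z" "ends_off i k" "conj_by z (gen i) = conj_by k (gen i)"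
      using snoc.IH[OF z] by blast
    with eq show ?thesis by (intro bexI[of _ k]) simp_all
  next
    case False
    then show ?thesis using snoc.prems by (intro bexI[of _ "z @ [a]"]) (auto simp: ends_off_def)
  qed
qed

lemma length_mult_le: "length (u \<otimes>\<^bsub>F3\<^esub> v) \<le> length u + length v"
proof -
  have "length (prepend_letter a w) \<le> Suc (length w)" for a and w :: "nat gword"
    by (cases w) (auto simp: prepend_letter_Cons)
  then have "length (foldr prepend_letter u v) \<le> length u + length v"
    by (induction u) (auto intro: order_trans)
  then show ?thesis by (simp add: F3_def mult_free_group)
qed

lemma append_F3D:
  "u @ v \<in> carrier F3 \<Longrightarrow> u \<in> carrier F3 \<and> v \<in> carrier F3 \<and> u @ v = u \<otimes>\<^bsub>F3\<^esub> v"
  by (auto simp: carrier_F3 reduced_append mult_F3_append)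

lemma append_F3I:
  "u \<in> carrier F3 \<Longrightarrow> v \<in> carrier F3 \<Longrightarrow> u = [] \<or> v = [] \<or> hd v \<noteq> flip_letter (last u) \<Longrightarrow> u @ v \<in> carrier F3"
  by (auto simp: carrier_F3 reduced_append)

lemma ends_off_last: "ends_off i w \<Longrightarrow> w = [] \<or> (i, b) \<noteq> flip_letter (last w)"
  by (auto simp: ends_off_def flip_letter_def)

lemma starts_off_hd: "starts_off i w \<Longrightarrow> w = [] \<or> hd w \<noteq> (i, b)"
  by (auto simp: starts_off_def)

text \<open>
  The hypothesis on prefixes says that no conjugator extends another one in such a way that conjugation by
  \<open>\<phi> x\<^sub>j\<^bsup>\<plusminus>1\<^esup>\<close> would shorten it. Then in a product of images \<open>h\<^sub>i x\<^sub>i\<^bsup>\<plusminus>1\<^esup> h\<^sub>i\<^bsup>-1\<^esup>\<close> the cancellation between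
  \<open>h\<^sub>i\<^bsup>-1\<^esup>\<close> and the next \<open>h\<^sub>j\<close> never reaches either of the two middle letters. So they survive, and
  the product still begins with \<open>h\<^sub>i x\<^sub>i\<^bsup>\<plusminus>1\<^esup>\<close>.
\<close>
lemma image_starts_with_conjugator:
  assumes \<phi>: "\<phi> \<in> hom F3 F3"
    and h: "\<And>i. i \<in> {1, 2, 3} \<Longrightarrow> h i \<in> carrier F3" "\<And>i. i \<in> {1, 2, 3} \<Longrightarrow> ends_off i (h i)"
      "\<And>i. i \<in> {1, 2, 3} \<Longrightarrow> \<phi> (gen i) = conj_by (h i) (gen i)"
    and irreducible: "\<And>i j e. i \<in> {1, 2, 3} \<Longrightarrow> j \<in> {1, 2, 3} \<Longrightarrow> i \<noteq> j \<Longrightarrow> \<not> prefix (h j @ [(j, e)]) (h i)"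
    and "(i, e) # v \<in> carrier F3"
  shows "\<exists>z. h i @ (i, e) # z \<in> carrier F3 \<and> \<phi> ((i, e) # v) = h i @ (i, e) # z"
  using assms(6)
proof (induction v arbitrary: i e)
  case Nil
  have i: "i \<in> {1, 2, 3}" using Cons_F3[OF Nil] by simp
  note hi = h(1,2)[OF i]
  have fl: "flip_word (h i) \<in> carrier F3" using hi(1) by (simp add: inv_F3[symmetric])
  have "(i, e) # flip_word (h i) \<in> carrier F3"
    using append_F3I[of "[(i, e)]" "flip_word (h i)"] starts_off_hd[of i "flip_word (h i)" "\<not> e"] i hi(2) fl
    by simp
  moreover from this have mem: "h i @ (i, e) # flip_word (h i) \<in> carrier F3"
    using append_F3I[of "h i" "(i, e) # flip_word (h i)"] hi ends_off_last[of i "h i" e] by simp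
  moreover have "\<phi> [(i, e)] = conj_by (h i) [(i, e)]"
    by (simp only: hom_letter[OF \<phi> i] h(3)[OF i] signed_conj_by[OF hi(1) i])
  ultimately show ?case
    using append_F3D[of "h i" "(i, e) # flip_word (h i)"] append_F3D[of "[(i, e)]" "flip_word (h i)"] hi i
    by (intro exI[of _ "flip_word (h i)"]) (simp add: conj_by_def inv_F3 F3.m_assoc fl)
next
  case (Cons b v)
  obtain j d where b: "b = (j, d)" by (cases b)
  have w: "(j, d) # v \<in> carrier F3" using Cons_F3(2)[OF Cons.prems] by (simp add: b)
  have i: "i \<in> {1, 2, 3}" and j: "j \<in> {1, 2, 3}" using Cons_F3(1)[OF Cons.prems] Cons_F3(1)[OF w] by simp_all
  note hi = h(1,2)[OF i] and hj = h(1,2)[OF j]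
  obtain z where z: "h j @ (j, d) # z \<in> carrier F3" "\<phi> ((j, d) # v) = h j @ (j, d) # z"
    using Cons.IH[OF w] by blast
  define r where "r = (j, d) # z"
  have fl: "flip_word (h i) \<in> carrier F3" using hi(1) by (simp add: inv_F3[symmetric])
  have "\<phi> ((i, e) # b # v) = \<phi> [(i, e)] \<otimes>\<^bsub>F3\<^esub> \<phi> (b # v)"
    using append_F3D[of "[(i, e)]" "b # v"] Cons.prems hom_F3D(2)[OF \<phi>] by simp
  also have "\<phi> [(i, e)] = conj_by (h i) [(i, e)]"
    by (simp only: hom_letter[OF \<phi> i] h(3)[OF i] signed_conj_by[OF hi(1) i])
  also have "\<phi> (b # v) = h j @ r" using z by (simp add: b r_def)
  also have "conj_by (h i) [(i, e)] \<otimes>\<^bsub>F3\<^esub> (h j @ r) = h i \<otimes>\<^bsub>F3\<^esub> ([(i, e)] \<otimes>\<^bsub>F3\<^esub> (inv\<^bsub>F3\<^esub> (h i) \<otimes>\<^bsub>F3\<^esub> (h j @ r)))"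
    using z(1) hi(1) i by (simp add: conj_by_def F3.m_assoc r_def)
  finally have eq: "\<phi> ((i, e) # b # v) = h i \<otimes>\<^bsub>F3\<^esub> ([(i, e)] \<otimes>\<^bsub>F3\<^esub> (inv\<^bsub>F3\<^esub> (h i) \<otimes>\<^bsub>F3\<^esub> (h j @ r)))" .
  have "\<exists>m\<in>carrier F3. inv\<^bsub>F3\<^esub> (h i) \<otimes>\<^bsub>F3\<^esub> (h j @ r) = m \<and> m \<noteq> [] \<and> hd m \<noteq> (i, \<not> e)"
  proof (cases "i = j")
    case True
    have "h j @ r = h j \<otimes>\<^bsub>F3\<^esub> r" "r \<in> carrier F3" using append_F3D[of "h j" r] z(1) by (auto simp: r_def)
    then have "inv\<^bsub>F3\<^esub> (h i) \<otimes>\<^bsub>F3\<^esub> (h j @ r) = r" using True hj by simp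
    moreover have "d = e" using Cons.prems True by (auto simp: b carrier_F3 reduced_Cons)
    ultimately show ?thesis using True \<open>r \<in> carrier F3\<close> by (auto simp: r_def)
  next
    case False
    \<comment> \<open>What cancels in the product of \<open>h\<^sub>i\<^bsup>-1\<^esup>\<close> and \<open>h\<^sub>j\<close> is their longest common prefix.\<close>
    obtain c x y where c: "h i = c @ x" "h j = c @ y" "x = [] \<or> y = [] \<or> hd x \<noteq> hd y"
      using longest_common_prefix[of "h i" "h j"] by blast
    have x: "c \<in> carrier F3" "x \<in> carrier F3" "h i = c \<otimes>\<^bsub>F3\<^esub> x"
      using append_F3D[of c x] hi(1) c(1) by simp_all
    have yr: "y @ r \<in> carrier F3" "h j @ r = c \<otimes>\<^bsub>F3\<^esub> (y @ r)"
      using append_F3D[of c "y @ r"] z(1) c(2) by (simp_all add: r_def)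
    have fx: "flip_word x \<in> carrier F3" using x(2) by (simp add: inv_F3[symmetric])
    have "flip_word x = [] \<or> hd (y @ r) \<noteq> flip_letter (last (flip_word x))"
    proof (cases x)
      case (Cons a x')
      have "hd (y @ r) \<noteq> a"
      proof (cases y)
        case Nil
        have "\<not> prefix (h j @ [(j, d)]) (h i)" using irreducible[OF i j False] .
        then show ?thesis using c Nil Cons by (auto simp: r_def)
      qed (use c Cons in auto)
      then show ?thesis by (simp add: Cons flip_word_def)
    qed (simp add: flip_word_def)
    then have mem: "flip_word x @ (y @ r) \<in> carrier F3"
      using append_F3I[OF fx yr(1)] by blast
    moreover have "inv\<^bsub>F3\<^esub> (h i) \<otimes>\<^bsub>F3\<^esub> (h j @ r) = flip_word x @ (y @ r)"
      using append_F3D[OF mem] x yr by (simp add: F3.inv_mult_group F3.m_assoc inv_F3[OF x(2)])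
    moreover have "hd (flip_word x @ (y @ r)) \<noteq> (i, \<not> e)"
    proof (cases "x = []")
      case True
      have "\<not> prefix (h i @ [(i, \<not> e)]) (h j)" using irreducible[OF j i] False by simp
      then show ?thesis using c True False by (cases y) (auto simp: r_def flip_word_def)
    next
      case False
      then have "starts_off i (flip_word x)" using hi(2) c(1) by (simp add: ends_off_append)
      then show ?thesis using False by (auto simp: starts_off_def)
    qed
    moreover have "flip_word x @ (y @ r) \<noteq> []" by (simp add: r_def)
    ultimately show ?thesis by blast
  qed
  then obtain m where m: "m \<in> carrier F3" "inv\<^bsub>F3\<^esub> (h i) \<otimes>\<^bsub>F3\<^esub> (h j @ r) = m" "m \<noteq> []" "hd m \<noteq> (i, \<not> e)"
    by blast
  have im: "[(i, e)] @ m \<in> carrier F3"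
    using append_F3I[of "[(i, e)]" m] m i by auto
  have him: "h i @ [(i, e)] @ m \<in> carrier F3"
    using append_F3I[OF hi(1) im] ends_off_last[OF hi(2), of e] by simp
  show ?case
    using him eq append_F3D[OF him] append_F3D[OF im] m(2) by (intro exI[of _ m]) auto
qed

abbreviation C3_gens :: "(nat gword \<Rightarrow> nat gword) set" where
  "C3_gens \<equiv> {sigma 1, sigma 2, alpha 1, alpha 2}"

lemma C3_gens_subset: "C3_gens \<subseteq> carrier C3"
  using sigma_C3 alpha_C3 by auto

lemma generate_C3: "generate C3 C3_gens \<subseteq> carrier C3"
  by (rule C3.generate_incl[OF C3_gens_subset])

lemma alpha_involution: "a \<in> {1, 2} \<Longrightarrow> alpha a \<otimes>\<^bsub>C3\<^esub> alpha a = \<one>\<^bsub>C3\<^esub>"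
proof (rule C3_eqI)
  fix i :: nat assume a: "a \<in> {1, 2}" and i: "i \<in> {1, 2, 3}"
  then have "alpha a (alpha a (gen i)) = gen i"
    using alpha_gen by auto
  then show "(alpha a \<otimes>\<^bsub>C3\<^esub> alpha a) (gen i) = \<one>\<^bsub>C3\<^esub> (gen i)"
    using alpha_C3[OF a] i by (simp only: C3_mult_apply gen_F3 C3_one restrict_apply')
qed (simp_all add: alpha_C3)

lemma alpha_conj_auto:
  assumes a: "a \<in> {1, 2}" and \<tau>: "\<And>l. l \<in> {1, 2, 3} \<Longrightarrow> \<tau> l \<in> {1, 2, 3}"
      "\<And>l. l \<in> {1, 2, 3} \<Longrightarrow> \<tau> (\<tau> l) = l" "\<And>l. l \<in> {1, 2, 3} \<Longrightarrow> alpha a (gen l) = gen (\<tau> l)"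
    and ij: "i \<in> {1, 2, 3}" "j \<in> {1, 2, 3}" "i \<noteq> j"
  shows "alpha a \<otimes>\<^bsub>C3\<^esub> conj_auto i j e \<otimes>\<^bsub>C3\<^esub> alpha a = conj_auto (\<tau> i) (\<tau> j) e"
proof (rule C3_eqI)
  have ne: "\<tau> i \<noteq> \<tau> j" using \<tau>(2)[OF ij(1)] \<tau>(2)[OF ij(2)] ij(3) by auto
  show mem: "alpha a \<otimes>\<^bsub>C3\<^esub> conj_auto i j e \<otimes>\<^bsub>C3\<^esub> alpha a \<in> carrier C3"
    "conj_auto (\<tau> i) (\<tau> j) e \<in> carrier C3"
    using alpha_C3[OF a] conj_auto_C3[OF ij] conj_auto_C3[OF \<tau>(1)[OF ij(1)] \<tau>(1)[OF ij(2)] ne] by simp_all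
  fix l :: nat assume l: "l \<in> {1, 2, 3}"
  note aC = alpha_C3[OF a] and cC = conj_auto_C3[OF ij, of e]
  have "(alpha a \<otimes>\<^bsub>C3\<^esub> conj_auto i j e \<otimes>\<^bsub>C3\<^esub> alpha a) (gen l) = alpha a (conj_auto i j e (gen (\<tau> l)))"
    using aC cC l \<tau>(1,3)[OF l] C3_closed[OF cC] by (simp only: C3_mult_apply C3.m_closed gen_F3)
  also have "\<dots> = conj_auto (\<tau> i) (\<tau> j) e (gen l)"
  proof (cases "\<tau> l = i")
    case True
    then have "\<tau> i = l" using \<tau>(2)[OF l] by simp
    moreover have "alpha a (conj_by [(j, e)] (gen i)) = conj_by [(\<tau> j, e)] (gen (\<tau> i))"
      using ij \<tau>(1)[OF ij(2)] by (simp only: hom_conj_by[OF C3_hom[OF aC]] hom_letter[OF C3_hom[OF aC]] \<tau>(3) signed_gen letter_F3 gen_F3)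
    ultimately show ?thesis using True l ij \<tau>(1)[OF ij(1)] \<tau>(1)[OF ij(2)]
      by (simp only: conj_auto_gen simp_thms if_True)
  next
    case False
    then have "l \<noteq> \<tau> i" using \<tau>(2)[OF ij(1)] by auto
    then show ?thesis using False l ij \<tau>(1)[OF ij(1)] \<tau>(1)[OF ij(2)] \<tau>(1)[OF l] \<tau>(2)[OF l]
      by (simp only: conj_auto_gen simp_thms if_False \<tau>(3))
  qed
  finally show "(alpha a \<otimes>\<^bsub>C3\<^esub> conj_auto i j e \<otimes>\<^bsub>C3\<^esub> alpha a) (gen l) = conj_auto (\<tau> i) (\<tau> j) e (gen l)" .
qed

definition swap1 :: "nat \<Rightarrow> nat" where "swap1 = Transposition.transpose 1 2"
definition swap2 :: "nat \<Rightarrow> nat" where "swap2 = Transposition.transpose 2 3"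

lemma swap_simps [simp]:
  "swap1 1 = 2" "swap1 2 = 1" "swap1 3 = 3" "swap2 1 = 1" "swap2 2 = 3" "swap2 3 = 2"
  by (simp_all add: swap1_def swap2_def transpose_apply_other)

lemma alpha_conj_auto_swap:
  assumes ij: "i \<in> {1, 2, 3}" "j \<in> {1, 2, 3}" "i \<noteq> j"
  shows "alpha 1 \<otimes>\<^bsub>C3\<^esub> conj_auto i j e \<otimes>\<^bsub>C3\<^esub> alpha 1 = conj_auto (swap1 i) (swap1 j) e"
    "alpha 2 \<otimes>\<^bsub>C3\<^esub> conj_auto i j e \<otimes>\<^bsub>C3\<^esub> alpha 2 = conj_auto (swap2 i) (swap2 j) e"
proof -
  have "l = 1 \<or> l = 2 \<or> l = 3" if "l \<in> {1, 2, 3}" for l :: nat using that by simp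
  then show "alpha 1 \<otimes>\<^bsub>C3\<^esub> conj_auto i j e \<otimes>\<^bsub>C3\<^esub> alpha 1 = conj_auto (swap1 i) (swap1 j) e"
    "alpha 2 \<otimes>\<^bsub>C3\<^esub> conj_auto i j e \<otimes>\<^bsub>C3\<^esub> alpha 2 = conj_auto (swap2 i) (swap2 j) e"
    using alpha_gen by (intro alpha_conj_auto ij; fastforce)+
qed

text \<open>
  The six automorphisms \<open>c(i, j)\<close> form a single orbit under conjugation by the \<open>\<alpha>\<close>'s, and \<open>c(2, 1)\<close>
  is \<open>\<alpha>\<^sub>1 \<sigma>\<^sub>1\<close>.
\<close>
lemma conj_auto_generated:
  assumes "i \<in> {1, 2, 3}" "j \<in> {1, 2, 3}" "i \<noteq> j"
  shows "conj_auto i j e \<in> generate C3 C3_gens"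
proof -
  let ?U = "generate C3 C3_gens"
  have U: "subgroup ?U C3" by (rule C3.generate_is_subgroup[OF C3_gens_subset])
  have a: "alpha 1 \<in> ?U" "alpha 2 \<in> ?U" "sigma 1 \<in> ?U" by (auto intro: generate.incl)
  have "alpha 1 \<otimes>\<^bsub>C3\<^esub> sigma 1 = conj_auto 2 1 True"
    using alpha_involution[of 1] alpha_C3[of 1] conj_auto_C3[of 2 1 True]
    by (simp add: sigma_eq C3.m_assoc[symmetric])
  then have c21: "conj_auto 2 1 True \<in> ?U" using generate.eng[OF a(1,3)] by simp
  have s: "conj_auto (swap1 i) (swap1 j) True \<in> ?U" "conj_auto (swap2 i) (swap2 j) True \<in> ?U"
    if "conj_auto i j True \<in> ?U" "i \<in> {1, 2, 3}" "j \<in> {1, 2, 3}" "i \<noteq> j" for i j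
    using alpha_conj_auto_swap[OF that(2-4), of True] generate.eng[OF generate.eng[OF a(1) that(1)] a(1)]
      generate.eng[OF generate.eng[OF a(2) that(1)] a(2)] by simp_all
  have c12: "conj_auto 1 2 True \<in> ?U" and c31: "conj_auto 3 1 True \<in> ?U"
    using s[OF c21] by simp_all
  have c32: "conj_auto 3 2 True \<in> ?U" and c13: "conj_auto 1 3 True \<in> ?U"
    using s(1)[OF c31] s(2)[OF c12] by simp_all
  have c23: "conj_auto 2 3 True \<in> ?U" using s(1)[OF c13] by simp
  have "(i = 1 \<or> i = 2 \<or> i = 3) \<and> (j = 1 \<or> j = 2 \<or> j = 3)" using assms by simp
  then have T: "conj_auto i j True \<in> ?U"
    using c12 c13 c21 c23 c31 c32 assms(3) by (elim conjE disjE) simp_all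
  then have "conj_auto i j False \<in> ?U"
    using conj_auto_inverse[OF assms, of True] subgroup.m_inv_closed[OF U T] by simp
  with T show ?thesis by (cases e) simp_all
qed

text \<open>
  Induction on the total length of the conjugators. If some \<open>h\<^sub>i\<close> starts with \<open>h\<^sub>j x\<^sub>j\<^bsup>\<plusminus>1\<^esup>\<close>, multiplying by
  \<open>c(i, j)\<^bsup>\<plusminus>1\<^esup>\<close> deletes that letter. Otherwise \<open>image_starts_with_conjugator\<close> applies: each \<open>x\<^sub>l\<close> is
  itself an image, a word of length one, so the conjugator it starts with must be empty.
\<close>
lemma pure_C3_generated:
  assumes "g \<in> pure_C3"
  shows "g \<in> generate C3 C3_gens"
proof -
  let ?U = "generate C3 C3_gens"
  have U: "subgroup ?U C3" by (rule C3.generate_is_subgroup[OF C3_gens_subset])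
  have main: "g \<in> ?U" if "g \<in> carrier C3" "\<And>i. i \<in> {1, 2, 3} \<Longrightarrow> h i \<in> carrier F3"
    "\<And>i. i \<in> {1, 2, 3} \<Longrightarrow> g (gen i) = conj_by (h i) (gen i)" for g h
    using that
  proof (induction "\<Sum>i\<in>{1, 2, 3}. length (h i)" arbitrary: g h rule: less_induct)
    case less
    note gC = less.prems(1) and g_hom = C3_hom[OF less.prems(1)]
    have "\<forall>i\<in>{1, 2, 3}. \<exists>k. k \<in> carrier F3 \<and> length k \<le> length (h i) \<and> ends_off i k \<and> g (gen i) = conj_by k (gen i)"
    proof
      fix i :: nat assume i: "i \<in> {1, 2, 3}"
      show "\<exists>k. k \<in> carrier F3 \<and> length k \<le> length (h i) \<and> ends_off i k \<and> g (gen i) = conj_by k (gen i)"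
        using strip_conjugator[OF less.prems(2)[OF i] i] less.prems(3)[OF i] by auto
    qed
    then obtain k where "\<forall>i\<in>{1, 2, 3}. k i \<in> carrier F3 \<and> length (k i) \<le> length (h i) \<and> ends_off i (k i) \<and> g (gen i) = conj_by (k i) (gen i)"
      by (rule bchoice[THEN exE])
    then have k: "\<And>i. i \<in> {1, 2, 3} \<Longrightarrow> k i \<in> carrier F3"
      "\<And>i. i \<in> {1, 2, 3} \<Longrightarrow> length (k i) \<le> length (h i)" "\<And>i. i \<in> {1, 2, 3} \<Longrightarrow> ends_off i (k i)"
      "\<And>i. i \<in> {1, 2, 3} \<Longrightarrow> g (gen i) = conj_by (k i) (gen i)"
      by blast+
    show ?case
    proof (cases "\<exists>i j e. i \<in> {1, 2, 3} \<and> j \<in> {1, 2, 3} \<and> i \<noteq> j \<and> prefix (k j @ [(j, e)]) (k i)")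
      case True
      then obtain i j e r where ij: "i \<in> {1, 2, 3}" "j \<in> {1, 2, 3}" "i \<noteq> j" and r: "k i = k j @ [(j, e)] @ r"
        unfolding prefix_def by auto
      have mem: "k j \<in> carrier F3" "[(j, e)] \<in> carrier F3" "r \<in> carrier F3" 
        and ki: "k i = k j \<otimes>\<^bsub>F3\<^esub> ([(j, e)] \<otimes>\<^bsub>F3\<^esub> r)"
        using append_F3D[of "k j" "[(j, e)] @ r"] append_F3D[of "[(j, e)]" r] k(1)[OF ij(1)] by (simp_all add: r del: letter_F3)
      let ?c = "conj_auto i j (\<not> e)"
      note cC = conj_auto_C3[OF ij, of "\<not> e"]
      define h' where "h' = (\<lambda>l. if l = i then k j \<otimes>\<^bsub>F3\<^esub> r else k l)"
      have "?c \<otimes>\<^bsub>C3\<^esub> g \<in> ?U"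
      proof (rule less.hyps[of h'])
        have "length (h' i) < length (h i)"
          using length_mult_le[of "k j" r] k(2)[OF ij(1)] by (simp add: h'_def r)
        moreover have "length (h' l) \<le> length (h l)" if "l \<in> {1, 2, 3}" for l
          using calculation k(2)[OF that] by (simp add: h'_def)
        ultimately show "(\<Sum>i\<in>{1, 2, 3}. length (h' i)) < (\<Sum>i\<in>{1, 2, 3}. length (h i))"
          using ij(1) by (intro sum_strict_mono_ex1) auto
        show "?c \<otimes>\<^bsub>C3\<^esub> g \<in> carrier C3" using gC cC by simp
        fix l :: nat assume l: "l \<in> {1, 2, 3}"
        show "h' l \<in> carrier F3" using k(1)[OF l] mem by (simp add: h'_def)
        have "(?c \<otimes>\<^bsub>C3\<^esub> g) (gen l) = g (?c (gen l))"
          using gC cC l by (simp only: C3_mult_apply gen_F3)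
        also have "\<dots> = conj_by (h' l) (gen l)"
        proof (cases "l = i")
          case True
          have "g (?c (gen i)) = conj_by (conj_by (k j) [(j, \<not> e)]) (conj_by (k i) (gen i))"
            using ij by (simp only: conj_auto_gen simp_thms if_True hom_conj_by[OF g_hom] hom_letter[OF g_hom] letter_F3 gen_F3
                k(4) signed_conj_by[OF mem(1)])
          also have "\<dots> = conj_by (conj_by (k j) [(j, \<not> e)] \<otimes>\<^bsub>F3\<^esub> k i) (gen i)"
            using ij mem k(1)[OF ij(1)] by (simp only: conj_by_conj_by letter_F3 gen_F3 conj_by_closed)
          also have "[(j, \<not> e)] = inv\<^bsub>F3\<^esub> [(j, e)]"
            using ij(2) by (simp only: inv_letter_F3)
          also have "conj_by (k j) (inv\<^bsub>F3\<^esub> [(j, e)]) \<otimes>\<^bsub>F3\<^esub> k i = k j \<otimes>\<^bsub>F3\<^esub> r"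
            using mem unfolding ki conj_by_def by (simp only: F3.m_assoc F3.m_closed F3.inv_closed F3_cancel)
          finally show ?thesis using True by (simp add: h'_def)
        next
          case False
          then show ?thesis using ij l k(4)[OF l] by (simp only: conj_auto_gen simp_thms if_False h'_def)
        qed
        finally show "(?c \<otimes>\<^bsub>C3\<^esub> g) (gen l) = conj_by (h' l) (gen l)" .
      qed
      then have "inv\<^bsub>C3\<^esub> ?c \<otimes>\<^bsub>C3\<^esub> (?c \<otimes>\<^bsub>C3\<^esub> g) \<in> ?U"
        using subgroup.m_inv_closed[OF U conj_auto_generated[OF ij]] subgroup.m_closed[OF U] by blast
      then show ?thesis using gC cC by (simp add: C3.m_assoc[symmetric])
    next
      case False
      have "k l = []" if l: "l \<in> {1, 2, 3}" for l
      proof -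
        have "gen l \<in> g ` carrier F3"
          using auto_F3D(4)[OF C3_auto[OF gC]] l by (simp only: bij_betw_def gen_F3)
        then obtain w where w: "w \<in> carrier F3" "g w = gen l" by auto
        have "w \<noteq> []" using w hom_F3D(4)[OF g_hom w(1)] by (auto simp: one_F3 gen_def)
        then obtain i e v where v: "w = (i, e) # v" by (cases w) auto
        have "\<exists>z. k i @ (i, e) # z \<in> carrier F3 \<and> g ((i, e) # v) = k i @ (i, e) # z"
          by (rule image_starts_with_conjugator[OF g_hom k(1,3,4)]) (use False w v in blast)+
        then obtain z where "gen l = k i @ (i, e) # z" using w v by auto
        then show ?thesis by (cases "k i") (auto simp: gen_def)
      qed
      then have "g = \<one>\<^bsub>C3\<^esub>"
        using gC k(4) conj_by_one by (intro C3_eqI[OF gC C3.one_closed]) (simp_all only: C3_one restrict_apply' gen_F3 one_F3)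
      then show ?thesis by (simp add: generate.one)
    qed
  qed
  have "\<forall>i. \<exists>h. i \<in> {1, 2, 3} \<longrightarrow> h \<in> carrier F3 \<and> g (gen i) = conj_by h (gen i)"
    using assms unfolding pure_C3_def by blast
  then obtain h where "\<And>i. i \<in> {1, 2, 3} \<Longrightarrow> h i \<in> carrier F3 \<and> g (gen i) = conj_by (h i) (gen i)" by metis
  then show ?thesis using assms by (intro main[of g h]) (auto simp: pure_C3_def)
qed

lemma permutation_generated:
  assumes "\<pi> permutes {1, 2, 3 :: nat}"
  shows "\<exists>s\<in>generate C3 {alpha 1, alpha 2}. \<forall>i\<in>{1, 2, 3}. s (gen i) = gen (\<pi> i)"
proof -
  let ?U = "generate C3 {alpha 1, alpha 2}"
  have a: "alpha 1 \<in> ?U" "alpha 2 \<in> ?U" by (auto intro: generate.incl)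
  note aC = alpha_C3[of 1] alpha_C3[of 2]
  have ex: "\<exists>s\<in>?U. s (gen 1) = gen (\<pi> 1) \<and> s (gen 2) = gen (\<pi> 2) \<and> s (gen 3) = gen (\<pi> 3)"
    if "s \<in> ?U" "s (gen 1) = gen (\<pi> 1) \<and> s (gen 2) = gen (\<pi> 2) \<and> s (gen 3) = gen (\<pi> 3)" for s
    using that by blast
  have "\<pi> i = 1 \<or> \<pi> i = 2 \<or> \<pi> i = 3" if "i \<in> {1, 2, 3}" for i
    using permutes_in_image[OF assms, of i] that by simp
  from this[of 1] this[of 2] this[of 3]
  have "\<pi> 1 = 1 \<or> \<pi> 1 = 2 \<or> \<pi> 1 = 3" "\<pi> 2 = 1 \<or> \<pi> 2 = 2 \<or> \<pi> 2 = 3" "\<pi> 3 = 1 \<or> \<pi> 3 = 2 \<or> \<pi> 3 = 3"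
    by simp_all
  moreover have "\<pi> 1 \<noteq> \<pi> 2" "\<pi> 1 \<noteq> \<pi> 3" "\<pi> 2 \<noteq> \<pi> 3"
    using permutes_inj[OF assms] by (simp_all add: inj_eq)
  ultimately consider "\<pi> 1 = 1" "\<pi> 2 = 2" "\<pi> 3 = 3" | "\<pi> 1 = 2" "\<pi> 2 = 1" "\<pi> 3 = 3" | "\<pi> 1 = 1" "\<pi> 2 = 3" "\<pi> 3 = 2"
    | "\<pi> 1 = 3" "\<pi> 2 = 1" "\<pi> 3 = 2" | "\<pi> 1 = 2" "\<pi> 2 = 3" "\<pi> 3 = 1" | "\<pi> 1 = 3" "\<pi> 2 = 2" "\<pi> 3 = 1"
    by (elim disjE) simp_all
  then have "\<exists>s\<in>?U. s (gen 1) = gen (\<pi> 1) \<and> s (gen 2) = gen (\<pi> 2) \<and> s (gen 3) = gen (\<pi> 3)"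
  proof cases
    case 1
    then show ?thesis by (intro ex[OF generate.one]) (simp add: C3_one)
  next
    case 2
    then show ?thesis by (intro ex[OF a(1)]) (simp add: alpha_gen)
  next
    case 3
    then show ?thesis by (intro ex[OF a(2)]) (simp add: alpha_gen)
  next
    case 4
    then show ?thesis using aC by (intro ex[OF generate.eng[OF a]]) (simp add: alpha_gen C3_mult_apply)
  next
    case 5
    then show ?thesis using aC by (intro ex[OF generate.eng[OF a(2,1)]]) (simp add: alpha_gen C3_mult_apply)
  next
    case 6
    then show ?thesis using aC by (intro ex[OF generate.eng[OF generate.eng[OF a] a(1)]]) (simp add: alpha_gen C3_mult_apply)
  qed
  then show ?thesis by auto
qed

text \<open>
  Multiplying by a product of \<open>\<alpha>\<close>'s that undoes the permutation reduces the claim to pure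
  automorphisms.
\<close>
theorem C3_generated: "generate C3 C3_gens = carrier C3"
proof (intro equalityI generate_C3 subsetI)
  let ?U = "generate C3 C3_gens"
  have U: "subgroup ?U C3" by (rule C3.generate_is_subgroup[OF C3_gens_subset])
  fix g assume g: "g \<in> carrier C3"
  then obtain \<pi> h where h: "\<pi> permutes {1, 2, 3}" "\<And>i. i \<in> {1, 2, 3} \<Longrightarrow> h i \<in> carrier F3"
      "\<And>i. i \<in> {1, 2, 3} \<Longrightarrow> g (gen i) = conj_by (h i) (gen (\<pi> i))"
    using conjugatingE[of g] unfolding carrier_C3 by blast
  let ?\<rho> = "inv_into UNIV \<pi>"
  have \<rho>: "?\<rho> permutes {1, 2, 3}" "\<pi> (?\<rho> i) = i" for i
    using permutes_inv[OF h(1)] permutes_inverses[OF h(1)] by auto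
  obtain s where s: "s \<in> generate C3 {alpha 1, alpha 2}" "\<And>i. i \<in> {1, 2, 3} \<Longrightarrow> s (gen i) = gen (?\<rho> i)"
    using permutation_generated[OF \<rho>(1)] by blast
  have sU: "s \<in> ?U" using s(1) C3.mono_generate[of "{alpha 1, alpha 2}" C3_gens] by blast
  have sC: "s \<in> carrier C3" using sU generate_C3 by blast
  have "\<exists>h\<in>carrier F3. (s \<otimes>\<^bsub>C3\<^esub> g) (gen i) = conj_by h (gen i)" if i: "i \<in> {1, 2, 3}" for i
  proof -
    have "?\<rho> i \<in> {1, 2, 3}" using permutes_in_image[OF \<rho>(1), of i] i by blast
    then have "(s \<otimes>\<^bsub>C3\<^esub> g) (gen i) = conj_by (h (?\<rho> i)) (gen i)" "h (?\<rho> i) \<in> carrier F3"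
      using i s(2)[OF i] h(2,3) sC g by (simp_all only: C3_mult_apply gen_F3 \<rho>(2))
    then show ?thesis by blast
  qed
  then have "s \<otimes>\<^bsub>C3\<^esub> g \<in> pure_C3" using sC g unfolding pure_C3_def by blast
  then have "inv\<^bsub>C3\<^esub> s \<otimes>\<^bsub>C3\<^esub> (s \<otimes>\<^bsub>C3\<^esub> g) \<in> ?U"
    using pure_C3_generated subgroup.m_inv_closed[OF U sU] subgroup.m_closed[OF U] by blast
  then show "g \<in> ?U" using g sC by (simp add: C3.m_assoc[symmetric])
qed

section \<open>The linear maps and their relations\<close>

lemma module_V3: "module ((*s) :: laurent \<Rightarrow> V3 \<Rightarrow> V3)"
  by unfold_locales (simp_all add: vec_eq_iff algebra_simps)

lemma GL_V3_iff:
  "g \<in> carrier GL_V3 \<longleftrightarrow> (\<forall>u v. g (u + v) = g u + g v) \<and> (\<forall>r v. g (r *s v) = r *s g v) \<and> bij g"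
  using module_V3 by (auto simp: GL_V3_def module_hom_def module_hom_axioms_def)

lemma GL_V3_mult: "g \<otimes>\<^bsub>GL_V3\<^esub> h = h \<circ> g"
  by (simp add: GL_V3_def)

lemma GL_V3_one: "\<one>\<^bsub>GL_V3\<^esub> = id"
  by (simp add: GL_V3_def)

lemma group_GL_V3: "group GL_V3"
proof (rule groupI)
  fix g assume g: "g \<in> carrier GL_V3"
  then have b: "bij g" by (simp add: GL_V3_iff)
  then have i: "g (inv_into UNIV g v) = v" "inv_into UNIV g (g v) = v" for v
    by (simp_all add: bij_is_surj surj_f_inv_f bij_is_inj)
  have "inv_into UNIV g (u + v) = inv_into UNIV g u + inv_into UNIV g v" for u v
    using g i by (metis GL_V3_iff)
  moreover have "inv_into UNIV g (r *s v) = r *s inv_into UNIV g v" for r v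
    using g i by (metis GL_V3_iff)
  ultimately have "inv_into UNIV g \<in> carrier GL_V3"
    using b by (simp add: GL_V3_iff bij_imp_bij_inv)
  moreover have "inv_into UNIV g \<otimes>\<^bsub>GL_V3\<^esub> g = \<one>\<^bsub>GL_V3\<^esub>"
    using i by (simp add: GL_V3_mult GL_V3_one fun_eq_iff)
  ultimately show "\<exists>h\<in>carrier GL_V3. h \<otimes>\<^bsub>GL_V3\<^esub> g = \<one>\<^bsub>GL_V3\<^esub>" by blast
qed (auto simp: GL_V3_mult GL_V3_one GL_V3_iff bij_comp o_assoc)

interpretation GL: group GL_V3
  by (rule group_GL_V3)

lemma linear_ext_nth: "linear_ext a b c v $ i = v $ 1 * a $ i + v $ 2 * b $ i + v $ 3 * c $ i"
  by (simp add: linear_ext_def)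

lemma linear_ext_linear:
  "linear_ext a b c (u + v) = linear_ext a b c u + linear_ext a b c v"
  "linear_ext a b c (r *s v) = r *s linear_ext a b c v"
  by (simp_all add: vec_eq_iff linear_ext_nth algebra_simps)

lemma linear_ext_GL: "bij (linear_ext a b c) \<Longrightarrow> linear_ext a b c \<in> carrier GL_V3"
  by (simp add: GL_V3_iff linear_ext_linear)

lemma basis_nth:
  "v12 $ 1 = 1" "v12 $ 2 = 0" "v12 $ 3 = 0"
  "v13 $ 1 = 0" "v13 $ 2 = 1" "v13 $ 3 = 0"
  "v23 $ 1 = 0" "v23 $ 2 = 0" "v23 $ 3 = 1"
  by (simp_all add: v12_def v13_def v23_def axis_def)

lemma LK_sigma1_nth:
  "LK_sigma1 v $ 1 = v $ 1 * (t_var * q_var ^ 2) + v $ 2 * (t_var * q_var * (q_var - 1))"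
  "LK_sigma1 v $ 2 = v $ 2 * (1 - q_var) + v $ 3"
  "LK_sigma1 v $ 3 = v $ 2 * q_var"
  by (simp_all add: LK_sigma1_def linear_ext_nth basis_nth)

lemma LK_sigma2_nth:
  "LK_sigma2 v $ 1 = v $ 1 * (1 - q_var) + v $ 2"
  "LK_sigma2 v $ 2 = v $ 1 * q_var"
  "LK_sigma2 v $ 3 = v $ 1 * (q_var * (q_var - 1)) + v $ 3 * (t_var * q_var ^ 2)"
  by (simp_all add: LK_sigma2_def linear_ext_nth basis_nth)

lemma rho1_alpha1_nth:
  "rho1_alpha1 v $ 1 = v $ 1" "rho1_alpha1 v $ 2 = v $ 3 * x_inv" "rho1_alpha1 v $ 3 = v $ 2 * x_var"
  by (simp_all add: rho1_alpha1_def linear_ext_nth basis_nth)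

lemma rho1_alpha2_nth:
  "rho1_alpha2 v $ 1 = v $ 2 * x_inv" "rho1_alpha2 v $ 2 = v $ 1 * x_var" "rho1_alpha2 v $ 3 = v $ 3"
  by (simp_all add: rho1_alpha2_def linear_ext_nth basis_nth)

lemma laurent_monom_mult: "laurent_monom a b * laurent_monom c d = laurent_monom (a + c) (b + d)"
  by (simp add: laurent_monom_def mult_single)

lemma laurent_monom_one: "laurent_monom 0 0 = 1"
  by (simp add: laurent_monom_def single_one zero_prod_def[symmetric])

lemma x_inverse: "x_var * x_inv = 1" "x_inv * x_var = 1" "x_var * (x_inv * c) = c" "x_inv * (x_var * c) = c"
proof -
  show *: "x_var * x_inv = 1" "x_inv * x_var = 1"
    by (simp_all add: x_var_def x_inv_def laurent_monom_mult laurent_monom_one)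
  show "x_var * (x_inv * c) = c" "x_inv * (x_var * c) = c"
    by (simp_all only: mult.assoc[symmetric] * mult_1_left)
qed

lemma t_var_eq: "t_var = x_inv * x_inv * x_inv"
  by (simp add: t_var_def x_inv_def laurent_monom_mult)

text \<open>
  The \<open>n\<close>-th power of \<open>(t\<^bsup>1/3\<^esup> q)\<^sup>2\<close>, the scalar by which conjugation by a generator acts.
\<close>
definition scalar :: "int \<Rightarrow> V3 \<Rightarrow> V3" where
  "scalar n v = laurent_monom (2 * n) (2 * n) *s v"

lemma scalar_scalar: "scalar m (scalar n v) = scalar (m + n) v"
  by (simp add: scalar_def vector_smult_assoc laurent_monom_mult distrib_left)

lemma scalar_zero: "scalar 0 = id"
  by (simp add: scalar_def laurent_monom_one fun_eq_iff vec_eq_iff)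

lemma scalar_one_nth: "scalar 1 v $ i = x_inv * x_inv * q_var * q_var * v $ i"
  by (simp add: scalar_def x_inv_def q_var_def laurent_monom_mult)

lemma scalar_GL: "scalar n \<in> carrier GL_V3"
proof -
  have "bij (scalar n)"
    by (rule o_bij[of "scalar (- n)"]) (simp_all add: fun_eq_iff scalar_scalar scalar_zero)
  then show ?thesis
    by (simp add: GL_V3_iff) (simp add: scalar_def vec_eq_iff algebra_simps)
qed

lemma scalar_commute: "g \<in> carrier GL_V3 \<Longrightarrow> g (scalar n v) = scalar n (g v)"
  by (simp add: GL_V3_iff scalar_def)

lemma alpha_linear_relations:
  "rho1_alpha1 (rho1_alpha1 v) = v" "rho1_alpha2 (rho1_alpha2 v) = v"
  "rho1_alpha1 (rho1_alpha2 (rho1_alpha1 v)) = rho1_alpha2 (rho1_alpha1 (rho1_alpha2 v))"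
  by (simp_all add: vec_eq_iff forall_3 rho1_alpha1_nth rho1_alpha2_nth algebra_simps x_inverse)

text \<open>
  The first relation is the matrix version of \<open>c(1, 2) c(3, 2)\<close> being inner. Together with the cyclically
  permuted product it exhibits a left and a right inverse of \<open>LK_sigma1\<close> up to a scalar, from which
  the invertibility of both braid matrices follows.
\<close>
lemma sigma_linear_relations:
  "LK_sigma2 (rho1_alpha2 (rho1_alpha1 (LK_sigma1 v))) = scalar 1 v"
  "LK_sigma1 (LK_sigma2 (rho1_alpha2 (rho1_alpha1 v))) = scalar 1 v"
  by (simp_all add: vec_eq_iff forall_3 rho1_alpha1_nth rho1_alpha2_nth LK_sigma1_nth LK_sigma2_nth
      scalar_one_nth power2_eq_square t_var_eq algebra_simps x_inverse)

lemma assigned_GL: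
  "rho1_alpha1 \<in> carrier GL_V3" "rho1_alpha2 \<in> carrier GL_V3"
  "LK_sigma1 \<in> carrier GL_V3" "LK_sigma2 \<in> carrier GL_V3"
proof -
  have b: "bij rho1_alpha1" "bij rho1_alpha2"
    by (rule o_bij[of rho1_alpha1] o_bij[of rho1_alpha2]; simp add: fun_eq_iff alpha_linear_relations)+
  have s: "bij (scalar 1)" using scalar_GL by (simp add: GL_V3_iff)
  have "LK_sigma2 \<circ> rho1_alpha2 \<circ> rho1_alpha1 \<circ> LK_sigma1 = scalar 1"
    "LK_sigma1 \<circ> LK_sigma2 \<circ> rho1_alpha2 \<circ> rho1_alpha1 = scalar 1"
    by (simp_all add: fun_eq_iff sigma_linear_relations)
  then have "inj LK_sigma1" "surj LK_sigma1"
    using s by (metis bij_is_inj inj_on_imageI2 inj_compose comp_assoc)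
      (metis \<open>LK_sigma1 \<circ> LK_sigma2 \<circ> rho1_alpha2 \<circ> rho1_alpha1 = scalar 1\<close> s bij_is_surj comp_assoc surj_compose comp_surj surj_def comp_apply)
  then have s1: "bij LK_sigma1" by (simp add: bij_def)
  have "LK_sigma2 w = scalar 1 (inv_into UNIV LK_sigma1 (rho1_alpha1 (rho1_alpha2 w)))" for w
  proof -
    have "LK_sigma2 (rho1_alpha2 (rho1_alpha1 (LK_sigma1 (inv_into UNIV LK_sigma1 (rho1_alpha1 (rho1_alpha2 w))))))
        = LK_sigma2 w"
      using s1 by (simp add: bij_is_surj surj_f_inv_f alpha_linear_relations)
    then show ?thesis by (simp add: sigma_linear_relations)
  qed
  then have "LK_sigma2 = scalar 1 \<circ> inv_into UNIV LK_sigma1 \<circ> rho1_alpha1 \<circ> rho1_alpha2"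
    by (simp add: fun_eq_iff)
  then have s2: "bij LK_sigma2"
    using b s bij_imp_bij_inv[OF s1] by (metis bij_comp)
  show "rho1_alpha1 \<in> carrier GL_V3" "rho1_alpha2 \<in> carrier GL_V3"
    "LK_sigma1 \<in> carrier GL_V3" "LK_sigma2 \<in> carrier GL_V3"
    using b s1 s2 unfolding rho1_alpha1_def rho1_alpha2_def LK_sigma1_def LK_sigma2_def
    by (auto intro: linear_ext_GL)
qed

text \<open>
  The values forced on the twists by \<open>twist 1 = \<alpha>\<^sub>1 \<sigma>\<^sub>1\<close>, \<open>twist 2 = \<alpha>\<^sub>2 \<sigma>\<^sub>2\<close> and
  \<open>twist 3 = \<alpha>\<^sub>2 \<sigma>\<^sub>1 \<alpha>\<^sub>1 \<alpha>\<^sub>2\<close>.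
\<close>
definition twist_matrix :: "nat \<Rightarrow> V3 \<Rightarrow> V3" where
  "twist_matrix j = (if j = 1 then LK_sigma1 \<circ> rho1_alpha1 else if j = 2 then LK_sigma2 \<circ> rho1_alpha2
     else rho1_alpha2 \<circ> rho1_alpha1 \<circ> LK_sigma1 \<circ> rho1_alpha2)"

lemma twist_matrix_apply:
  "twist_matrix 1 v = LK_sigma1 (rho1_alpha1 v)" "twist_matrix 2 v = LK_sigma2 (rho1_alpha2 v)"
  "twist_matrix 3 v = rho1_alpha2 (rho1_alpha1 (LK_sigma1 (rho1_alpha2 v)))"
  by (simp_all add: twist_matrix_def)

text \<open>
  In each line \<open>\<alpha>\<^sub>i (twist j) \<alpha>\<^sub>i\<close> is the partner of \<open>twist k\<close>, for the index \<open>k\<close> of the outermost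
  matrix, so the composite is the value of an inner automorphism. Up to the relations between the
  \<open>\<alpha>\<close>'s, these six identities are the compatibility of the matrices with the relations of \<open>C\<^sub>3\<close>.
\<close>
lemma twist_linear_relations:
  "twist_matrix 2 (rho1_alpha1 (twist_matrix 1 (rho1_alpha1 v))) = scalar 1 v"
  "twist_matrix 1 (rho1_alpha1 (twist_matrix 2 (rho1_alpha1 v))) = scalar 1 v"
  "twist_matrix 3 (rho1_alpha1 (twist_matrix 3 (rho1_alpha1 v))) = scalar 1 v"
  "twist_matrix 1 (rho1_alpha2 (twist_matrix 1 (rho1_alpha2 v))) = scalar 1 v"
  "twist_matrix 3 (rho1_alpha2 (twist_matrix 2 (rho1_alpha2 v))) = scalar 1 v"
  "twist_matrix 2 (rho1_alpha2 (twist_matrix 3 (rho1_alpha2 v))) = scalar 1 v"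
  by (simp_all add: twist_matrix_apply vec_eq_iff forall_3 rho1_alpha1_nth rho1_alpha2_nth LK_sigma1_nth LK_sigma2_nth
      scalar_one_nth power2_eq_square t_var_eq algebra_simps x_inverse)

lemma twist_matrix_GL: "twist_matrix j \<in> carrier GL_V3"
  using assigned_GL GL.m_closed unfolding twist_matrix_def by (auto simp flip: GL_V3_mult)

section \<open>Homomorphisms from their graphs\<close>

lemma (in group) subgroup_set_mult_normalized:
  assumes Q: "subgroup Q G" and S: "subgroup S G"
    and norm: "\<And>s q. s \<in> S \<Longrightarrow> q \<in> Q \<Longrightarrow> s \<otimes> q \<otimes> inv s \<in> Q"
  shows "subgroup (Q <#> S) G"
proof (rule subgroupI)
  note sub = subgroup.mem_carrier[OF Q] subgroup.mem_carrier[OF S]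
  show "Q <#> S \<subseteq> carrier G" using sub by (auto simp: set_mult_def)
  show "Q <#> S \<noteq> {}" using subgroup.one_closed[OF Q] subgroup.one_closed[OF S] by (auto simp: set_mult_def)
  fix a assume "a \<in> Q <#> S"
  then obtain q s where a: "a = q \<otimes> s" "q \<in> Q" "s \<in> S" by (auto simp: set_mult_def)
  have "inv a = (inv s \<otimes> inv q \<otimes> inv (inv s)) \<otimes> inv s"
    using a sub by (simp add: inv_mult_group m_assoc)
  moreover have "inv s \<otimes> inv q \<otimes> inv (inv s) \<in> Q"
    using a norm subgroup.m_inv_closed[OF Q] subgroup.m_inv_closed[OF S] by blast
  ultimately show "inv a \<in> Q <#> S"
    using a subgroup.m_inv_closed[OF S] by (auto simp: set_mult_def)
  fix b assume "b \<in> Q <#> S"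
  then obtain q' s' where b: "b = q' \<otimes> s'" "q' \<in> Q" "s' \<in> S" by (auto simp: set_mult_def)
  have "a \<otimes> b = (q \<otimes> (s \<otimes> q' \<otimes> inv s)) \<otimes> (s \<otimes> s')"
    using a b sub by (simp add: m_assoc inv_solve_left)
  moreover have "q \<otimes> (s \<otimes> q' \<otimes> inv s) \<in> Q" "s \<otimes> s' \<in> S"
    using a b norm subgroup.m_closed[OF Q] subgroup.m_closed[OF S] by blast+
  ultimately show "a \<otimes> b \<in> Q <#> S" by (auto simp: set_mult_def)
qed

lemma hom_eq_on_generate:
  assumes "group G" "group H" "\<phi> \<in> hom G H" "\<psi> \<in> hom G H" "X \<subseteq> carrier G"
    "\<And>x. x \<in> X \<Longrightarrow> \<phi> x = \<psi> x" "g \<in> generate G X"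
  shows "\<phi> g = \<psi> g"
proof -
  interpret \<phi>: group_hom G H \<phi> by (simp add: group_hom_def group_hom_axioms_def assms)
  interpret \<psi>: group_hom G H \<psi> by (simp add: group_hom_def group_hom_axioms_def assms)
  show ?thesis
    using assms(7)
  proof (induction g rule: generate.induct)
    case (inv h)
    then show ?case using assms(5,6) by (metis \<phi>.hom_inv \<psi>.hom_inv subsetD)
  next
    case (eng h k)
    then show ?case using \<phi>.G.generate_in_carrier[OF assms(5)] by simp
  qed (use assms in auto)
qed

text \<open>
  A prescription on generators extends to a homomorphism if and only if the subgroup generated by
  its graph is the graph of a function, that is, if it contains no pair \<open>(\<one>, y)\<close> other than the
  trivial one. This replaces a presentation of \<open>G\<close> by a description of that subgroup.
\<close>
lemma hom_from_graph:
  assumes G: "group G" and H: "group H" and P: "P \<subseteq> carrier (G \<times>\<times> H)"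
    and gen: "carrier G \<subseteq> generate G (fst ` P)"
    and kernel: "\<And>y. (\<one>\<^bsub>G\<^esub>, y) \<in> generate (G \<times>\<times> H) P \<Longrightarrow> y = \<one>\<^bsub>H\<^esub>"
  shows "\<exists>\<rho>. group_hom G H \<rho> \<and> (\<forall>(x, y)\<in>P. \<rho> x = y)"
proof -
  interpret G: group G by fact
  interpret H: group H by fact
  let ?E = "G \<times>\<times> H" and ?K = "generate (G \<times>\<times> H) P"
  interpret E: group ?E by (rule DirProd_group[OF G H])
  have K: "subgroup ?K ?E" by (rule E.generate_is_subgroup[OF P])
  have KC: "x \<in> carrier G \<and> y \<in> carrier H" if "(x, y) \<in> ?K" for x y
    using E.generate_in_carrier[OF P that] by simp
  have ex: "\<exists>y. (x, y) \<in> ?K" if "x \<in> generate G (fst ` P)" for x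
    using that
  proof (induction x rule: generate.induct)
    case one
    then show ?case using generate.one[of ?E P] by auto
  next
    case (incl h)
    then show ?case by (force intro: generate.incl)
  next
    case (inv h)
    then obtain y where y: "(h, y) \<in> P" by force
    then have "inv\<^bsub>?E\<^esub> (h, y) = (inv\<^bsub>G\<^esub> h, inv\<^bsub>H\<^esub> y)"
      using P by (intro inv_DirProd G H) auto
    with generate.inv[OF y, of ?E] show ?case by auto
  next
    case (eng h k)
    then show ?case using generate.eng[of _ ?E P] by (metis mult_DirProd)
  qed
  have unique: "y = z" if "(x, y) \<in> ?K" "(x, z) \<in> ?K" for x y z
  proof -
    have "inv\<^bsub>?E\<^esub> (x, y) \<otimes>\<^bsub>?E\<^esub> (x, z) \<in> ?K"
      using subgroup.m_closed[OF K subgroup.m_inv_closed[OF K that(1)] that(2)] .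
    moreover have "inv\<^bsub>?E\<^esub> (x, y) = (inv\<^bsub>G\<^esub> x, inv\<^bsub>H\<^esub> y)"
      using KC[OF that(1)] by (intro inv_DirProd G H) auto
    ultimately have "(\<one>\<^bsub>G\<^esub>, inv\<^bsub>H\<^esub> y \<otimes>\<^bsub>H\<^esub> z) \<in> ?K" using KC[OF that(1)] by simp
    then have "inv\<^bsub>H\<^esub> y \<otimes>\<^bsub>H\<^esub> z = \<one>\<^bsub>H\<^esub>" by (rule kernel)
    then show ?thesis using KC[OF that(1)] KC[OF that(2)] H.inv_equality H.inv_inv by (metis H.inv_closed)
  qed
  define \<rho> where "\<rho> x = (THE y. (x, y) \<in> ?K)" for x
  have \<rho>: "\<rho> x = y" if "(x, y) \<in> ?K" for x y
    unfolding \<rho>_def using that unique by blast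
  have \<rho>_mem: "(x, \<rho> x) \<in> ?K" if "x \<in> carrier G" for x
    using ex gen that \<rho> by (metis subsetD)
  have "\<rho> \<in> hom G H"
  proof (rule homI)
    fix x y assume xy: "x \<in> carrier G" "y \<in> carrier G"
    show "\<rho> x \<in> carrier H" using KC \<rho>_mem[OF xy(1)] by blast
    have "(x \<otimes>\<^bsub>G\<^esub> y, \<rho> x \<otimes>\<^bsub>H\<^esub> \<rho> y) \<in> ?K"
      using generate.eng[OF \<rho>_mem[OF xy(1)] \<rho>_mem[OF xy(2)]] by simp
    then show "\<rho> (x \<otimes>\<^bsub>G\<^esub> y) = \<rho> x \<otimes>\<^bsub>H\<^esub> \<rho> y" by (rule \<rho>)
  qed
  moreover have "\<rho> x = y" if "(x, y) \<in> P" for x y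
    by (rule \<rho>) (rule generate.incl[OF that])
  ultimately show ?thesis
    by (intro exI[of _ \<rho>]) (auto simp: group_hom_def group_hom_axioms_def G H)
qed

section \<open>The graph of the representation\<close>

text \<open>
  The graph of the representation lives in this product. The suffix \<open>_pair\<close> marks an automorphism
  together with its intended value.
\<close>
abbreviation E :: "((nat gword \<Rightarrow> nat gword) \<times> (V3 \<Rightarrow> V3)) monoid" where
  "E \<equiv> C3 \<times>\<times> GL_V3"

interpretation E: group E
  by (rule DirProd_group[OF group_C3 group_GL_V3])

definition alpha1_pair where "alpha1_pair = (alpha 1, rho1_alpha1)"
definition alpha2_pair where "alpha2_pair = (alpha 2, rho1_alpha2)"
definition sigma1_pair where "sigma1_pair = (sigma 1, LK_sigma1)"
definition sigma2_pair where "sigma2_pair = (sigma 2, LK_sigma2)"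
definition twist_pair where "twist_pair j = (twist j, twist_matrix j)"

lemma E_mem [simp]: "alpha1_pair \<in> carrier E" "alpha2_pair \<in> carrier E" "sigma1_pair \<in> carrier E" "sigma2_pair \<in> carrier E"
  "j \<in> {1, 2, 3} \<Longrightarrow> twist_pair j \<in> carrier E"
  using alpha_C3 sigma_C3 assigned_GL twist_C3 twist_matrix_GL
  by (simp_all add: alpha1_pair_def alpha2_pair_def sigma1_pair_def sigma2_pair_def twist_pair_def)

lemma A_involution: "alpha1_pair \<otimes>\<^bsub>E\<^esub> alpha1_pair = \<one>\<^bsub>E\<^esub>" "alpha2_pair \<otimes>\<^bsub>E\<^esub> alpha2_pair = \<one>\<^bsub>E\<^esub>"
  using alpha_involution[of 1] alpha_involution[of 2]
  by (simp_all add: alpha1_pair_def alpha2_pair_def GL_V3_mult GL_V3_one fun_eq_iff alpha_linear_relations)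

lemma alpha_braid:
  "alpha 1 \<otimes>\<^bsub>C3\<^esub> alpha 2 \<otimes>\<^bsub>C3\<^esub> alpha 1 = alpha 2 \<otimes>\<^bsub>C3\<^esub> alpha 1 \<otimes>\<^bsub>C3\<^esub> alpha 2"
proof (rule C3_eqI)
  fix i :: nat assume "i \<in> {1, 2, 3}"
  then have "i = 1 \<or> i = 2 \<or> i = 3" by simp
  then show "(alpha 1 \<otimes>\<^bsub>C3\<^esub> alpha 2 \<otimes>\<^bsub>C3\<^esub> alpha 1) (gen i) = (alpha 2 \<otimes>\<^bsub>C3\<^esub> alpha 1 \<otimes>\<^bsub>C3\<^esub> alpha 2) (gen i)"
    using alpha_C3[of 1] alpha_C3[of 2] by (elim disjE) (simp_all add: C3_mult_apply alpha_gen)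
qed (use alpha_C3[of 1] alpha_C3[of 2] in simp_all)

lemma A_braid: "alpha1_pair \<otimes>\<^bsub>E\<^esub> alpha2_pair \<otimes>\<^bsub>E\<^esub> alpha1_pair = alpha2_pair \<otimes>\<^bsub>E\<^esub> alpha1_pair \<otimes>\<^bsub>E\<^esub> alpha2_pair"
  by (simp add: alpha1_pair_def alpha2_pair_def GL_V3_mult fun_eq_iff alpha_linear_relations alpha_braid)

lemma inv_A: "inv\<^bsub>E\<^esub> alpha1_pair = alpha1_pair" "inv\<^bsub>E\<^esub> alpha2_pair = alpha2_pair"
  by (rule E.inv_equality[OF A_involution(1) E_mem(1) E_mem(1)],
      rule E.inv_equality[OF A_involution(2) E_mem(2) E_mem(2)])

text \<open>
  The sign reflects that \<open>inner_auto h\<close> is conjugation by the inverse of \<open>h\<close>.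
\<close>
definition inner_pair :: "nat gword \<Rightarrow> (nat gword \<Rightarrow> nat gword) \<times> (V3 \<Rightarrow> V3)" where
  "inner_pair h = (inner_auto h, scalar (- weight (\<lambda>_. 1) h))"

lemma inner_auto_mult:
  assumes "h \<in> carrier F3" "k \<in> carrier F3"
  shows "inner_auto h \<otimes>\<^bsub>C3\<^esub> inner_auto k = inner_auto (h \<otimes>\<^bsub>F3\<^esub> k)"
proof (rule C3_eqI)
  fix i :: nat assume i: "i \<in> {1, 2, 3}"
  have g: "gen i \<in> carrier F3" using i by (simp only: gen_F3)
  show "(inner_auto h \<otimes>\<^bsub>C3\<^esub> inner_auto k) (gen i) = inner_auto (h \<otimes>\<^bsub>F3\<^esub> k) (gen i)"
    using assms g inner_auto_C3 by (simp add: C3_mult_apply inner_auto_apply conj_by_conj_by F3.inv_mult_group)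
qed (use assms inner_auto_C3 in simp_all)

lemma inner_pair_hom: "inner_pair \<in> hom F3 E"
  using inner_auto_C3 scalar_GL
  by (intro homI) (simp_all add: inner_pair_def inner_auto_mult weight_mult GL_V3_mult fun_eq_iff scalar_scalar algebra_simps)

text \<open>
  Generators are sent to conjugates of generators, so total exponent sums are preserved. This makes
  the scalar attached to an inner automorphism invariant under conjugation in \<open>C\<^sub>3\<close>.
\<close>
lemma weight_C3:
  assumes g: "g \<in> carrier C3" and h: "h \<in> carrier F3"
  shows "weight (\<lambda>_. 1) (g h) = weight (\<lambda>_. 1) h"
proof -
  obtain \<pi> k where k: "\<pi> permutes {1, 2, 3}" "\<And>i. i \<in> {1, 2, 3} \<Longrightarrow> k i \<in> carrier F3"
      "\<And>i. i \<in> {1, 2, 3} \<Longrightarrow> g (gen i) = conj_by (k i) (gen (\<pi> i))"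
    using g conjugatingE[of g] unfolding carrier_C3 by blast
  have "(\<lambda>w. weight (\<lambda>_. 1) (g w)) \<in> hom F3 integer_group"
    using C3_closed[OF g] hom_F3D(2)[OF C3_hom[OF g]] by (intro homI) (simp_all add: weight_mult)
  moreover have "weight (\<lambda>_. 1) (g (gen i)) = weight (\<lambda>_. 1) (gen i)" if i: "i \<in> {1, 2, 3}" for i
  proof -
    have "\<pi> i \<in> {1, 2, 3}" using permutes_in_image[OF k(1), of i] i by blast
    then show ?thesis using k(2,3)[OF i] i by (simp only: weight_conj_by gen_F3 weight_gen)
  qed
  ultimately show ?thesis
    using free_group_hom_eqI[of integer_group "\<lambda>w. weight (\<lambda>_. 1) (g w)" "{1, 2, 3}" "weight (\<lambda>_. 1)" h]
      weight_hom h unfolding F3_def by simp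
qed

text \<open>
  Scalars are central in \<open>GL(V\<^sub>3)\<close>, and conjugating an inner automorphism by \<open>g\<close> replaces \<open>h\<close> by its
  image under \<open>g\<close>. So the inner pairs are normalised by the whole product group.
\<close>
lemma inner_pair_commute:
  assumes h: "h \<in> carrier F3" and x: "x \<in> carrier E"
  shows "inner_pair h \<otimes>\<^bsub>E\<^esub> x = x \<otimes>\<^bsub>E\<^esub> inner_pair (fst x h)"
proof -
  obtain g M where xgM: "x = (g, M)" by (cases x)
  have g: "g \<in> carrier C3" and M: "M \<in> carrier GL_V3" using x by (simp_all add: xgM)
  have "inner_auto h \<otimes>\<^bsub>C3\<^esub> g = g \<otimes>\<^bsub>C3\<^esub> inner_auto (g h)"
  proof (rule C3_eqI)
    fix i :: nat assume i: "i \<in> {1, 2, 3}"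
    have gi: "gen i \<in> carrier F3" using i by (simp only: gen_F3)
    show "(inner_auto h \<otimes>\<^bsub>C3\<^esub> g) (gen i) = (g \<otimes>\<^bsub>C3\<^esub> inner_auto (g h)) (gen i)"
      using h g gi inner_auto_C3 C3_closed[OF g] hom_conj_by[OF C3_hom[OF g]] hom_F3D(3)[OF C3_hom[OF g]]
      by (simp add: C3_mult_apply inner_auto_apply)
  qed (use g h inner_auto_C3 C3_closed[OF g] in simp_all)
  moreover have "scalar n \<otimes>\<^bsub>GL_V3\<^esub> M = M \<otimes>\<^bsub>GL_V3\<^esub> scalar n" for n
    using scalar_commute[OF M] by (simp add: GL_V3_mult fun_eq_iff)
  ultimately show ?thesis
    using weight_C3[OF g h] by (simp add: xgM inner_pair_def)
qed

lemma group_hom_inner_pair: "group_hom F3 E inner_pair"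
  by (simp add: group_hom_def group_hom_axioms_def group_F3 E.is_group inner_pair_hom)

definition word_pair :: "nat gword \<Rightarrow> (nat gword \<Rightarrow> nat gword) \<times> (V3 \<Rightarrow> V3)" where
  "word_pair = free_group_lift {1, 2, 3} E twist_pair"

lemma word_pair_hom: "word_pair \<in> hom F3 E"
  unfolding word_pair_def F3_def by (intro free_group_lift_hom E.is_group E_mem(5))

lemma group_hom_word_pair: "group_hom F3 E word_pair"
  by (simp add: group_hom_def group_hom_axioms_def group_F3 E.is_group word_pair_hom)

lemma word_pair_gen: "j \<in> {1, 2, 3} \<Longrightarrow> word_pair (gen j) = twist_pair j"
  unfolding word_pair_def by (intro free_group_lift_gen E.is_group E_mem(5))

lemma fst_word_pair:
  assumes "v \<in> carrier F3" shows "fst (word_pair v) = word_auto v"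
proof -
  have "(\<lambda>w. fst (word_pair w)) \<in> hom F3 C3"
  proof (rule homI)
    have fst_mult: "fst (a \<otimes>\<^bsub>E\<^esub> b) = fst a \<otimes>\<^bsub>C3\<^esub> fst b" for a b
      by (cases a; cases b) simp
    fix v w assume vw: "v \<in> carrier F3" "w \<in> carrier F3"
    show "fst (word_pair v) \<in> carrier C3"
      using hom_in_carrier[OF word_pair_hom vw(1)] by auto
    show "fst (word_pair (v \<otimes>\<^bsub>F3\<^esub> w)) = fst (word_pair v) \<otimes>\<^bsub>C3\<^esub> fst (word_pair w)"
      by (simp only: hom_mult[OF word_pair_hom vw] fst_mult)
  qed
  moreover have "fst (word_pair (gen i)) = word_auto (gen i)" if "i \<in> {1, 2, 3}" for i
    using free_group_lift_gen[OF group_C3 that, of twist] twist_C3[OF that]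
    by (simp only: word_pair_gen[OF that] twist_pair_def fst_conv word_auto_def)
  ultimately show ?thesis
    using free_group_hom_eqI[OF group_C3, of "\<lambda>w. fst (word_pair w)" "{1, 2, 3}" word_auto v] word_auto_hom assms
    unfolding F3_def by blast
qed

text \<open>
  The product conjugates the two generators other than \<open>x\<^sub>j\<close> by \<open>x\<^sub>j\<close>, and \<open>x\<^sub>j\<close> commutes with itself.
\<close>
lemma conj_auto_pair:
  assumes "{i, j, k} = {1, 2, 3}" "i \<noteq> j" "j \<noteq> k" "i \<noteq> k"
  shows "conj_auto i j True \<otimes>\<^bsub>C3\<^esub> conj_auto k j True = inner_auto (inv\<^bsub>F3\<^esub> (gen j))"
proof (rule C3_eqI)
  have mem: "i \<in> {1, 2, 3}" "j \<in> {1, 2, 3}" "k \<in> {1, 2, 3}" using assms(1) by blast+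
  note c = conj_auto_C3[OF mem(1,2) assms(2), of True] conj_auto_C3[OF mem(3,2) not_sym[OF assms(3)], of True]
  have gj: "gen j \<in> carrier F3" "inv\<^bsub>F3\<^esub> (gen j) \<in> carrier F3" "[(j, True)] = gen j"
  proof -
    show "gen j \<in> carrier F3" using mem(2) by (simp only: gen_F3)
    then show "inv\<^bsub>F3\<^esub> (gen j) \<in> carrier F3" by (rule F3.inv_closed)
    show "[(j, True)] = gen j" by (simp add: gen_def)
  qed
  show "conj_auto i j True \<otimes>\<^bsub>C3\<^esub> conj_auto k j True \<in> carrier C3" "inner_auto (inv\<^bsub>F3\<^esub> (gen j)) \<in> carrier C3"
    using c gj inner_auto_C3 by simp_all
  fix l :: nat assume l: "l \<in> {1, 2, 3}"
  then have gl: "gen l \<in> carrier F3" by (simp only: gen_F3)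
  have rhs: "inner_auto (inv\<^bsub>F3\<^esub> (gen j)) (gen l) = conj_by (gen j) (gen l)"
    using gl gj by (simp add: inner_auto_apply)
  have lhs: "(conj_auto i j True \<otimes>\<^bsub>C3\<^esub> conj_auto k j True) (gen l) = conj_auto k j True (conj_auto i j True (gen l))"
    using gl c by (simp only: C3_mult_apply)
  consider "l = i" | "l = j" | "l = k" using l assms(1) by blast
  then have "conj_auto k j True (conj_auto i j True (gen l)) = conj_by (gen j) (gen l)"
  proof cases
    case 1
    then show ?thesis using assms mem gl gj
      by (simp only: conj_auto_gen simp_thms if_True if_False hom_conj_by[OF conj_auto_hom])
  next
    case 2
    have "conj_by [(j, True)] (gen j) = gen j" by (rule letter_commutes[OF mem(2)])
    with 2 show ?thesis using assms(2,3) not_sym[OF assms(2)] mem gj by (simp only: conj_auto_gen simp_thms if_False)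
  next
    case 3
    then show ?thesis using assms(4) not_sym[OF assms(4)] mem gj by (simp only: conj_auto_gen simp_thms if_True if_False)
  qed
  with lhs rhs show "(conj_auto i j True \<otimes>\<^bsub>C3\<^esub> conj_auto k j True) (gen l) = inner_auto (inv\<^bsub>F3\<^esub> (gen j)) (gen l)"
    by simp
qed

lemma outer_relationI:
  assumes "a \<otimes>\<^bsub>C3\<^esub> twist i \<otimes>\<^bsub>C3\<^esub> a \<otimes>\<^bsub>C3\<^esub> twist k = inner_auto (inv\<^bsub>F3\<^esub> (gen l))"
    and "\<And>v. twist_matrix k (m (twist_matrix i (m v))) = scalar 1 v" and l: "l \<in> {1, 2, 3}"
  shows "(a, m) \<otimes>\<^bsub>E\<^esub> twist_pair i \<otimes>\<^bsub>E\<^esub> (a, m) \<otimes>\<^bsub>E\<^esub> twist_pair k = inner_pair (inv\<^bsub>F3\<^esub> (gen l))"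
proof -
  have "gen l \<in> carrier F3" using l by (simp only: gen_F3)
  then have "- weight (\<lambda>_. 1) (inv\<^bsub>F3\<^esub> (gen l)) = 1"
    using weight_inv[of "gen l" "\<lambda>_. 1"] weight_gen[OF l, of "\<lambda>_. 1"] by simp
  then show ?thesis
    using assms(1,2) by (simp add: twist_pair_def inner_pair_def GL_V3_mult fun_eq_iff[of "_ \<circ> _"])
qed

lemma alpha_twist:
  "alpha 1 \<otimes>\<^bsub>C3\<^esub> twist 1 \<otimes>\<^bsub>C3\<^esub> alpha 1 = conj_auto 1 2 True"
  "alpha 1 \<otimes>\<^bsub>C3\<^esub> twist 2 \<otimes>\<^bsub>C3\<^esub> alpha 1 = conj_auto 3 1 True"
  "alpha 1 \<otimes>\<^bsub>C3\<^esub> twist 3 \<otimes>\<^bsub>C3\<^esub> alpha 1 = conj_auto 2 3 True"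
  "alpha 2 \<otimes>\<^bsub>C3\<^esub> twist 1 \<otimes>\<^bsub>C3\<^esub> alpha 2 = conj_auto 3 1 True"
  "alpha 2 \<otimes>\<^bsub>C3\<^esub> twist 2 \<otimes>\<^bsub>C3\<^esub> alpha 2 = conj_auto 2 3 True"
  "alpha 2 \<otimes>\<^bsub>C3\<^esub> twist 3 \<otimes>\<^bsub>C3\<^esub> alpha 2 = conj_auto 1 2 True"
  using alpha_conj_auto_swap[of 2 1 True] alpha_conj_auto_swap[of 3 2 True] alpha_conj_auto_swap[of 1 3 True]
  by (simp_all add: twist_def)

lemma twist_mult_twist:
  "conj_auto 1 2 True \<otimes>\<^bsub>C3\<^esub> twist 2 = inner_auto (inv\<^bsub>F3\<^esub> (gen 2))"
  "conj_auto 3 1 True \<otimes>\<^bsub>C3\<^esub> twist 1 = inner_auto (inv\<^bsub>F3\<^esub> (gen 1))"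
  "conj_auto 2 3 True \<otimes>\<^bsub>C3\<^esub> twist 3 = inner_auto (inv\<^bsub>F3\<^esub> (gen 3))"
proof -
  have sets: "{3, 1, 2 :: nat} = {1, 2, 3}" "{2, 3, 1 :: nat} = {1, 2, 3}" by auto
  show "conj_auto 1 2 True \<otimes>\<^bsub>C3\<^esub> twist 2 = inner_auto (inv\<^bsub>F3\<^esub> (gen 2))"
    using conj_auto_pair[of 1 2 3] by (simp add: twist_def)
  show "conj_auto 3 1 True \<otimes>\<^bsub>C3\<^esub> twist 1 = inner_auto (inv\<^bsub>F3\<^esub> (gen 1))"
    using conj_auto_pair[OF sets(1)] by (simp add: twist_def)
  show "conj_auto 2 3 True \<otimes>\<^bsub>C3\<^esub> twist 3 = inner_auto (inv\<^bsub>F3\<^esub> (gen 3))"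
    using conj_auto_pair[OF sets(2)] by (simp add: twist_def)
qed

text \<open>
  Conjugation by \<open>\<alpha>\<^sub>i\<close> inverts and permutes the twist pairs, up to inner pairs. It is consistent between
  automorphisms and matrices, so the group \<open>pure_pairs\<close> is normalised by the \<open>\<alpha>\<close>'s.
\<close>
lemma twist_pair_relations:
  "alpha1_pair \<otimes>\<^bsub>E\<^esub> twist_pair 1 \<otimes>\<^bsub>E\<^esub> alpha1_pair \<otimes>\<^bsub>E\<^esub> twist_pair 2 = inner_pair (inv\<^bsub>F3\<^esub> (gen 2))"
  "alpha1_pair \<otimes>\<^bsub>E\<^esub> twist_pair 2 \<otimes>\<^bsub>E\<^esub> alpha1_pair \<otimes>\<^bsub>E\<^esub> twist_pair 1 = inner_pair (inv\<^bsub>F3\<^esub> (gen 1))"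
  "alpha1_pair \<otimes>\<^bsub>E\<^esub> twist_pair 3 \<otimes>\<^bsub>E\<^esub> alpha1_pair \<otimes>\<^bsub>E\<^esub> twist_pair 3 = inner_pair (inv\<^bsub>F3\<^esub> (gen 3))"
  "alpha2_pair \<otimes>\<^bsub>E\<^esub> twist_pair 1 \<otimes>\<^bsub>E\<^esub> alpha2_pair \<otimes>\<^bsub>E\<^esub> twist_pair 1 = inner_pair (inv\<^bsub>F3\<^esub> (gen 1))"
  "alpha2_pair \<otimes>\<^bsub>E\<^esub> twist_pair 2 \<otimes>\<^bsub>E\<^esub> alpha2_pair \<otimes>\<^bsub>E\<^esub> twist_pair 3 = inner_pair (inv\<^bsub>F3\<^esub> (gen 3))"
  "alpha2_pair \<otimes>\<^bsub>E\<^esub> twist_pair 3 \<otimes>\<^bsub>E\<^esub> alpha2_pair \<otimes>\<^bsub>E\<^esub> twist_pair 2 = inner_pair (inv\<^bsub>F3\<^esub> (gen 2))"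
  unfolding alpha1_pair_def alpha2_pair_def
  by (rule outer_relationI, simp only: alpha_twist twist_mult_twist, simp only: twist_linear_relations, simp)+

definition inner_pairs where "inner_pairs = inner_pair ` carrier F3"
definition pure_pairs where "pure_pairs = inner_pairs <#>\<^bsub>E\<^esub> word_pair ` carrier F3"

lemma subgroup_inner_pairs: "subgroup inner_pairs E"
  unfolding inner_pairs_def by (rule group_hom.img_is_subgroup[OF group_hom_inner_pair])

lemma inner_pairs_normalized:
  assumes "n \<in> inner_pairs" "x \<in> carrier E"
  shows "x \<otimes>\<^bsub>E\<^esub> n \<otimes>\<^bsub>E\<^esub> inv\<^bsub>E\<^esub> x \<in> inner_pairs"
proof -
  obtain h where h: "n = inner_pair h" "h \<in> carrier F3" using assms(1) by (auto simp: inner_pairs_def)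
  have ix: "inv\<^bsub>E\<^esub> x \<in> carrier E" using assms(2) by (rule E.inv_closed)
  have fh: "fst (inv\<^bsub>E\<^esub> x) h \<in> carrier F3"
    using ix h(2) C3_closed by (cases "inv\<^bsub>E\<^esub> x") auto
  have nC: "inner_pair w \<in> carrier E" if "w \<in> carrier F3" for w using that inner_pair_hom by (auto simp: hom_def)
  have "x \<otimes>\<^bsub>E\<^esub> n \<otimes>\<^bsub>E\<^esub> inv\<^bsub>E\<^esub> x = x \<otimes>\<^bsub>E\<^esub> (inv\<^bsub>E\<^esub> x \<otimes>\<^bsub>E\<^esub> inner_pair (fst (inv\<^bsub>E\<^esub> x) h))"
    using E.m_assoc[OF assms(2) nC[OF h(2)] ix] inner_pair_commute[OF h(2) ix] by (simp only: h(1))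
  also have "\<dots> = inner_pair (fst (inv\<^bsub>E\<^esub> x) h)"
    using E.m_assoc[OF assms(2) ix nC[OF fh]] E.r_inv[OF assms(2)] E.l_one[OF nC[OF fh]] by (simp only:)
  finally show ?thesis using fh by (simp add: inner_pairs_def)
qed

lemma subgroup_pure_pairs: "subgroup pure_pairs E"
  unfolding pure_pairs_def
proof (rule E.subgroup_set_mult_normalized[OF subgroup_inner_pairs])
  show H: "subgroup (word_pair ` carrier F3) E" by (rule group_hom.img_is_subgroup[OF group_hom_word_pair])
  fix s q assume "s \<in> word_pair ` carrier F3" "q \<in> inner_pairs"
  then show "s \<otimes>\<^bsub>E\<^esub> q \<otimes>\<^bsub>E\<^esub> inv\<^bsub>E\<^esub> s \<in> inner_pairs"
    using inner_pairs_normalized subgroup.mem_carrier[OF H] by blast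
qed

lemma inner_pairs_subset_pure_pairs: "inner_pairs \<subseteq> pure_pairs"
proof
  fix n assume n: "n \<in> inner_pairs"
  have "word_pair [] = \<one>\<^bsub>E\<^esub>" unfolding word_pair_def by (rule free_group_lift_Nil)
  moreover have "[] \<in> carrier F3" by (simp add: carrier_F3)
  ultimately have "n \<otimes>\<^bsub>E\<^esub> \<one>\<^bsub>E\<^esub> \<in> pure_pairs" using n unfolding pure_pairs_def set_mult_def by force
  then show "n \<in> pure_pairs" using subgroup.mem_carrier[OF subgroup_inner_pairs n] by (simp only: E.r_one)
qed

lemma word_pair_in_pure_pairs: "v \<in> carrier F3 \<Longrightarrow> word_pair v \<in> pure_pairs"
proof -
  assume v: "v \<in> carrier F3"
  have "\<one>\<^bsub>E\<^esub> \<otimes>\<^bsub>E\<^esub> word_pair v \<in> pure_pairs"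
    using v subgroup.one_closed[OF subgroup_inner_pairs] unfolding pure_pairs_def set_mult_def by blast
  moreover have "word_pair v \<in> carrier E" using v word_pair_hom by (auto simp: hom_def)
  ultimately show ?thesis by (simp only: E.l_one)
qed

lemma twist_pair_in_pure_pairs: "j \<in> {1, 2, 3} \<Longrightarrow> twist_pair j \<in> pure_pairs"
  using word_pair_in_pure_pairs[of "gen j"] by (simp only: word_pair_gen gen_F3)

text \<open>
  It suffices to look at the generators, as conjugation by an involution is multiplicative and the
  inner pairs are normal.
\<close>
lemma pure_pairs_involution_normalized:
  assumes A: "A \<in> carrier E" "A \<otimes>\<^bsub>E\<^esub> A = \<one>\<^bsub>E\<^esub>"
    and twist_pair: "\<And>j. j \<in> {1, 2, 3} \<Longrightarrow> A \<otimes>\<^bsub>E\<^esub> twist_pair j \<otimes>\<^bsub>E\<^esub> A \<in> pure_pairs" and q: "q \<in> pure_pairs"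
  shows "A \<otimes>\<^bsub>E\<^esub> q \<otimes>\<^bsub>E\<^esub> A \<in> pure_pairs"
proof -
  have invA: "inv\<^bsub>E\<^esub> A = A" using A by (simp only: E.inv_equality)
  have QC: "x \<in> carrier E" if "x \<in> pure_pairs" for x using subgroup.mem_carrier[OF subgroup_pure_pairs that] .
  have mult: "A \<otimes>\<^bsub>E\<^esub> (x \<otimes>\<^bsub>E\<^esub> y) \<otimes>\<^bsub>E\<^esub> A \<in> pure_pairs"
    if "A \<otimes>\<^bsub>E\<^esub> x \<otimes>\<^bsub>E\<^esub> A \<in> pure_pairs" "A \<otimes>\<^bsub>E\<^esub> y \<otimes>\<^bsub>E\<^esub> A \<in> pure_pairs" "x \<in> carrier E" "y \<in> carrier E" for x y
  proof -
    have "A \<otimes>\<^bsub>E\<^esub> (A \<otimes>\<^bsub>E\<^esub> z) = z" if "z \<in> carrier E" for z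
      using A E.m_assoc[OF A(1) A(1) that] that by (simp only: E.l_one)
    then have "A \<otimes>\<^bsub>E\<^esub> (x \<otimes>\<^bsub>E\<^esub> y) \<otimes>\<^bsub>E\<^esub> A = (A \<otimes>\<^bsub>E\<^esub> x \<otimes>\<^bsub>E\<^esub> A) \<otimes>\<^bsub>E\<^esub> (A \<otimes>\<^bsub>E\<^esub> y \<otimes>\<^bsub>E\<^esub> A)"
      using A(1) that(3,4) by (simp only: E.m_assoc E.m_closed)
    then show ?thesis using subgroup.m_closed[OF subgroup_pure_pairs that(1,2)] by simp
  qed
  have inv: "A \<otimes>\<^bsub>E\<^esub> inv\<^bsub>E\<^esub> x \<otimes>\<^bsub>E\<^esub> A \<in> pure_pairs" if "A \<otimes>\<^bsub>E\<^esub> x \<otimes>\<^bsub>E\<^esub> A \<in> pure_pairs" "x \<in> carrier E" for x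
  proof -
    have "inv\<^bsub>E\<^esub> (A \<otimes>\<^bsub>E\<^esub> x \<otimes>\<^bsub>E\<^esub> A) = A \<otimes>\<^bsub>E\<^esub> inv\<^bsub>E\<^esub> x \<otimes>\<^bsub>E\<^esub> A"
      using A(1) that(2) by (simp only: E.inv_mult_group E.m_closed E.inv_closed invA E.m_assoc)
    then show ?thesis using subgroup.m_inv_closed[OF subgroup_pure_pairs that(1)] by simp
  qed
  have word_pairC: "word_pair v \<in> carrier E" if "v \<in> carrier F3" for v using word_pair_in_pure_pairs[OF that] QC by blast
  have word: "A \<otimes>\<^bsub>E\<^esub> word_pair v \<otimes>\<^bsub>E\<^esub> A \<in> pure_pairs" if "v \<in> carrier F3" for v
    using that
  proof (induction v)
    case Nil
    have "word_pair [] = \<one>\<^bsub>E\<^esub>" unfolding word_pair_def by (rule free_group_lift_Nil)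
    then show ?case using A subgroup.one_closed[OF subgroup_pure_pairs] by (simp only: E.r_one)
  next
    case (Cons a v)
    have j: "fst a \<in> {1, 2, 3}" and v: "v \<in> carrier F3" using Cons_F3[OF Cons.prems] by simp_all
    have "word_pair (a # v) = letter_value E twist_pair a \<otimes>\<^bsub>E\<^esub> word_pair v"
      using free_group_lift_Cons[OF E.is_group Cons.prems[unfolded F3_def], of twist_pair] by (simp add: word_pair_def)
    moreover have "A \<otimes>\<^bsub>E\<^esub> letter_value E twist_pair a \<otimes>\<^bsub>E\<^esub> A \<in> pure_pairs" "letter_value E twist_pair a \<in> carrier E"
      using twist_pair[OF j] inv[OF twist_pair[OF j]] E_mem(5)[OF j] E.inv_closed[OF E_mem(5)[OF j]]
      unfolding letter_value_def by (auto split: if_split simp del: inv_DirProd)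
    ultimately show ?case using mult[OF _ Cons.IH[OF v]] word_pairC[OF v] by simp
  qed
  obtain n v where nv: "q = n \<otimes>\<^bsub>E\<^esub> word_pair v" "n \<in> inner_pairs" "v \<in> carrier F3"
    using q unfolding pure_pairs_def set_mult_def by blast
  have "A \<otimes>\<^bsub>E\<^esub> n \<otimes>\<^bsub>E\<^esub> A \<in> pure_pairs"
    using inner_pairs_normalized[OF nv(2) A(1)] inner_pairs_subset_pure_pairs by (simp only: invA) blast
  then show ?thesis
    using mult[OF _ word[OF nv(3)]] word_pairC[OF nv(3)] subgroup.mem_carrier[OF subgroup_inner_pairs nv(2)] by (simp only: nv(1))
qed

lemma pure_pairs_A_normalized:
  assumes "q \<in> pure_pairs"
  shows "alpha1_pair \<otimes>\<^bsub>E\<^esub> q \<otimes>\<^bsub>E\<^esub> alpha1_pair \<in> pure_pairs" "alpha2_pair \<otimes>\<^bsub>E\<^esub> q \<otimes>\<^bsub>E\<^esub> alpha2_pair \<in> pure_pairs"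
proof -
  have key: "x \<in> pure_pairs" if "x \<otimes>\<^bsub>E\<^esub> twist_pair k = inner_pair h" "x \<in> carrier E" "k \<in> {1, 2, 3}" "h \<in> carrier F3" for x k h
  proof -
    have "x = inner_pair h \<otimes>\<^bsub>E\<^esub> inv\<^bsub>E\<^esub> (twist_pair k)"
      using that(1) E.inv_solve_right[of x "inner_pair h" "twist_pair k"] that(2) E_mem(5)[OF that(3)] hom_in_carrier[OF inner_pair_hom that(4)]
      by (simp only:)
    moreover have "inner_pair h \<in> pure_pairs" using inner_pairs_subset_pure_pairs that(4) by (auto simp: inner_pairs_def)
    ultimately show ?thesis
      using subgroup.m_closed[OF subgroup_pure_pairs] subgroup.m_inv_closed[OF subgroup_pure_pairs twist_pair_in_pure_pairs[OF that(3)]] by simp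
  qed
  have g: "inv\<^bsub>F3\<^esub> (gen j) \<in> carrier F3" if "j \<in> {1, 2, 3}" for j using that by (simp only: gen_F3 F3.inv_closed)
  have 1: "alpha1_pair \<otimes>\<^bsub>E\<^esub> twist_pair j \<otimes>\<^bsub>E\<^esub> alpha1_pair \<in> pure_pairs" "alpha2_pair \<otimes>\<^bsub>E\<^esub> twist_pair j \<otimes>\<^bsub>E\<^esub> alpha2_pair \<in> pure_pairs" if "j \<in> {1, 2, 3}" for j
  proof -
    have "j = 1 \<or> j = 2 \<or> j = 3" using that by simp
    moreover have c: "alpha1_pair \<otimes>\<^bsub>E\<^esub> twist_pair j \<otimes>\<^bsub>E\<^esub> alpha1_pair \<in> carrier E" "alpha2_pair \<otimes>\<^bsub>E\<^esub> twist_pair j \<otimes>\<^bsub>E\<^esub> alpha2_pair \<in> carrier E"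
      using E_mem(1,2) E_mem(5)[OF that] by (simp_all only: E.m_closed)
    ultimately show "alpha1_pair \<otimes>\<^bsub>E\<^esub> twist_pair j \<otimes>\<^bsub>E\<^esub> alpha1_pair \<in> pure_pairs" "alpha2_pair \<otimes>\<^bsub>E\<^esub> twist_pair j \<otimes>\<^bsub>E\<^esub> alpha2_pair \<in> pure_pairs"
      using key[OF twist_pair_relations(1)] key[OF twist_pair_relations(2)] key[OF twist_pair_relations(3)]
        key[OF twist_pair_relations(4)] key[OF twist_pair_relations(5)] key[OF twist_pair_relations(6)] g[of 1] g[of 2] g[of 3]
      by (elim disjE; simp del: mult_DirProd carrier_DirProd)+
  qed
  show "alpha1_pair \<otimes>\<^bsub>E\<^esub> q \<otimes>\<^bsub>E\<^esub> alpha1_pair \<in> pure_pairs" "alpha2_pair \<otimes>\<^bsub>E\<^esub> q \<otimes>\<^bsub>E\<^esub> alpha2_pair \<in> pure_pairs"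
    using pure_pairs_involution_normalized[OF E_mem(1) A_involution(1) 1(1) assms]
      pure_pairs_involution_normalized[OF E_mem(2) A_involution(2) 1(2) assms] by blast+
qed

definition perm_pairs where "perm_pairs = generate E {alpha1_pair, alpha2_pair}"

lemma subgroup_perm_pairs: "subgroup perm_pairs E"
  unfolding perm_pairs_def using E_mem(1,2) by (intro E.generate_is_subgroup) blast

lemma pure_pairs_perm_pairs_normalized:
  assumes "s \<in> perm_pairs" "q \<in> pure_pairs"
  shows "s \<otimes>\<^bsub>E\<^esub> q \<otimes>\<^bsub>E\<^esub> inv\<^bsub>E\<^esub> s \<in> pure_pairs"
  using assms unfolding perm_pairs_def
proof (induction s arbitrary: q rule: generate.induct)
  case one
  then show ?case using subgroup.mem_carrier[OF subgroup_pure_pairs] by (simp only: E.l_one E.r_one E.inv_one)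
next
  case (incl h)
  then show ?case using pure_pairs_A_normalized[OF incl.prems] inv_A by (elim insertE) (simp_all only: empty_iff)
next
  case (inv h)
  then show ?case using pure_pairs_A_normalized[OF inv.prems] inv_A by (elim insertE) (simp_all only: empty_iff)
next
  case (eng h k)
  have hk: "h \<in> carrier E" "k \<in> carrier E"
    using eng(1,2) subgroup.mem_carrier[OF subgroup_perm_pairs] by (simp_all only: perm_pairs_def)
  have "h \<otimes>\<^bsub>E\<^esub> k \<otimes>\<^bsub>E\<^esub> q \<otimes>\<^bsub>E\<^esub> inv\<^bsub>E\<^esub> (h \<otimes>\<^bsub>E\<^esub> k)
      = h \<otimes>\<^bsub>E\<^esub> (k \<otimes>\<^bsub>E\<^esub> q \<otimes>\<^bsub>E\<^esub> inv\<^bsub>E\<^esub> k) \<otimes>\<^bsub>E\<^esub> inv\<^bsub>E\<^esub> h"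
    using hk subgroup.mem_carrier[OF subgroup_pure_pairs eng.prems]
    by (simp only: E.inv_mult_group E.m_assoc E.m_closed E.inv_closed)
  then show ?case using eng.IH(1)[OF eng.IH(2)[OF eng.prems]] by simp
qed

text \<open>
  The two involutions satisfy the braid relation, so the listed products are closed under
  multiplication by either of them.
\<close>
lemma perm_pairs_elements:
  assumes "s \<in> perm_pairs"
  shows "s \<in> {\<one>\<^bsub>E\<^esub>, alpha1_pair, alpha2_pair, alpha1_pair \<otimes>\<^bsub>E\<^esub> alpha2_pair, alpha2_pair \<otimes>\<^bsub>E\<^esub> alpha1_pair, alpha1_pair \<otimes>\<^bsub>E\<^esub> alpha2_pair \<otimes>\<^bsub>E\<^esub> alpha1_pair}" (is "_ \<in> ?F")
proof -
  have cancel: "x \<otimes>\<^bsub>E\<^esub> alpha1_pair \<otimes>\<^bsub>E\<^esub> alpha1_pair = x" "x \<otimes>\<^bsub>E\<^esub> alpha2_pair \<otimes>\<^bsub>E\<^esub> alpha2_pair = x" if "x \<in> carrier E" for x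
    using E.m_assoc[OF that E_mem(1) E_mem(1)] E.m_assoc[OF that E_mem(2) E_mem(2)] E.r_one[OF that]
    by (simp_all only: A_involution)
  have step: "f \<otimes>\<^bsub>E\<^esub> alpha1_pair \<in> ?F" "f \<otimes>\<^bsub>E\<^esub> alpha2_pair \<in> ?F" if "f \<in> ?F" for f
  proof -
    have "alpha1_pair \<otimes>\<^bsub>E\<^esub> alpha2_pair \<otimes>\<^bsub>E\<^esub> alpha1_pair \<otimes>\<^bsub>E\<^esub> alpha2_pair = alpha2_pair \<otimes>\<^bsub>E\<^esub> alpha1_pair"
      using cancel(2)[of "alpha2_pair \<otimes>\<^bsub>E\<^esub> alpha1_pair"] E_mem(1,2) by (simp only: A_braid E.m_closed)
    moreover have "alpha2_pair \<otimes>\<^bsub>E\<^esub> alpha1_pair \<otimes>\<^bsub>E\<^esub> alpha2_pair = alpha1_pair \<otimes>\<^bsub>E\<^esub> alpha2_pair \<otimes>\<^bsub>E\<^esub> alpha1_pair" by (simp only: A_braid)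
    ultimately show "f \<otimes>\<^bsub>E\<^esub> alpha1_pair \<in> ?F" "f \<otimes>\<^bsub>E\<^esub> alpha2_pair \<in> ?F"
      using that E_mem(1,2) cancel E.m_closed A_involution E.l_one
      by (elim insertE; simp only: insert_iff simp_thms empty_iff)+
  qed
  have "\<forall>f\<in>?F. f \<otimes>\<^bsub>E\<^esub> s \<in> ?F"
    using assms unfolding perm_pairs_def
  proof (induction s rule: generate.induct)
    case one
    have "f \<in> carrier E" if "f \<in> ?F" for f
      using that E_mem(1,2) E.m_closed E.one_closed by (elim insertE) (simp_all only: empty_iff)
    then show ?case using E.r_one by (metis (no_types, lifting))
  next
    case (incl h)
    then show ?case using step by (elim insertE) (simp_all only: empty_iff, blast+)
  next
    case (inv h)
    then show ?case using step inv_A by (elim insertE) (simp_all only: empty_iff, blast+)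
  next
    case (eng h k)
    have hk: "h \<in> carrier E" "k \<in> carrier E"
      using eng(1,2) subgroup.mem_carrier[OF subgroup_perm_pairs] by (simp_all only: perm_pairs_def)
    have fC: "f \<in> carrier E" if "f \<in> ?F" for f
      using that E_mem(1,2) E.m_closed E.one_closed by (elim insertE) (simp_all only: empty_iff)
    show ?case
    proof
      fix f assume f: "f \<in> ?F"
      have "f \<otimes>\<^bsub>E\<^esub> h \<otimes>\<^bsub>E\<^esub> k \<in> ?F" using eng.IH f by blast
      then show "f \<otimes>\<^bsub>E\<^esub> (h \<otimes>\<^bsub>E\<^esub> k) \<in> ?F" using E.m_assoc[OF fC[OF f] hk] by (simp only:)
    qed
  qed
  then have "\<one>\<^bsub>E\<^esub> \<otimes>\<^bsub>E\<^esub> s \<in> ?F" by blast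
  then show ?thesis using E.l_one[OF subgroup.mem_carrier[OF subgroup_perm_pairs assms]] by (simp only:)
qed

lemma fst_mult_E: "fst (a \<otimes>\<^bsub>E\<^esub> b) = fst a \<otimes>\<^bsub>C3\<^esub> fst b"
  by (cases a; cases b) simp

lemma fst_one_E: "i \<in> {1, 2, 3} \<Longrightarrow> fst \<one>\<^bsub>E\<^esub> (gen i) = gen i"
  by (simp only: one_DirProd fst_conv C3_one restrict_apply' gen_F3)

lemma perm_pairs_permutes_gens:
  assumes "s \<in> perm_pairs" "i \<in> {1, 2, 3}"
  shows "\<exists>l\<in>{1, 2, 3}. fst s (gen i) = gen l"
proof -
  have a: "\<exists>l\<in>{1, 2, 3}. fst A (gen i) = gen l" if A: "A \<in> {alpha1_pair, alpha2_pair}" and "i \<in> {1, 2, 3}" for A i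
  proof -
    have "i = 1 \<or> i = 2 \<or> i = 3" using that by simp
    moreover have "fst A = alpha 1 \<or> fst A = alpha 2" using A by (auto simp: alpha1_pair_def alpha2_pair_def)
    ultimately show ?thesis by (elim disjE) (simp_all add: alpha_gen)
  qed
  show ?thesis
    using assms unfolding perm_pairs_def
  proof (induction s arbitrary: i rule: generate.induct)
    case one
    then show ?case using fst_one_E[OF one] by blast
  next
    case (incl h)
    then show ?case using a by blast
  next
    case (inv h)
    have "inv\<^bsub>E\<^esub> h = h" using inv.hyps inv_A by blast
    then show ?case using a[OF inv] by (simp only:)
  next
    case (eng h k)
    have hk: "fst h \<in> carrier C3" "fst k \<in> carrier C3"
      using eng(1,2)[folded perm_pairs_def, THEN subgroup.mem_carrier[OF subgroup_perm_pairs]] by auto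
    obtain l where l: "l \<in> {1, 2, 3}" "fst h (gen i) = gen l" using eng.IH(1)[OF eng.prems] by blast
    have "fst (h \<otimes>\<^bsub>E\<^esub> k) (gen i) = fst k (gen l)"
      using eng.prems hk l(2) by (simp only: fst_mult_E C3_mult_apply gen_F3)
    then show ?case using eng.IH(2)[OF l(1)] by (simp only:)
  qed
qed

lemma perm_pairs_faithful:
  assumes s: "s \<in> perm_pairs" and id: "\<And>i. i \<in> {1, 2, 3} \<Longrightarrow> fst s (gen i) = gen i"
  shows "s = \<one>\<^bsub>E\<^esub>"
proof -
  have ne: "gen i \<noteq> gen j" if "i \<noteq> j" for i j :: nat using that by (simp add: gen_def)
  have A: "fst alpha1_pair = alpha 1" "fst alpha2_pair = alpha 2"
    by (simp_all add: alpha1_pair_def alpha2_pair_def)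
  have gC: "gen 1 \<in> carrier F3" "gen 2 \<in> carrier F3" "gen 3 \<in> carrier F3" by simp_all
  have aC: "alpha 1 \<in> carrier C3" "alpha 2 \<in> carrier C3" by (simp_all add: alpha_C3)
  have moved: "fst alpha1_pair (gen 1) = gen 2" "fst alpha2_pair (gen 2) = gen 3" "fst (alpha1_pair \<otimes>\<^bsub>E\<^esub> alpha2_pair) (gen 1) = gen 3"
    "fst (alpha2_pair \<otimes>\<^bsub>E\<^esub> alpha1_pair) (gen 1) = gen 2" "fst (alpha1_pair \<otimes>\<^bsub>E\<^esub> alpha2_pair \<otimes>\<^bsub>E\<^esub> alpha1_pair) (gen 1) = gen 3"
    using gC aC by (simp_all only: fst_mult_E A C3_mult_apply C3.m_closed alpha_gen)
  have "gen 1 \<noteq> (gen 2 :: nat gword)" "gen 1 \<noteq> (gen 3 :: nat gword)" "gen 2 \<noteq> (gen 3 :: nat gword)"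
    by (simp_all add: ne)
  with moved id[of 1] id[of 2] perm_pairs_elements[OF s] show ?thesis
    by (metis empty_iff insert_iff)
qed

text \<open>
  Normal forms: an inner pair, a word in the twist pairs, and a permutation. By the next lemmas this
  is a subgroup containing the graph of the assignment on the generators.
\<close>
definition all_pairs where "all_pairs = pure_pairs <#>\<^bsub>E\<^esub> perm_pairs"

lemma subgroup_all_pairs: "subgroup all_pairs E"
  unfolding all_pairs_def by (rule E.subgroup_set_mult_normalized[OF subgroup_pure_pairs subgroup_perm_pairs pure_pairs_perm_pairs_normalized])

lemma S_eq: "sigma1_pair = alpha1_pair \<otimes>\<^bsub>E\<^esub> twist_pair 1" "sigma2_pair = alpha2_pair \<otimes>\<^bsub>E\<^esub> twist_pair 2"
  by (simp_all add: sigma1_pair_def sigma2_pair_def alpha1_pair_def alpha2_pair_def twist_pair_def twist_def sigma_eq GL_V3_mult fun_eq_iff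
      twist_matrix_apply alpha_linear_relations)

lemma graph_in_all_pairs: "{sigma1_pair, sigma2_pair, alpha1_pair, alpha2_pair} \<subseteq> all_pairs"
proof -
  have A: "alpha1_pair \<in> all_pairs" "alpha2_pair \<in> all_pairs"
  proof -
    have "\<one>\<^bsub>E\<^esub> \<otimes>\<^bsub>E\<^esub> alpha1_pair \<in> all_pairs" "\<one>\<^bsub>E\<^esub> \<otimes>\<^bsub>E\<^esub> alpha2_pair \<in> all_pairs"
      unfolding all_pairs_def set_mult_def perm_pairs_def using subgroup.one_closed[OF subgroup_pure_pairs] 
      by (blast intro: generate.incl)+
    then show "alpha1_pair \<in> all_pairs" "alpha2_pair \<in> all_pairs" using E_mem(1,2) by (simp_all only: E.l_one)
  qed
  moreover have twist_pair: "twist_pair j \<in> all_pairs" if "j \<in> {1, 2, 3}" for j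
  proof -
    have "twist_pair j \<otimes>\<^bsub>E\<^esub> \<one>\<^bsub>E\<^esub> \<in> all_pairs"
      unfolding all_pairs_def set_mult_def using twist_pair_in_pure_pairs[OF that] subgroup.one_closed[OF subgroup_perm_pairs] by blast
    then show ?thesis using E_mem(5)[OF that] by (simp only: E.r_one)
  qed
  ultimately show ?thesis
    using subgroup.m_closed[OF subgroup_all_pairs A(1) twist_pair[of 1]] subgroup.m_closed[OF subgroup_all_pairs A(2) twist_pair[of 2]]
    by (simp only: S_eq) blast
qed

text \<open>
  The three factors are recovered one after the other: the permutation from the action
  on conjugacy classes of generators, the word because it is determined modulo inner automorphisms,
  and finally the inner part because the centre is trivial. Each is trivial if the product
  acts trivially on the free group, and then the matrix is trivial as well.
\<close>
lemma all_pairs_kernel: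
  assumes "(\<one>\<^bsub>C3\<^esub>, M) \<in> all_pairs"
  shows "M = \<one>\<^bsub>GL_V3\<^esub>"
proof -
  obtain h v s where hv: "h \<in> carrier F3" "v \<in> carrier F3" and s: "s \<in> perm_pairs"
    and eq: "(\<one>\<^bsub>C3\<^esub>, M) = inner_pair h \<otimes>\<^bsub>E\<^esub> word_pair v \<otimes>\<^bsub>E\<^esub> s"
    using assms unfolding all_pairs_def pure_pairs_def inner_pairs_def set_mult_def by blast
  define p where "p = inner_auto h \<otimes>\<^bsub>C3\<^esub> word_auto v"
  have p: "p \<in> pure_C3"
    unfolding p_def using hv pure_C3_mult pure_C3_inner_auto pure_C3_word_auto by blast
  then have pC: "p \<in> carrier C3" by (simp add: pure_C3_def)
  have one: "\<one>\<^bsub>C3\<^esub> = p \<otimes>\<^bsub>C3\<^esub> fst s"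
    using arg_cong[OF eq, of fst] by (simp only: fst_mult_E fst_conv fst_word_pair[OF hv(2)] inner_pair_def p_def)
  have sC: "fst s \<in> carrier C3" using subgroup.mem_carrier[OF subgroup_perm_pairs s] by auto
  have "fst s (gen i) = gen i" if i: "i \<in> {1, 2, 3}" for i
  proof -
    obtain k where k: "k \<in> carrier F3" "p (gen i) = conj_by k (gen i)"
      using p i unfolding pure_C3_def by blast
    obtain l where l: "l \<in> {1, 2, 3}" "fst s (gen i) = gen l"
      using perm_pairs_permutes_gens[OF s i] by blast
    have "gen i = \<one>\<^bsub>C3\<^esub> (gen i)"
      using i by (simp only: C3_one restrict_apply' gen_F3)
    also have "\<dots> = fst s (conj_by k (gen i))"
      using pC sC i by (simp only: one C3_mult_apply gen_F3 k(2))
    also have "\<dots> = conj_by (fst s k) (gen l)"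
      using i k(1) l(2) by (simp only: hom_conj_by[OF C3_hom[OF sC]] gen_F3)
    finally have "l = i" using gen_conj_gen[OF C3_closed[OF sC k(1)] l(1) i] by simp
    then show ?thesis using l(2) by simp
  qed
  then have s1: "s = \<one>\<^bsub>E\<^esub>" by (rule perm_pairs_faithful[OF s])
  have "fst s = \<one>\<^bsub>C3\<^esub>" by (simp add: s1)
  then have p1: "p = \<one>\<^bsub>C3\<^esub>" using one C3.r_one[OF pC] by metis
  have w: "word_auto v = inv\<^bsub>C3\<^esub> (inner_auto h)"
    using p1 unfolding p_def using inner_auto_C3[OF hv(1)] word_auto_C3[OF hv(2)]
    by (metis C3.inv_equality C3.inv_inv C3.inv_closed)
  have "inner_auto (inv\<^bsub>F3\<^esub> h) \<otimes>\<^bsub>C3\<^esub> inner_auto h = \<one>\<^bsub>C3\<^esub>"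
  proof -
    have "inner_auto \<one>\<^bsub>F3\<^esub> = \<one>\<^bsub>C3\<^esub>" by (auto simp: inner_auto_def C3_one)
    then show ?thesis using hv(1) by (simp add: inner_auto_mult)
  qed
  then have i: "inv\<^bsub>C3\<^esub> (inner_auto h) = inner_auto (inv\<^bsub>F3\<^esub> h)"
    using inner_auto_C3 hv(1) by (intro C3.inv_equality) simp_all
  have v: "v = []"
    using word_auto_not_inner[OF hv(2) _ F3.inv_closed[OF hv(1)]] w i by metis
  then have "inner_auto h = \<one>\<^bsub>C3\<^esub>"
    using p1 inner_auto_C3[OF hv(1)] by (simp only: p_def word_auto_Nil C3.r_one)
  then have "h = []" by (rule inner_auto_eq_one[OF hv(1)])
  moreover have "word_pair [] = \<one>\<^bsub>E\<^esub>" unfolding word_pair_def by (rule free_group_lift_Nil)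
  ultimately have "(\<one>\<^bsub>C3\<^esub>, M) = inner_pair []"
    using eq s1 v hom_in_carrier[OF inner_pair_hom hv(1)] by (simp only: E.r_one)
  then show ?thesis by (simp add: inner_pair_def weight_one scalar_zero GL_V3_one)
qed

theorem proposition5p3:
  shows "\<exists>\<rho>\<^sub>1. is_rho1 \<rho>\<^sub>1 \<and>
           (\<forall>\<rho>'. is_rho1 \<rho>' \<longrightarrow> (\<forall>g\<in>carrier C3. \<rho>' g = \<rho>\<^sub>1 g)) \<and>
           subgroup (carrier B3) C3 \<and>
           (\<exists>\<rho>. is_Lawrence_Krammer \<rho>) \<and>
           (\<forall>\<rho>. is_Lawrence_Krammer \<rho> \<longrightarrow> (\<forall>\<beta>\<in>carrier B3. \<rho>\<^sub>1 \<beta> = \<rho> \<beta>))"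
proof -
  have "\<exists>\<rho>. group_hom C3 GL_V3 \<rho> \<and> (\<forall>(x, y)\<in>{sigma1_pair, sigma2_pair, alpha1_pair, alpha2_pair}. \<rho> x = y)"
  proof (rule hom_from_graph[OF group_C3 group_GL_V3])
    show "{sigma1_pair, sigma2_pair, alpha1_pair, alpha2_pair} \<subseteq> carrier E" using E_mem(1-4) by blast
    have "fst ` {sigma1_pair, sigma2_pair, alpha1_pair, alpha2_pair} = C3_gens"
      by (simp add: sigma1_pair_def sigma2_pair_def alpha1_pair_def alpha2_pair_def)
    then show "carrier C3 \<subseteq> generate C3 (fst ` {sigma1_pair, sigma2_pair, alpha1_pair, alpha2_pair})"
      using C3_generated by simp
    fix M assume "(\<one>\<^bsub>C3\<^esub>, M) \<in> generate E {sigma1_pair, sigma2_pair, alpha1_pair, alpha2_pair}"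
    then show "M = \<one>\<^bsub>GL_V3\<^esub>"
      using E.generate_subgroup_incl[OF graph_in_all_pairs subgroup_all_pairs] all_pairs_kernel by blast
  qed
  then obtain \<rho>1 where \<rho>1: "group_hom C3 GL_V3 \<rho>1" "\<forall>(x, y)\<in>{sigma1_pair, sigma2_pair, alpha1_pair, alpha2_pair}. \<rho>1 x = y" by blast
  then have is_rho1: "is_rho1 \<rho>1"
    by (simp add: is_rho1_def sigma1_pair_def sigma2_pair_def alpha1_pair_def alpha2_pair_def)
  have hom: "\<rho>1 \<in> hom C3 GL_V3" using \<rho>1(1) by (rule group_hom.homh)
  have unique: "\<rho>' g = \<rho>1 g" if "is_rho1 \<rho>'" "g \<in> carrier C3" for \<rho>' g
  proof (rule hom_eq_on_generate[OF group_C3 group_GL_V3 _ hom C3_gens_subset])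
    show "\<rho>' \<in> hom C3 GL_V3" using that(1) by (simp add: is_rho1_def group_hom.homh)
    show "\<rho>' x = \<rho>1 x" if "x \<in> C3_gens" for x
      using that \<open>is_rho1 \<rho>'\<close> is_rho1 by (auto simp: is_rho1_def)
    show "g \<in> generate C3 C3_gens" using that(2) by (simp add: C3_generated)
  qed
  let ?X = "{sigma 1, sigma 2}"
  have X: "?X \<subseteq> carrier C3" using C3_gens_subset by blast
  have B3: "subgroup (carrier B3) C3"
    unfolding B3_def using C3.generate_is_subgroup[OF X] by simp
  have group_B3: "group B3"
    using C3.subgroup_imp_group[OF C3.generate_is_subgroup[OF X]] by (simp add: B3_def)
  have gen_B3: "generate B3 ?X = carrier B3"
    using C3.generate_consistent[of ?X "generate C3 ?X"] C3.generate_is_subgroup[OF X]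
    by (auto simp: B3_def intro: generate.incl)
  have hom_B3: "\<rho>1 \<in> hom B3 GL_V3"
    using hom subgroup.mem_carrier[OF B3] by (auto simp: hom_def B3_def)
  then have "is_Lawrence_Krammer \<rho>1"
    using is_rho1 by (simp add: is_Lawrence_Krammer_def is_rho1_def group_hom_def group_hom_axioms_def group_B3 group_GL_V3)
  moreover have "\<rho>1 \<beta> = \<rho> \<beta>" if "is_Lawrence_Krammer \<rho>" "\<beta> \<in> carrier B3" for \<rho> \<beta>
  proof (rule hom_eq_on_generate[OF group_B3 group_GL_V3 hom_B3])
    show "\<rho> \<in> hom B3 GL_V3" using that(1) by (simp add: is_Lawrence_Krammer_def group_hom.homh)
    show "?X \<subseteq> carrier B3" by (auto simp: B3_def intro: generate.incl)
    show "\<rho>1 x = \<rho> x" if "x \<in> ?X" for x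
      using that \<open>is_Lawrence_Krammer \<rho>\<close> is_rho1 by (auto simp: is_rho1_def is_Lawrence_Krammer_def)
    show "\<beta> \<in> generate B3 ?X" using that(2) gen_B3 by simp
  qed
  ultimately show ?thesis
    using is_rho1 unique B3 by blast
qed

end
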